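(* For each $k=1,2,3,4$, the category of complete restriction monoids and morphisms of type $k$ is equivalent to the category of restriction quantal frames and morphisms of type $k$.
   Context: **Restriction monoids.** An Ehresmann semigroup is a semigroup $S$ with a non-empty set $E$ of idempotents (the projections) and maps $\lambda,\rho:S\to E$ such that: $E$ is a commutative subsemigroup; $\lambda(a)=\rho(a)=a$ for $a\in E$; $a\lambda(a)=a$ and $\rho(a)a=a$; $\lambda(\lambda(a)b)=\lambda(ab)$ and $\rho(a\rho(b))=\rho(ab)$ for all $a,b\in S$. It is a restriction semigroup if moreover $fa=a\lambda(fa)$ and $af=\rho(af)a$ for all $a\in S$, $f\in E$. The natural partial order is: $a\le b$ iff $a=gb=bf$ for some $f,g\in E$. If $S$ is a monoid with identity $e$, then $E=e^{\downarrow}=\{x:x\le e\}$. Elements $a,b$ of a restriction semigroup are compatible ($a\sim b$) if $a\lambda(b)=b\lambda(a)$ and $\rho(b)a=\rho(a)b$; a subset is compatible if its elements are pairwise compatible. A complete restriction monoid is a restriction monoid such that $E$ is a frame under the natural partial order and every compatible subset has a join in $S$ (including the empty subset, so $S$ has a least element $0$, which is the least projection and a multiplicative zero). Non-empty meets exist in such an $S$. **Morphisms of complete restriction monoids.** A morphism $\varphi:S\to T$ is a semigroup homomorphism commuting with $\lambda$ and $\rho$ whose restriction to projections is a frame morphism $E_S\to E_T$ (preserving all joins and all finite meets, including top). It is proper if for every $t\in T$ there is $X\subseteq T$ with $t=\bigvee X$ such that for each $x\in X$ there is $s\in S$ with $\varphi(s)\ge x$. It is a $\wedge$-morphism if $\varphi(s\wedge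 t)=\varphi(s)\wedge\varphi(t)$ for all $s,t\in S$. **Quantales.** An Ehresmann quantale is a unital quantale $Q$ (a complete lattice with an associative multiplication, with unit $e$, distributing over arbitrary joins on both sides), with maps $\lambda,\rho:Q\to e^{\downarrow}=\{a:a\le e\}$ that preserve arbitrary joins and satisfy: $\lambda(a)=\rho(a)=a$ for $a\le e$; $a=\rho(a)a=a\lambda(a)$; $\lambda(ab)=\lambda(\lambda(a)b)$ and $\rho(ab)=\rho(a\rho(b))$. It is an Ehresmann quantal frame if its underlying lattice is a frame. Besides the lattice order $\le$, $Q$ carries the natural order $\le'$: $a\le' b$ iff $a=gb=bf$ for some $f,g\le e$. An element $a$ is a partial isometry if $b\le a$ implies $b\le' a$. A restriction quantal frame is an Ehresmann quantal frame in which the top element $1$ is a join of partial isometries and the set of partial isometries is closed under multiplication. **Morphisms of restriction quantal frames.** A morphism is a map preserving arbitrary joins, multiplication, the unit, $\lambda$ and $\rho$, and mapping partial isometries to partial isometries. It is proper if it preserves the top element, and a $\wedge$-morphism if it preserves non-empty finite meets. **Types (in both categories).** Type 1: morphisms; type 2: proper morphisms; type 3: $\wedge$-morphisms; type 4: proper $\wedge$-morphisms. *)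

theory Defs
  imports "HOL-Algebra.Group" "HOL-Library.Equipollence"
begin

section \<open>Categories and equivalence of categories\<close>

text \<open>Hom-sets of different pairs of objects need not be disjoint; composition and the arrow part
  of a functor are therefore indexed by the objects involved.
  \<open>Comp C a b c g f\<close> is the composite of \<open>f\<close> from \<open>a\<close> to \<open>b\<close> with \<open>g\<close> from \<open>b\<close> to \<open>c\<close>.\<close>

record ('o, 'm) category =
  Obj :: "'o set"
  Hom :: "'o \<Rightarrow> 'o \<Rightarrow> 'm set"
  Ident :: "'o \<Rightarrow> 'm"
  Comp :: "'o \<Rightarrow> 'o \<Rightarrow> 'o \<Rightarrow> 'm \<Rightarrow> 'm \<Rightarrow> 'm"

definition is_category :: "('o, 'm) category \<Rightarrow> bool" where
  "is_category C \<longleftrightarrow>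
     (\<forall>a \<in> Obj C. Ident C a \<in> Hom C a a) \<and>
     (\<forall>a \<in> Obj C. \<forall>b \<in> Obj C. \<forall>c \<in> Obj C. \<forall>f \<in> Hom C a b. \<forall>g \<in> Hom C b c.
        Comp C a b c g f \<in> Hom C a c) \<and>
     (\<forall>a \<in> Obj C. \<forall>b \<in> Obj C. \<forall>f \<in> Hom C a b.
        Comp C a a b f (Ident C a) = f \<and> Comp C a b b (Ident C b) f = f) \<and>
     (\<forall>a \<in> Obj C. \<forall>b \<in> Obj C. \<forall>c \<in> Obj C. \<forall>d \<in> Obj C.
        \<forall>f \<in> Hom C a b. \<forall>g \<in> Hom C b c. \<forall>h \<in> Hom C c d.
        Comp C a b d (Comp C b c d h g) f = Comp C a c d h (Comp C a b c g f))"

record ('o, 'm, 'p, 'n) functor_data =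
  on_obj :: "'o \<Rightarrow> 'p"
  on_arr :: "'o \<Rightarrow> 'o \<Rightarrow> 'm \<Rightarrow> 'n"

definition is_functor ::
  "('o, 'm) category \<Rightarrow> ('p, 'n) category \<Rightarrow> ('o, 'm, 'p, 'n) functor_data \<Rightarrow> bool" where
  "is_functor C D F \<longleftrightarrow>
     on_obj F \<in> Obj C \<rightarrow> Obj D \<and>
     (\<forall>a \<in> Obj C. \<forall>b \<in> Obj C. \<forall>f \<in> Hom C a b.
        on_arr F a b f \<in> Hom D (on_obj F a) (on_obj F b)) \<and>
     (\<forall>a \<in> Obj C. on_arr F a a (Ident C a) = Ident D (on_obj F a)) \<and>
     (\<forall>a \<in> Obj C. \<forall>b \<in> Obj C. \<forall>c \<in> Obj C. \<forall>f \<in> Hom C a b. \<forall>g \<in> Hom C b c.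
        on_arr F a c (Comp C a b c g f) =
        Comp D (on_obj F a) (on_obj F b) (on_obj F c) (on_arr F b c g) (on_arr F a b f))"

definition id_functor :: "('o, 'm, 'o, 'm) functor_data" where
  "id_functor = \<lparr>on_obj = (\<lambda>a. a), on_arr = (\<lambda>a b f. f)\<rparr>"

definition comp_functor ::
  "('p, 'n, 'q, 'l) functor_data \<Rightarrow> ('o, 'm, 'p, 'n) functor_data \<Rightarrow> ('o, 'm, 'q, 'l) functor_data"
  where
  "comp_functor G F =
     \<lparr>on_obj = (\<lambda>a. on_obj G (on_obj F a)),
      on_arr = (\<lambda>a b f. on_arr G (on_obj F a) (on_obj F b) (on_arr F a b f))\<rparr>"

definition isos :: "('o, 'm) category \<Rightarrow> 'o \<Rightarrow> 'o \<Rightarrow> 'm set" where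
  "isos C a b =
     {f \<in> Hom C a b. \<exists>g \<in> Hom C b a. Comp C a b a g f = Ident C a \<and> Comp C b a b f g = Ident C b}"

definition natural_iso ::
  "('o, 'm) category \<Rightarrow> ('p, 'n) category \<Rightarrow> ('o, 'm, 'p, 'n) functor_data \<Rightarrow>
   ('o, 'm, 'p, 'n) functor_data \<Rightarrow> ('o \<Rightarrow> 'n) \<Rightarrow> bool" where
  "natural_iso C D F G \<eta> \<longleftrightarrow>
     (\<forall>a \<in> Obj C. \<eta> a \<in> isos D (on_obj F a) (on_obj G a)) \<and>
     (\<forall>a \<in> Obj C. \<forall>b \<in> Obj C. \<forall>f \<in> Hom C a b.
        Comp D (on_obj F a) (on_obj F b) (on_obj G b) (\<eta> b) (on_arr F a b f) =
        Comp D (on_obj F a) (on_obj G a) (on_obj G b) (on_arr G a b f) (\<eta> a))"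

definition equivalent_categories :: "('o, 'm) category \<Rightarrow> ('p, 'n) category \<Rightarrow> bool" where
  "equivalent_categories C D \<longleftrightarrow>
     is_category C \<and> is_category D \<and>
     (\<exists>F G \<eta> \<epsilon>. is_functor C D F \<and> is_functor D C G \<and>
        natural_iso C C id_functor (comp_functor G F) \<eta> \<and>
        natural_iso D D (comp_functor F G) id_functor \<epsilon>)"


section \<open>Frames\<close>

locale frame = complete_lattice L for L (structure) +
  assumes meet_join_distrib:
    "\<lbrakk>x \<in> carrier L; A \<subseteq> carrier L\<rbrakk> \<Longrightarrow> x \<sqinter> (\<Squnion>A) = \<Squnion>((\<lambda>y. x \<sqinter> y) ` A)"

text \<open>The empty join and the empty meet (the top element) are included.\<close>

definition frame_morphism :: "('a, 'm) gorder_scheme \<Rightarrow> ('b, 'n) gorder_scheme \<Rightarrow> ('a \<Rightarrow> 'b) \<Rightarrow> bool"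
  where
  "frame_morphism L M f \<longleftrightarrow>
     f \<in> carrier L \<rightarrow> carrier M \<and>
     (\<forall>A. A \<subseteq> carrier L \<longrightarrow> f (\<Squnion>\<^bsub>L\<^esub>A) = \<Squnion>\<^bsub>M\<^esub>(f ` A)) \<and>
     (\<forall>A. A \<subseteq> carrier L \<and> finite A \<longrightarrow> f (\<Sqinter>\<^bsub>L\<^esub>A) = \<Sqinter>\<^bsub>M\<^esub>(f ` A))"


section \<open>Complete restriction monoids\<close>

text \<open>\<open>lam\<close> and \<open>rho\<close> are the maps \<open>\<lambda>\<close> and \<open>\<rho>\<close>, shared by restriction monoids and quantales.\<close>

record 'a lr_monoid = "'a monoid" +
  lam :: "'a \<Rightarrow> 'a"
  rho :: "'a \<Rightarrow> 'a"

record 'a restr_monoid = "'a lr_monoid" +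
  proj :: "'a set"

text \<open>The field \<open>one\<close> plays no role in the next two locales.\<close>

locale ehresmann_semigroup =
  fixes S :: "('a, 'm) restr_monoid_scheme" (structure)
  assumes mult_closed: "\<lbrakk>a \<in> carrier S; b \<in> carrier S\<rbrakk> \<Longrightarrow> a \<otimes> b \<in> carrier S"
    and mult_assoc: "\<lbrakk>a \<in> carrier S; b \<in> carrier S; c \<in> carrier S\<rbrakk> \<Longrightarrow> (a \<otimes> b) \<otimes> c = a \<otimes> (b \<otimes> c)"
    and proj_subset: "proj S \<subseteq> carrier S"
    and proj_nonempty: "proj S \<noteq> {}"
    and proj_idem: "f \<in> proj S \<Longrightarrow> f \<otimes> f = f"
    and proj_mult_closed: "\<lbrakk>f \<in> proj S; g \<in> proj S\<rbrakk> \<Longrightarrow> f \<otimes> g \<in> proj S"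
    and proj_comm: "\<lbrakk>f \<in> proj S; g \<in> proj S\<rbrakk> \<Longrightarrow> f \<otimes> g = g \<otimes> f"
    and lam_proj: "a \<in> carrier S \<Longrightarrow> lam S a \<in> proj S"
    and rho_proj: "a \<in> carrier S \<Longrightarrow> rho S a \<in> proj S"
    and lam_id: "f \<in> proj S \<Longrightarrow> lam S f = f"
    and rho_id: "f \<in> proj S \<Longrightarrow> rho S f = f"
    and mult_lam: "a \<in> carrier S \<Longrightarrow> a \<otimes> lam S a = a"
    and rho_mult: "a \<in> carrier S \<Longrightarrow> rho S a \<otimes> a = a"
    and lam_lam_mult: "\<lbrakk>a \<in> carrier S; b \<in> carrier S\<rbrakk> \<Longrightarrow> lam S (lam S a \<otimes> b) = lam S (a \<otimes> b)"
    and rho_mult_rho: "\<lbrakk>a \<in> carrier S; b \<in> carrier S\<rbrakk> \<Longrightarrow> rho S (a \<otimes> rho S b) = rho S (a \<otimes> b)"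

locale restriction_semigroup = ehresmann_semigroup +
  assumes proj_mult: "\<lbrakk>a \<in> carrier S; f \<in> proj S\<rbrakk> \<Longrightarrow> f \<otimes> a = a \<otimes> lam S (f \<otimes> a)"
    and mult_proj: "\<lbrakk>a \<in> carrier S; f \<in> proj S\<rbrakk> \<Longrightarrow> a \<otimes> f = rho S (a \<otimes> f) \<otimes> a"

locale restriction_monoid = restriction_semigroup S + monoid S
  for S :: "('a, 'm) restr_monoid_scheme" (structure)

text \<open>The natural order relative to a set \<open>E\<close> of projections.\<close>

definition nat_le :: "('a, 'm) monoid_scheme \<Rightarrow> 'a set \<Rightarrow> 'a \<Rightarrow> 'a \<Rightarrow> bool" where
  "nat_le M E a b \<longleftrightarrow> (\<exists>g \<in> E. \<exists>f \<in> E. a = g \<otimes>\<^bsub>M\<^esub> b \<and> a = b \<otimes>\<^bsub>M\<^esub> f)"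

definition nat_order :: "('a, 'm) restr_monoid_scheme \<Rightarrow> 'a gorder" where
  "nat_order S = \<lparr>carrier = carrier S, eq = (=), le = nat_le S (proj S)\<rparr>"

definition proj_order :: "('a, 'm) restr_monoid_scheme \<Rightarrow> 'a gorder" where
  "proj_order S = \<lparr>carrier = proj S, eq = (=), le = nat_le S (proj S)\<rparr>"

definition compatible :: "('a, 'm) restr_monoid_scheme \<Rightarrow> 'a \<Rightarrow> 'a \<Rightarrow> bool" where
  "compatible S a b \<longleftrightarrow>
     a \<otimes>\<^bsub>S\<^esub> lam S b = b \<otimes>\<^bsub>S\<^esub> lam S a \<and> rho S b \<otimes>\<^bsub>S\<^esub> a = rho S a \<otimes>\<^bsub>S\<^esub> b"

locale complete_restriction_monoid = restriction_monoid +
  assumes proj_frame: "frame (proj_order S)"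
    and compatible_join:
      "\<lbrakk>A \<subseteq> carrier S; \<And>a b. \<lbrakk>a \<in> A; b \<in> A\<rbrakk> \<Longrightarrow> compatible S a b\<rbrakk>
       \<Longrightarrow> \<exists>s. is_lub (nat_order S) s A"

text \<open>Morphisms are functions on the carrier, represented canonically by being \<^const>\<open>undefined\<close>
  outside it, so that equality of arrows is equality of functions on the carrier.\<close>

definition crm_morphism ::
  "('a, 'm) restr_monoid_scheme \<Rightarrow> ('b, 'n) restr_monoid_scheme \<Rightarrow> ('a \<Rightarrow> 'b) \<Rightarrow> bool" where
  "crm_morphism S T \<phi> \<longleftrightarrow>
     \<phi> \<in> carrier S \<rightarrow>\<^sub>E carrier T \<and>
     \<phi> \<in> hom S T \<and>
     (\<forall>a \<in> carrier S. \<phi> (lam S a) = lam T (\<phi> a) \<and> \<phi> (rho S a) = rho T (\<phi> a)) \<and>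
     frame_morphism (proj_order S) (proj_order T) \<phi>"

definition crm_proper ::
  "('a, 'm) restr_monoid_scheme \<Rightarrow> ('b, 'n) restr_monoid_scheme \<Rightarrow> ('a \<Rightarrow> 'b) \<Rightarrow> bool" where
  "crm_proper S T \<phi> \<longleftrightarrow>
     (\<forall>t \<in> carrier T. \<exists>X \<subseteq> carrier T. is_lub (nat_order T) t X \<and>
        (\<forall>x \<in> X. \<exists>s \<in> carrier S. x \<sqsubseteq>\<^bsub>nat_order T\<^esub> \<phi> s))"

definition crm_meet_preserving ::
  "('a, 'm) restr_monoid_scheme \<Rightarrow> ('b, 'n) restr_monoid_scheme \<Rightarrow> ('a \<Rightarrow> 'b) \<Rightarrow> bool" where
  "crm_meet_preserving S T \<phi> \<longleftrightarrow>
     (\<forall>s \<in> carrier S. \<forall>t \<in> carrier S.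
        \<phi> (s \<sqinter>\<^bsub>nat_order S\<^esub> t) = \<phi> s \<sqinter>\<^bsub>nat_order T\<^esub> \<phi> t)"

definition crm_morphisms ::
  "nat \<Rightarrow> ('a, 'm) restr_monoid_scheme \<Rightarrow> ('b, 'n) restr_monoid_scheme \<Rightarrow> ('a \<Rightarrow> 'b) set" where
  "crm_morphisms k S T =
     {\<phi>. crm_morphism S T \<phi> \<and>
         (k \<in> {2, 4} \<longrightarrow> crm_proper S T \<phi>) \<and>
         (k \<in> {3, 4} \<longrightarrow> crm_meet_preserving S T \<phi>)}"


section \<open>Restriction quantal frames\<close>

record 'a lr_quantale = "'a lr_monoid" +
  qle :: "'a \<Rightarrow> 'a \<Rightarrow> bool"

definition lat :: "('a, 'm) lr_quantale_scheme \<Rightarrow> 'a gorder" where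
  "lat Q = \<lparr>carrier = carrier Q, eq = (=), le = qle Q\<rparr>"

definition below_one :: "('a, 'm) lr_quantale_scheme \<Rightarrow> 'a set" where
  "below_one Q = {a \<in> carrier Q. qle Q a \<one>\<^bsub>Q\<^esub>}"

locale unital_quantale = monoid Q for Q :: "('a, 'm) lr_quantale_scheme" (structure) +
  assumes complete: "complete_lattice (lat Q)"
    and mult_join: "\<lbrakk>a \<in> carrier Q; A \<subseteq> carrier Q\<rbrakk>
        \<Longrightarrow> a \<otimes> (\<Squnion>\<^bsub>lat Q\<^esub>A) = \<Squnion>\<^bsub>lat Q\<^esub>((\<lambda>b. a \<otimes> b) ` A)"
    and join_mult: "\<lbrakk>a \<in> carrier Q; A \<subseteq> carrier Q\<rbrakk>
        \<Longrightarrow> (\<Squnion>\<^bsub>lat Q\<^esub>A) \<otimes> a = \<Squnion>\<^bsub>lat Q\<^esub>((\<lambda>b. b \<otimes> a) ` A)"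

locale ehresmann_quantale = unital_quantale +
  assumes lam_below: "a \<in> carrier Q \<Longrightarrow> lam Q a \<in> below_one Q"
    and rho_below: "a \<in> carrier Q \<Longrightarrow> rho Q a \<in> below_one Q"
    and lam_join: "A \<subseteq> carrier Q \<Longrightarrow> lam Q (\<Squnion>\<^bsub>lat Q\<^esub>A) = \<Squnion>\<^bsub>lat Q\<^esub>(lam Q ` A)"
    and rho_join: "A \<subseteq> carrier Q \<Longrightarrow> rho Q (\<Squnion>\<^bsub>lat Q\<^esub>A) = \<Squnion>\<^bsub>lat Q\<^esub>(rho Q ` A)"
    and lam_id: "a \<in> below_one Q \<Longrightarrow> lam Q a = a"
    and rho_id: "a \<in> below_one Q \<Longrightarrow> rho Q a = a"
    and rho_mult: "a \<in> carrier Q \<Longrightarrow> a = rho Q a \<otimes> a"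
    and mult_lam: "a \<in> carrier Q \<Longrightarrow> a = a \<otimes> lam Q a"
    and lam_mult: "\<lbrakk>a \<in> carrier Q; b \<in> carrier Q\<rbrakk> \<Longrightarrow> lam Q (a \<otimes> b) = lam Q (lam Q a \<otimes> b)"
    and rho_mult_rho: "\<lbrakk>a \<in> carrier Q; b \<in> carrier Q\<rbrakk> \<Longrightarrow> rho Q (a \<otimes> b) = rho Q (a \<otimes> rho Q b)"

locale ehresmann_quantal_frame = ehresmann_quantale +
  assumes lat_frame: "frame (lat Q)"

definition partial_isometries :: "('a, 'm) lr_quantale_scheme \<Rightarrow> 'a set" where
  "partial_isometries Q =
     {a \<in> carrier Q. \<forall>b \<in> carrier Q. qle Q b a \<longrightarrow> nat_le Q (below_one Q) b a}"

locale restriction_quantal_frame = ehresmann_quantal_frame +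
  assumes top_join: "\<exists>A \<subseteq> partial_isometries Q. \<top>\<^bsub>lat Q\<^esub> = \<Squnion>\<^bsub>lat Q\<^esub>A"
    and partial_isometries_mult:
      "\<lbrakk>a \<in> partial_isometries Q; b \<in> partial_isometries Q\<rbrakk> \<Longrightarrow> a \<otimes> b \<in> partial_isometries Q"

definition rqf_morphism ::
  "('a, 'm) lr_quantale_scheme \<Rightarrow> ('b, 'n) lr_quantale_scheme \<Rightarrow> ('a \<Rightarrow> 'b) \<Rightarrow> bool" where
  "rqf_morphism Q R \<theta> \<longleftrightarrow>
     \<theta> \<in> carrier Q \<rightarrow>\<^sub>E carrier R \<and>
     (\<forall>A. A \<subseteq> carrier Q \<longrightarrow> \<theta> (\<Squnion>\<^bsub>lat Q\<^esub>A) = \<Squnion>\<^bsub>lat R\<^esub>(\<theta> ` A)) \<and>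
     \<theta> \<in> hom Q R \<and>
     \<theta> \<one>\<^bsub>Q\<^esub> = \<one>\<^bsub>R\<^esub> \<and>
     (\<forall>a \<in> carrier Q. \<theta> (lam Q a) = lam R (\<theta> a) \<and> \<theta> (rho Q a) = rho R (\<theta> a)) \<and>
     \<theta> \<in> partial_isometries Q \<rightarrow> partial_isometries R"

definition rqf_proper ::
  "('a, 'm) lr_quantale_scheme \<Rightarrow> ('b, 'n) lr_quantale_scheme \<Rightarrow> ('a \<Rightarrow> 'b) \<Rightarrow> bool" where
  "rqf_proper Q R \<theta> \<longleftrightarrow> \<theta> \<top>\<^bsub>lat Q\<^esub> = \<top>\<^bsub>lat R\<^esub>"

definition rqf_meet_preserving ::
  "('a, 'm) lr_quantale_scheme \<Rightarrow> ('b, 'n) lr_quantale_scheme \<Rightarrow> ('a \<Rightarrow> 'b) \<Rightarrow> bool" where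
  "rqf_meet_preserving Q R \<theta> \<longleftrightarrow>
     (\<forall>A. A \<subseteq> carrier Q \<and> finite A \<and> A \<noteq> {} \<longrightarrow> \<theta> (\<Sqinter>\<^bsub>lat Q\<^esub>A) = \<Sqinter>\<^bsub>lat R\<^esub>(\<theta> ` A))"

definition rqf_morphisms ::
  "nat \<Rightarrow> ('a, 'm) lr_quantale_scheme \<Rightarrow> ('b, 'n) lr_quantale_scheme \<Rightarrow> ('a \<Rightarrow> 'b) set" where
  "rqf_morphisms k Q R =
     {\<theta>. rqf_morphism Q R \<theta> \<and>
         (k \<in> {2, 4} \<longrightarrow> rqf_proper Q R \<theta>) \<and>
         (k \<in> {3, 4} \<longrightarrow> rqf_meet_preserving Q R \<theta>)}"


section \<open>The two categories\<close>

text \<open>A category has a set of objects, and all structures of one kind do not live in a single type.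
  The objects are therefore the structures whose carrier is a subset of a given type and which
  satisfy a size condition \<open>P\<close>. Two kinds of size condition are of interest. One bounds the carriers
  on both sides by membership in a family of small sets (\<open>size_universe\<close> below). The other admits every
  complete restriction monoid with carrier inside a type \<open>'a\<close>; as a restriction quantal frame with
  at most \<open>\<kappa>\<close> partial isometries can have \<open>2\<^sup>\<kappa>\<close> elements, the corresponding quantales are
  those with carrier inside \<open>'a set\<close> and at most as many partial isometries as \<open>'a\<close> has elements.
  Every structure over any type occurs, up to isomorphism, for a suitable choice of \<open>'a\<close>.\<close>

definition crm_category ::
  "nat \<Rightarrow> ('a restr_monoid \<Rightarrow> bool) \<Rightarrow> ('a restr_monoid, 'a \<Rightarrow> 'a) category" where
  "crm_category k P =
     \<lparr>Obj = {S. complete_restriction_monoid S \<and> P S},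
      Hom = crm_morphisms k,
      Ident = (\<lambda>S. \<lambda>x\<in>carrier S. x),
      Comp = (\<lambda>S T U g f. compose (carrier S) g f)\<rparr>"

definition rqf_category ::
  "nat \<Rightarrow> ('a lr_quantale \<Rightarrow> bool) \<Rightarrow> ('a lr_quantale, 'a \<Rightarrow> 'a) category" where
  "rqf_category k P =
     \<lparr>Obj = {Q. restriction_quantal_frame Q \<and> P Q},
      Hom = rqf_morphisms k,
      Ident = (\<lambda>Q. \<lambda>x\<in>carrier Q. x),
      Comp = (\<lambda>Q R T g f. compose (carrier Q) g f)\<rparr>"

text \<open>A family of small sets: closed under passing to sets of at most the same size and, up to
  bijection, under power sets. Examples are the subsets of \<open>'u\<close> that are in bijection with an
  element of a Grothendieck universe, the subsets of cardinality below a strong limit cardinal,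
  and the finite subsets of an infinite type.\<close>

definition size_universe :: "'u set set \<Rightarrow> bool" where
  "size_universe U \<longleftrightarrow>
     (\<forall>A \<in> U. \<forall>B. B \<lesssim> A \<longrightarrow> B \<in> U) \<and> (\<forall>A \<in> U. \<exists>B \<in> U. Pow A \<approx> B)"

end

theory Submission
  imports Defs "HOL-Algebra.Complete_Lattice" "HOL-Algebra.Coset"
begin

text \<open>A restriction quantal frame \<open>Q\<close> is sent to the monoid of its partial isometries, and a morphism to
  its restriction. This functor is fully faithful and essentially surjective.

  It is faithful because the partial isometries generate \<open>Q\<close> under joins: the top element is a
  join of partial isometries, everything below a partial isometry is again one, and meets
  distribute over joins. It is full because a morphism \<open>\<phi>\<close> of monoids extends to \<open>Q\<close>
  by sending \<open>a\<close> to the join of all \<open>\<phi> p\<close> with \<open>p \<le> a\<close> a partial isometry. The point is that this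
  extension preserves joins (\<open>extend_join_le\<close>): if \<open>p\<close> lies below the join of \<open>X\<close>, then \<open>p\<close> is the join of
  restrictions \<open>p \<otimes> f\<close> by projections such that \<open>p \<otimes> f\<close> is below a member of \<open>X\<close>, and \<open>\<phi>\<close> preserves
  joins of projections. Properness says on either side that the top element of the target
  quantal frame is the join of the elements below images of partial isometries, and binary meets of partial isometries are the same in the monoid and in \<open>Q\<close>, so the
  four types of morphisms correspond to each other (\<open>bij_betw_transfer\<close>).

  Essential surjectivity means that every complete restriction monoid \<open>S\<close> is the monoid of partial
  isometries of some \<open>Q\<close>. Let \<open>Q\<close> consist of the order ideals of \<open>S\<close> that are closed under existing
  joins, with the closure of the elementwise product as product. Multiplication, \<open>lam\<close> and \<open>rho\<close> preserve
  existing joins of \<open>S\<close>, since such joins can be tested on projections, where the frame law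
  holds (\<open>lub_lam\<close>, \<open>lub_mult_left\<close>); this makes \<open>Q\<close> a quantal frame. Its partial isometries are
  exactly the principal ideals (\<open>partial_isometries_Q\<close>): a closed ideal that is a partial isometry
  is compatible, so it contains its own join.

  Both constructions are combined with bijections that move the structures into the types and
  sets prescribed by the size conditions. For this reason the correspondence is developed for
  an arbitrary bijection from a monoid onto the partial isometries of a quantal frame.\<close>

section \<open>Fully faithful, essentially surjective functors\<close>

text \<open>A quasi-inverse of \<open>G\<close> is obtained by choosing for every object \<open>c\<close> of \<open>C\<close> an object \<open>F0 c\<close> and an
  isomorphism \<open>\<eta> c\<close> from \<open>c\<close> to its image. An arrow \<open>f\<close> is sent to the unique preimage of
  \<open>\<eta> b \<circ> f \<circ> (\<eta> a)\<inverse>\<close>, which makes \<open>\<eta>\<close> natural, and the preimages of the inverses of \<open>\<eta>\<close> form the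
  counit. All equations in \<open>D\<close> are checked after applying the faithful functor \<open>G\<close>.\<close>

lemma equivalent_categories_if_fully_faithful:
  assumes C: "is_category C" and D: "is_category D" and G: "is_functor D C G"
    and ff: "\<And>a b. \<lbrakk>a \<in> Obj D; b \<in> Obj D\<rbrakk> \<Longrightarrow>
      bij_betw (on_arr G a b) (Hom D a b) (Hom C (on_obj G a) (on_obj G b))"
    and eso: "\<And>c. c \<in> Obj C \<Longrightarrow> \<exists>d \<in> Obj D. isos C c (on_obj G d) \<noteq> {}"
  shows "equivalent_categories C D"
proof -
  have id_in: "Ident C a \<in> Hom C a a" if "a \<in> Obj C" for a
    using C that by (simp add: is_category_def)
  have comp_in: "Comp C a b c g f \<in> Hom C a c"
    if "a \<in> Obj C" "b \<in> Obj C" "c \<in> Obj C" "f \<in> Hom C a b" "g \<in> Hom C b c" for a b c f g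
    using C that by (simp add: is_category_def)
  have id_right: "Comp C a a b f (Ident C a) = f" and id_left: "Comp C a b b (Ident C b) f = f"
    if "a \<in> Obj C" "b \<in> Obj C" "f \<in> Hom C a b" for a b f
    using C that by (simp_all add: is_category_def)
  have assoc: "Comp C a b d (Comp C b c d h g) f = Comp C a c d h (Comp C a b c g f)"
    if "a \<in> Obj C" "b \<in> Obj C" "c \<in> Obj C" "d \<in> Obj C"
      "f \<in> Hom C a b" "g \<in> Hom C b c" "h \<in> Hom C c d" for a b c d f g h
    using C that by (simp add: is_category_def)
  have Did_in: "Ident D a \<in> Hom D a a" if "a \<in> Obj D" for a
    using D that by (simp add: is_category_def)
  have Dcomp_in: "Comp D a b c g f \<in> Hom D a c"
    if "a \<in> Obj D" "b \<in> Obj D" "c \<in> Obj D" "f \<in> Hom D a b" "g \<in> Hom D b c" for a b c f g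
    using D that by (simp add: is_category_def)
  have G_obj: "on_obj G a \<in> Obj C" if "a \<in> Obj D" for a
    using G that by (auto simp: is_functor_def)
  have G_arr: "on_arr G a b f \<in> Hom C (on_obj G a) (on_obj G b)"
    if "a \<in> Obj D" "b \<in> Obj D" "f \<in> Hom D a b" for a b f
    using G that by (auto simp: is_functor_def)
  have G_id: "on_arr G a a (Ident D a) = Ident C (on_obj G a)" if "a \<in> Obj D" for a
    using G that by (auto simp: is_functor_def)
  have G_comp: "on_arr G a c (Comp D a b c g f) =
      Comp C (on_obj G a) (on_obj G b) (on_obj G c) (on_arr G b c g) (on_arr G a b f)"
    if "a \<in> Obj D" "b \<in> Obj D" "c \<in> Obj D" "f \<in> Hom D a b" "g \<in> Hom D b c" for a b c f g
    using G that by (auto simp: is_functor_def)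
  define L where "L a b f = inv_into (Hom D a b) (on_arr G a b) f" for a b f
  have L_in: "L a b f \<in> Hom D a b" and GL: "on_arr G a b (L a b f) = f"
    if "a \<in> Obj D" "b \<in> Obj D" "f \<in> Hom C (on_obj G a) (on_obj G b)" for a b f
  proof -
    have "f \<in> on_arr G a b ` Hom D a b"
      using ff[OF that(1,2)] that(3) by (simp add: bij_betw_def)
    then show "L a b f \<in> Hom D a b" "on_arr G a b (L a b f) = f"
      unfolding L_def by (rule inv_into_into, rule f_inv_into_f)
  qed
  have faithful: "f = g"
    if "a \<in> Obj D" "b \<in> Obj D" "f \<in> Hom D a b" "g \<in> Hom D a b" "on_arr G a b f = on_arr G a b g"
    for a b f g
    using ff[OF that(1,2)] that(3-) by (auto simp: bij_betw_def dest: inj_onD)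
  obtain F0 \<eta> where F0: "F0 c \<in> Obj D" and \<eta>_iso: "\<eta> c \<in> isos C c (on_obj G (F0 c))"
    if "c \<in> Obj C" for c
  proof -
    have "\<forall>c \<in> Obj C. \<exists>p. fst p \<in> Obj D \<and> snd p \<in> isos C c (on_obj G (fst p))"
      using eso by fastforce
    then obtain p where "\<forall>c \<in> Obj C. fst (p c) \<in> Obj D \<and> snd (p c) \<in> isos C c (on_obj G (fst (p c)))"
      by metis
    then show thesis using that[of "\<lambda>c. fst (p c)" "\<lambda>c. snd (p c)"] by blast
  qed
  have "\<exists>g \<in> Hom C (on_obj G (F0 c)) c.
      Comp C c (on_obj G (F0 c)) c g (\<eta> c) = Ident C c \<and>
      Comp C (on_obj G (F0 c)) c (on_obj G (F0 c)) (\<eta> c) g = Ident C (on_obj G (F0 c))"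
    if "c \<in> Obj C" for c
    using \<eta>_iso[OF that] by (simp add: isos_def)
  then obtain \<zeta> where \<zeta>_in: "\<zeta> c \<in> Hom C (on_obj G (F0 c)) c"
    and \<zeta>\<eta>: "Comp C c (on_obj G (F0 c)) c (\<zeta> c) (\<eta> c) = Ident C c"
    and \<eta>\<zeta>: "Comp C (on_obj G (F0 c)) c (on_obj G (F0 c)) (\<eta> c) (\<zeta> c) = Ident C (on_obj G (F0 c))"
    if "c \<in> Obj C" for c
    by metis
  have \<eta>_in: "\<eta> c \<in> Hom C c (on_obj G (F0 c))" if "c \<in> Obj C" for c
    using \<eta>_iso[OF that] by (simp add: isos_def)
  have GF0: "on_obj G (F0 c) \<in> Obj C" if "c \<in> Obj C" for c
    using that by (intro G_obj F0)
  \<comment> \<open>the arrow \<open>f\<close> conjugated by the isomorphisms \<open>\<eta>\<close>\<close>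
  define K where "K a b f = Comp C (on_obj G (F0 a)) a (on_obj G (F0 b))
      (Comp C a b (on_obj G (F0 b)) (\<eta> b) f) (\<zeta> a)" for a b f
  have K_in: "K a b f \<in> Hom C (on_obj G (F0 a)) (on_obj G (F0 b))"
    if "a \<in> Obj C" "b \<in> Obj C" "f \<in> Hom C a b" for a b f
    unfolding K_def using that by (intro comp_in GF0 \<eta>_in \<zeta>_in)
  have K\<eta>: "Comp C a (on_obj G (F0 a)) (on_obj G (F0 b)) (K a b f) (\<eta> a)
      = Comp C a b (on_obj G (F0 b)) (\<eta> b) f"
    if "a \<in> Obj C" "b \<in> Obj C" "f \<in> Hom C a b" for a b f
    unfolding K_def using that
    by (simp add: assoc comp_in GF0 \<eta>_in \<zeta>_in \<zeta>\<eta> id_right)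
  have K_unique: "h = K a b f"
    if h: "h \<in> Hom C (on_obj G (F0 a)) (on_obj G (F0 b))"
      and ab: "a \<in> Obj C" "b \<in> Obj C" and f: "f \<in> Hom C a b"
      and eq: "Comp C a (on_obj G (F0 a)) (on_obj G (F0 b)) h (\<eta> a)
        = Comp C a b (on_obj G (F0 b)) (\<eta> b) f"
    for a b f h
  proof -
    have "h = Comp C (on_obj G (F0 a)) (on_obj G (F0 a)) (on_obj G (F0 b)) h
        (Comp C (on_obj G (F0 a)) a (on_obj G (F0 a)) (\<eta> a) (\<zeta> a))"
      using h ab by (simp add: \<eta>\<zeta> id_right GF0)
    also have "\<dots> = Comp C (on_obj G (F0 a)) a (on_obj G (F0 b))
        (Comp C a (on_obj G (F0 a)) (on_obj G (F0 b)) h (\<eta> a)) (\<zeta> a)"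
      using h ab by (simp add: assoc GF0 \<eta>_in \<zeta>_in)
    finally show ?thesis unfolding eq K_def .
  qed
  define F where "F = \<lparr>on_obj = F0, on_arr = (\<lambda>a b f. L (F0 a) (F0 b) (K a b f))\<rparr>"
  have F: "is_functor C D F"
    unfolding is_functor_def
  proof (intro conjI ballI)
    show "on_obj F \<in> Obj C \<rightarrow> Obj D" using F0 by (auto simp: F_def)
  next
    fix a b f assume "a \<in> Obj C" "b \<in> Obj C" "f \<in> Hom C a b"
    then show "on_arr F a b f \<in> Hom D (on_obj F a) (on_obj F b)"
      by (simp add: F_def L_in F0 K_in)
  next
    fix a assume a: "a \<in> Obj C"
    have "Ident C (on_obj G (F0 a)) = K a a (Ident C a)"
      using a by (intro K_unique) (simp_all add: id_in GF0 id_left id_right \<eta>_in)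
    then have "on_arr G (F0 a) (F0 a) (on_arr F a a (Ident C a)) = on_arr G (F0 a) (F0 a) (Ident D (F0 a))"
      using a by (simp add: F_def GL F0 K_in id_in G_id)
    then show "on_arr F a a (Ident C a) = Ident D (on_obj F a)"
      using a by (intro faithful[of "F0 a" "F0 a"]) (simp_all add: F_def L_in F0 K_in id_in Did_in)
  next
    fix a b c f g
    assume o: "a \<in> Obj C" "b \<in> Obj C" "c \<in> Obj C" and f: "f \<in> Hom C a b" and g: "g \<in> Hom C b c"
    let ?GF = "\<lambda>a. on_obj G (F0 a)"
    have "Comp C (?GF a) (?GF b) (?GF c) (K b c g) (K a b f) = K a c (Comp C a b c g f)"
    proof (intro K_unique)
      have "Comp C a (?GF a) (?GF c) (Comp C (?GF a) (?GF b) (?GF c) (K b c g) (K a b f)) (\<eta> a)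
          = Comp C a (?GF b) (?GF c) (K b c g) (Comp C a b (?GF b) (\<eta> b) f)"
        using o f g by (simp add: assoc GF0 \<eta>_in K_in K\<eta>)
      also have "\<dots> = Comp C a b (?GF c) (Comp C b (?GF b) (?GF c) (K b c g) (\<eta> b)) f"
        using o f g by (simp add: assoc GF0 \<eta>_in K_in)
      also have "\<dots> = Comp C a c (?GF c) (\<eta> c) (Comp C a b c g f)"
        using o f g by (simp add: assoc GF0 \<eta>_in K\<eta>)
      finally show "Comp C a (?GF a) (?GF c) (Comp C (?GF a) (?GF b) (?GF c) (K b c g) (K a b f)) (\<eta> a)
          = Comp C a c (?GF c) (\<eta> c) (Comp C a b c g f)" .
    qed (use o f g in \<open>auto intro: comp_in GF0 K_in\<close>)
    then show "on_arr F a c (Comp C a b c g f) =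
        Comp D (on_obj F a) (on_obj F b) (on_obj F c) (on_arr F b c g) (on_arr F a b f)"
      using o f g
      by (intro faithful[of "F0 a" "F0 c"]) (simp_all add: F_def L_in F0 K_in comp_in Dcomp_in G_comp GL)
  qed
  have \<eta>: "natural_iso C C id_functor (comp_functor G F) \<eta>"
    unfolding natural_iso_def id_functor_def comp_functor_def
    by (auto simp: F_def \<eta>_iso GL F0 K_in K\<eta>)
  define \<epsilon> where "\<epsilon> d = L (F0 (on_obj G d)) d (\<zeta> (on_obj G d))" for d
  have \<epsilon>_in: "\<epsilon> d \<in> Hom D (F0 (on_obj G d)) d"
    and G\<epsilon>: "on_arr G (F0 (on_obj G d)) d (\<epsilon> d) = \<zeta> (on_obj G d)" if "d \<in> Obj D" for d
    unfolding \<epsilon>_def using that by (simp_all add: L_in GL F0 G_obj \<zeta>_in)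
  have \<epsilon>: "natural_iso D D (comp_functor F G) id_functor \<epsilon>"
    unfolding natural_iso_def
  proof (intro conjI ballI)
    fix d assume d: "d \<in> Obj D"
    define \<delta> where "\<delta> = L d (F0 (on_obj G d)) (\<eta> (on_obj G d))"
    have \<delta>: "\<delta> \<in> Hom D d (F0 (on_obj G d))"
        "on_arr G d (F0 (on_obj G d)) \<delta> = \<eta> (on_obj G d)"
      unfolding \<delta>_def using d by (simp_all add: L_in GL F0 G_obj \<eta>_in)
    have "Comp D (F0 (on_obj G d)) d (F0 (on_obj G d)) \<delta> (\<epsilon> d) = Ident D (F0 (on_obj G d))"
      using d \<delta> \<epsilon>_in G\<epsilon>
      by (intro faithful[of "F0 (on_obj G d)" "F0 (on_obj G d)"])
        (simp_all add: F0 G_obj Dcomp_in Did_in G_comp G_id \<eta>\<zeta>)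
    moreover have "Comp D d (F0 (on_obj G d)) d (\<epsilon> d) \<delta> = Ident D d"
      using d \<delta> \<epsilon>_in G\<epsilon>
      by (intro faithful[of d d]) (simp_all add: F0 G_obj Dcomp_in Did_in G_comp G_id \<zeta>\<eta>)
    ultimately show "\<epsilon> d \<in> isos D (on_obj (comp_functor F G) d) (on_obj id_functor d)"
      using \<epsilon>_in[OF d] \<delta>(1) by (auto simp: isos_def comp_functor_def id_functor_def F_def)
  next
    fix a b f assume ab: "a \<in> Obj D" "b \<in> Obj D" and f: "f \<in> Hom D a b"
    let ?A = "on_obj G a" and ?B = "on_obj G b"
    let ?f = "on_arr G a b f"
    have o: "?A \<in> Obj C" "?B \<in> Obj C" and Gf: "?f \<in> Hom C ?A ?B"
      using ab f by (simp_all add: G_obj G_arr)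
    have "Comp C (on_obj G (F0 ?A)) (on_obj G (F0 ?B)) ?B (\<zeta> ?B) (K ?A ?B ?f)
        = Comp C (on_obj G (F0 ?A)) ?A ?B (Comp C ?A (on_obj G (F0 ?B)) ?B (\<zeta> ?B)
            (Comp C ?A ?B (on_obj G (F0 ?B)) (\<eta> ?B) ?f)) (\<zeta> ?A)"
      unfolding K_def using o Gf by (simp add: assoc GF0 \<eta>_in \<zeta>_in comp_in)
    also have "Comp C ?A (on_obj G (F0 ?B)) ?B (\<zeta> ?B) (Comp C ?A ?B (on_obj G (F0 ?B)) (\<eta> ?B) ?f)
        = Comp C ?A ?B ?B (Comp C ?B (on_obj G (F0 ?B)) ?B (\<zeta> ?B) (\<eta> ?B)) ?f"
      using o Gf by (simp add: assoc[symmetric] GF0 \<eta>_in \<zeta>_in)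
    also have "\<dots> = ?f" using o Gf by (simp add: \<zeta>\<eta> id_left)
    finally have nat: "Comp C (on_obj G (F0 ?A)) (on_obj G (F0 ?B)) ?B (\<zeta> ?B) (K ?A ?B ?f)
        = Comp C (on_obj G (F0 ?A)) ?A ?B ?f (\<zeta> ?A)" .
    have "Comp D (F0 ?A) (F0 ?B) b (\<epsilon> b) (L (F0 ?A) (F0 ?B) (K ?A ?B ?f))
        = Comp D (F0 ?A) a b f (\<epsilon> a)"
      using ab f o Gf nat
      by (intro faithful[of "F0 ?A" b]) (simp_all add: F0 L_in K_in \<epsilon>_in Dcomp_in G_comp GL G\<epsilon>)
    then show "Comp D (on_obj (comp_functor F G) a) (on_obj (comp_functor F G) b) (on_obj id_functor b)
          (\<epsilon> b) (on_arr (comp_functor F G) a b f) =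
        Comp D (on_obj (comp_functor F G) a) (on_obj id_functor a) (on_obj id_functor b)
          (on_arr id_functor a b f) (\<epsilon> a)"
      by (simp add: comp_functor_def id_functor_def F_def)
  qed
  show ?thesis
    unfolding equivalent_categories_def using C D F G \<eta> \<epsilon> by blast
qed


section \<open>Least upper bounds and greatest lower bounds\<close>

lemma is_lub_iff:
  assumes "A \<subseteq> carrier L"
  shows "is_lub L s A \<longleftrightarrow> s \<in> carrier L \<and> (\<forall>a \<in> A. a \<sqsubseteq>\<^bsub>L\<^esub> s) \<and>
    (\<forall>u \<in> carrier L. (\<forall>a \<in> A. a \<sqsubseteq>\<^bsub>L\<^esub> u) \<longrightarrow> s \<sqsubseteq>\<^bsub>L\<^esub> u)"
  using assms unfolding least_def Upper_def by blast

lemma is_glb_iff: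
  assumes "A \<subseteq> carrier L"
  shows "is_glb L s A \<longleftrightarrow> s \<in> carrier L \<and> (\<forall>a \<in> A. s \<sqsubseteq>\<^bsub>L\<^esub> a) \<and>
    (\<forall>u \<in> carrier L. (\<forall>a \<in> A. u \<sqsubseteq>\<^bsub>L\<^esub> a) \<longrightarrow> u \<sqsubseteq>\<^bsub>L\<^esub> s)"
  using assms unfolding greatest_def Lower_def by blast

context partial_order
begin

lemma sup_eq: "is_lub L s A \<Longrightarrow> \<Squnion>A = s"
  unfolding sup_def using least_unique by blast

lemma inf_eq: "is_glb L s A \<Longrightarrow> \<Sqinter>A = s"
  unfolding inf_def using greatest_unique by blast

lemma meet_eq: "is_glb L s {x, y} \<Longrightarrow> x \<sqinter> y = s"
  unfolding meet_def by (rule inf_eq)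

lemma complete_lattice_if_lubs:
  assumes lub: "\<And>A. A \<subseteq> carrier L \<Longrightarrow> \<exists>s. is_lub L s A"
  shows "complete_lattice L"
proof (rule complete_latticeI)
  show "\<exists>s. is_lub L s A" if "A \<subseteq> carrier L" for A
    using lub that .
  show "\<exists>i. is_glb L i A" if A: "A \<subseteq> carrier L" for A
  proof -
    obtain i where i: "is_lub L i (Lower L A)"
      using lub[OF Lower_closed] by blast
    have "is_glb L i A"
      using i[unfolded is_lub_iff[OF Lower_closed]] A
      unfolding is_glb_iff[OF A] by (auto simp: Lower_def)
    then show ?thesis ..
  qed
qed

end

lemma partial_orderI:
  assumes "\<And>x y. eq L x y \<longleftrightarrow> x = y"
    and "\<And>x. x \<in> carrier L \<Longrightarrow> x \<sqsubseteq>\<^bsub>L\<^esub> x"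
    and "\<And>x y. \<lbrakk>x \<in> carrier L; y \<in> carrier L; x \<sqsubseteq>\<^bsub>L\<^esub> y; y \<sqsubseteq>\<^bsub>L\<^esub> x\<rbrakk> \<Longrightarrow> x = y"
    and "\<And>x y z. \<lbrakk>x \<in> carrier L; y \<in> carrier L; z \<in> carrier L; x \<sqsubseteq>\<^bsub>L\<^esub> y; y \<sqsubseteq>\<^bsub>L\<^esub> z\<rbrakk> \<Longrightarrow> x \<sqsubseteq>\<^bsub>L\<^esub> z"
  shows "partial_order L"
proof unfold_locales
  show "(.=\<^bsub>L\<^esub>) = (=)" using assms(1) by (intro ext) simp
  show "x \<sqsubseteq>\<^bsub>L\<^esub> z" if "x \<sqsubseteq>\<^bsub>L\<^esub> y" "y \<sqsubseteq>\<^bsub>L\<^esub> z" "x \<in> carrier L" "y \<in> carrier L" "z \<in> carrier L" for x y z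
    using assms(4) that by blast
qed (use assms(1,2) in \<open>simp_all add: assms(3)\<close>)


section \<open>Partial isometries of a restriction quantal frame\<close>

lemma lat_simps [simp]:
  "carrier (lat Q) = carrier Q" "le (lat Q) = qle Q" "eq (lat Q) = (=)"
  by (simp_all add: lat_def)

lemma monoid_order_simps [simp]:
  "carrier (nat_order S) = carrier S" "le (nat_order S) = nat_le S (proj S)" "eq (nat_order S) = (=)"
  "carrier (proj_order S) = proj S" "le (proj_order S) = nat_le S (proj S)" "eq (proj_order S) = (=)"
  by (simp_all add: nat_order_def proj_order_def)

sublocale unital_quantale \<subseteq> lat: complete_lattice "lat Q"
  by (rule complete)

context unital_quantale
begin

abbreviation le_syntax (infix \<open>\<preceq>\<close> 50) where "a \<preceq> b \<equiv> qle Q a b"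
abbreviation Join (\<open>\<Or>_\<close> [90] 90) where "\<Or>A \<equiv> \<Squnion>\<^bsub>lat Q\<^esub>A"

lemma le_refl: "a \<in> carrier Q \<Longrightarrow> a \<preceq> a"
  using lat.le_refl[of a] by simp

lemma le_trans: "\<lbrakk>a \<preceq> b; b \<preceq> c; a \<in> carrier Q; b \<in> carrier Q; c \<in> carrier Q\<rbrakk> \<Longrightarrow> a \<preceq> c"
  using lat.le_trans[of a b c] by simp

lemma le_antisym: "\<lbrakk>a \<preceq> b; b \<preceq> a; a \<in> carrier Q; b \<in> carrier Q\<rbrakk> \<Longrightarrow> a = b"
  using lat.le_antisym[of a b] by simp

lemma Join_closed: "A \<subseteq> carrier Q \<Longrightarrow> \<Or>A \<in> carrier Q"
  using lat.sup_closed[of A] by simp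

lemma Join_upper: "\<lbrakk>A \<subseteq> carrier Q; a \<in> A\<rbrakk> \<Longrightarrow> a \<preceq> \<Or>A"
  using lat.sup_upper[of A a] by simp

lemma Join_least: "\<lbrakk>A \<subseteq> carrier Q; u \<in> carrier Q; \<And>a. a \<in> A \<Longrightarrow> a \<preceq> u\<rbrakk> \<Longrightarrow> \<Or>A \<preceq> u"
  using lat.sup_least[of A u] by simp

lemma Join_eqI:
  assumes "A \<subseteq> carrier Q" "s \<in> carrier Q" "\<And>a. a \<in> A \<Longrightarrow> a \<preceq> s"
    "\<And>u. \<lbrakk>u \<in> carrier Q; \<And>a. a \<in> A \<Longrightarrow> a \<preceq> u\<rbrakk> \<Longrightarrow> s \<preceq> u"
  shows "\<Or>A = s"
  using assms by (intro le_antisym Join_least Join_closed assms(4) Join_upper) auto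

lemma Join_mono: "\<lbrakk>A \<subseteq> B; B \<subseteq> carrier Q\<rbrakk> \<Longrightarrow> \<Or>A \<preceq> \<Or>B"
  by (intro Join_least Join_closed Join_upper) auto

lemma Join_UN:
  assumes "\<And>a. a \<in> A \<Longrightarrow> f a \<subseteq> carrier Q"
  shows "\<Or>(\<Union>a\<in>A. f a) = \<Or>((\<lambda>a. \<Or>(f a)) ` A)"
proof (rule Join_eqI)
  have cl: "(\<lambda>a. \<Or>(f a)) ` A \<subseteq> carrier Q" using assms by (auto intro: Join_closed)
  then show "\<Or>((\<lambda>a. \<Or>(f a)) ` A) \<in> carrier Q" by (rule Join_closed)
  show "x \<preceq> \<Or>((\<lambda>a. \<Or>(f a)) ` A)" if "x \<in> (\<Union>a\<in>A. f a)" for x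
  proof -
    from that obtain a where a: "a \<in> A" "x \<in> f a" by blast
    then have "x \<preceq> \<Or>(f a)" "\<Or>(f a) \<preceq> \<Or>((\<lambda>a. \<Or>(f a)) ` A)"
      using assms cl by (auto intro!: Join_upper)
    then show ?thesis by (rule le_trans) (use a assms cl in \<open>auto intro: Join_closed\<close>)
  qed
  show "\<Or>((\<lambda>a. \<Or>(f a)) ` A) \<preceq> u" if "u \<in> carrier Q" "\<And>a. a \<in> (\<Union>a\<in>A. f a) \<Longrightarrow> a \<preceq> u" for u
    using that cl assms by (auto intro!: Join_least)
qed (use assms in auto)

lemma Join_pair: "\<lbrakk>a \<preceq> b; a \<in> carrier Q; b \<in> carrier Q\<rbrakk> \<Longrightarrow> \<Or>{a, b} = b"
  by (rule Join_eqI) (auto intro: le_refl)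

lemma mult_mono_right:
  assumes "a \<preceq> b" "a \<in> carrier Q" "b \<in> carrier Q" "c \<in> carrier Q"
  shows "c \<otimes> a \<preceq> c \<otimes> b"
proof -
  have "c \<otimes> b = \<Or>{c \<otimes> a, c \<otimes> b}"
    using mult_join[of c "{a, b}"] assms Join_pair by simp
  then show ?thesis using Join_upper[of "{c \<otimes> a, c \<otimes> b}" "c \<otimes> a"] assms by simp
qed

lemma mult_mono_left:
  assumes "a \<preceq> b" "a \<in> carrier Q" "b \<in> carrier Q" "c \<in> carrier Q"
  shows "a \<otimes> c \<preceq> b \<otimes> c"
proof -
  have "b \<otimes> c = \<Or>{a \<otimes> c, b \<otimes> c}"
    using join_mult[of c "{a, b}"] assms Join_pair by simp
  then show ?thesis using Join_upper[of "{a \<otimes> c, b \<otimes> c}" "a \<otimes> c"] assms by simp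
qed

lemma mult_mono:
  assumes "a \<preceq> b" "c \<preceq> d" "a \<in> carrier Q" "b \<in> carrier Q" "c \<in> carrier Q" "d \<in> carrier Q"
  shows "a \<otimes> c \<preceq> b \<otimes> d"
  using assms by (meson le_trans m_closed mult_mono_left mult_mono_right)

lemma below_one_closed: "f \<in> below_one Q \<Longrightarrow> f \<in> carrier Q"
  by (simp add: below_one_def)

lemma below_one_mult_le:
  assumes "f \<in> below_one Q" "a \<in> carrier Q"
  shows "f \<otimes> a \<preceq> a" "a \<otimes> f \<preceq> a"
  using assms mult_mono_left[of f \<one> a] mult_mono_right[of f \<one> a] by (auto simp: below_one_def)

lemma below_one_down: "\<lbrakk>a \<preceq> f; f \<in> below_one Q; a \<in> carrier Q\<rbrakk> \<Longrightarrow> a \<in> below_one Q"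
  unfolding below_one_def using le_trans by blast

lemma below_one_mult: "\<lbrakk>f \<in> below_one Q; g \<in> below_one Q\<rbrakk> \<Longrightarrow> f \<otimes> g \<in> below_one Q"
  using below_one_mult_le below_one_down below_one_closed by (meson m_closed)

lemma one_below_one: "\<one> \<in> below_one Q"
  by (simp add: below_one_def le_refl)

lemma Join_below_one: "A \<subseteq> below_one Q \<Longrightarrow> \<Or>A \<in> below_one Q"
  using Join_least[of A \<one>] Join_closed[of A] by (auto simp: below_one_def)

end

context ehresmann_quantale
begin

lemma lam_closed: "a \<in> carrier Q \<Longrightarrow> lam Q a \<in> carrier Q"
  and rho_closed: "a \<in> carrier Q \<Longrightarrow> rho Q a \<in> carrier Q"
  using lam_below rho_below below_one_closed by blast+

lemma lam_mono:
  assumes "a \<preceq> b" "a \<in> carrier Q" "b \<in> carrier Q"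
  shows "lam Q a \<preceq> lam Q b"
  using lam_join[of "{a, b}"] Join_upper[of "{lam Q a, lam Q b}" "lam Q a"] Join_pair[OF assms] assms
  by (simp add: lam_closed)

lemma rho_mono:
  assumes "a \<preceq> b" "a \<in> carrier Q" "b \<in> carrier Q"
  shows "rho Q a \<preceq> rho Q b"
  using rho_join[of "{a, b}"] Join_upper[of "{rho Q a, rho Q b}" "rho Q a"] Join_pair[OF assms] assms
  by (simp add: rho_closed)

lemma below_one_idem: "f \<in> below_one Q \<Longrightarrow> f \<otimes> f = f"
  using mult_lam[of f] lam_id[of f] below_one_closed by simp

text \<open>Idempotency makes the product of two elements below the unit their meet, and meets commute.\<close>

lemma below_one_le_mult:
  assumes "h \<in> below_one Q" "h \<preceq> f" "h \<preceq> g" "f \<in> carrier Q" "g \<in> carrier Q"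
  shows "h \<preceq> f \<otimes> g"
  using mult_mono[of h f h g] assms below_one_idem[of h] below_one_closed by simp

lemma below_one_comm:
  assumes "f \<in> below_one Q" "g \<in> below_one Q"
  shows "f \<otimes> g = g \<otimes> f"
proof -
  have "f \<otimes> g \<preceq> g \<otimes> f" if "f \<in> below_one Q" "g \<in> below_one Q" for f g
    using that by (intro below_one_le_mult below_one_mult_le below_one_mult below_one_closed)
  then show ?thesis using assms by (intro le_antisym) (auto intro: below_one_closed)
qed

text \<open>So the elements below the unit form a semilattice under multiplication with its usual order.\<close>

lemma below_one_le_iff:
  assumes "f \<in> below_one Q" "g \<in> below_one Q"
  shows "f \<preceq> g \<longleftrightarrow> f \<otimes> g = f"
proof
  assume "f \<preceq> g"
  then show "f \<otimes> g = f"
    using assms below_one_closed below_one_mult_le(2)[of g f]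
    by (intro le_antisym below_one_le_mult) (auto intro: le_refl)
next
  assume "f \<otimes> g = f"
  then show "f \<preceq> g" using below_one_mult_le(1)[of f g] assms below_one_closed by simp
qed

lemma lam_mult_below_one:
  assumes "a \<in> carrier Q" "f \<in> below_one Q"
  shows "lam Q (a \<otimes> f) = lam Q a \<otimes> f"
  using assms lam_mult[of a f] lam_id[of "lam Q a \<otimes> f"] lam_below below_one_mult below_one_closed
  by simp

lemma rho_mult_below_one:
  assumes "a \<in> carrier Q" "f \<in> below_one Q"
  shows "rho Q (f \<otimes> a) = f \<otimes> rho Q a"
  using assms rho_mult_rho[of f a] rho_id[of "f \<otimes> rho Q a"] rho_below below_one_mult below_one_closed
  by simp

text \<open>The projections witnessing \<open>b \<le>' a\<close> can be chosen canonically: from \<open>b = a \<otimes> f\<close> follows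
  \<open>lam b = lam a \<otimes> f\<close>, and \<open>lam a\<close> is absorbed by \<open>a\<close>.\<close>

lemma nat_le_eq_mult:
  assumes "nat_le Q (below_one Q) b a" "a \<in> carrier Q" "b \<in> carrier Q"
  shows "b = a \<otimes> lam Q b" "b = rho Q b \<otimes> a"
proof -
  from assms obtain f g where fg: "f \<in> below_one Q" "g \<in> below_one Q" "b = a \<otimes> f" "b = g \<otimes> a"
    by (auto simp: nat_le_def)
  have "a \<otimes> lam Q b = a \<otimes> (lam Q a \<otimes> f)"
    using fg(3) assms(2) fg(1) lam_mult_below_one by simp
  also have "\<dots> = a \<otimes> f"
    using assms(2) fg(1) mult_lam[of a] lam_closed below_one_closed by (simp flip: m_assoc)
  finally show "b = a \<otimes> lam Q b" using fg(3) by simp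
  have "rho Q b \<otimes> a = g \<otimes> rho Q a \<otimes> a"
    using fg(4) assms(2) fg(2) rho_mult_below_one by simp
  also have "\<dots> = g \<otimes> a"
    using assms(2) fg(2) rho_mult[of a] rho_closed below_one_closed by (simp add: m_assoc)
  finally show "b = rho Q b \<otimes> a" using fg(4) by simp
qed

lemma partial_isometry_closed: "a \<in> partial_isometries Q \<Longrightarrow> a \<in> carrier Q"
  by (simp add: partial_isometries_def)

lemma partial_isometry_le:
  assumes "b \<preceq> a" "a \<in> partial_isometries Q" "b \<in> carrier Q"
  shows "b = a \<otimes> lam Q b" "b = rho Q b \<otimes> a"
  using assms nat_le_eq_mult[of b a] by (auto simp: partial_isometries_def)

lemma partial_isometryI:
  assumes "a \<in> carrier Q"
    and "\<And>b. \<lbrakk>b \<in> carrier Q; b \<preceq> a\<rbrakk> \<Longrightarrow> b = a \<otimes> lam Q b \<and> b = rho Q b \<otimes> a"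
  shows "a \<in> partial_isometries Q"
  unfolding partial_isometries_def nat_le_def using assms lam_below rho_below by blast

text \<open>Let \<open>c \<preceq> b \<preceq> a\<close>. Both \<open>b\<close> and \<open>c\<close> are restrictions of \<open>a\<close>, namely \<open>b = a \<otimes> lam b\<close> and
  \<open>c = a \<otimes> lam c\<close>, and \<open>lam c \<preceq> lam b\<close>; so \<open>c = b \<otimes> lam c\<close>, and dually on the left.\<close>

lemma partial_isometry_down:
  assumes "b \<preceq> a" "a \<in> partial_isometries Q" "b \<in> carrier Q"
  shows "b \<in> partial_isometries Q"
proof (rule partial_isometryI)
  fix c assume c: "c \<in> carrier Q" "c \<preceq> b"
  have a: "a \<in> carrier Q" using assms(2) by (rule partial_isometry_closed)
  have "c \<preceq> a" using c assms a by (blast intro: le_trans)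
  note ca = partial_isometry_le[OF this assms(2) c(1)] and ba = partial_isometry_le[OF assms]
  have "lam Q b \<otimes> lam Q c = lam Q c"
    using below_one_le_iff[of "lam Q c" "lam Q b"] below_one_comm[of "lam Q c" "lam Q b"]
      lam_mono[OF c(2,1) assms(3)] lam_below assms(3) c(1) by simp
  then have "b \<otimes> lam Q c = c"
    using ba(1) ca(1) a assms(3) c(1) lam_closed m_assoc by metis
  moreover have "rho Q c \<otimes> rho Q b = rho Q c"
    using below_one_le_iff[of "rho Q c" "rho Q b"]
      rho_mono[OF c(2,1) assms(3)] rho_below assms(3) c(1) by simp
  then have "rho Q c \<otimes> b = c"
    using ba(2) ca(2) a assms(3) c(1) rho_closed m_assoc by metis
  ultimately show "c = b \<otimes> lam Q c \<and> c = rho Q c \<otimes> b" by simp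
qed fact

lemma below_one_partial_isometry:
  assumes f: "f \<in> below_one Q"
  shows "f \<in> partial_isometries Q"
proof (rule partial_isometryI)
  fix b assume b: "b \<in> carrier Q" "b \<preceq> f"
  then have "b \<in> below_one Q" using f by (blast intro: below_one_down)
  then show "b = f \<otimes> lam Q b \<and> b = rho Q b \<otimes> f"
    using below_one_le_iff[of b f] below_one_comm[of b f] b f lam_id rho_id by simp
qed (rule below_one_closed[OF f])

end

abbreviation (in unital_quantale) le_meet (infixl \<open>\<sqdot>\<close> 70) where "le_meet a b \<equiv> a \<sqinter>\<^bsub>lat Q\<^esub> b"

context ehresmann_quantal_frame
begin

lemma meet_closed: "\<lbrakk>a \<in> carrier Q; b \<in> carrier Q\<rbrakk> \<Longrightarrow> a \<sqdot> b \<in> carrier Q"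
  using lat.meet_closed[of a b] by simp

lemma meet_le: "\<lbrakk>a \<in> carrier Q; b \<in> carrier Q\<rbrakk> \<Longrightarrow> a \<sqdot> b \<preceq> a"
  "\<lbrakk>a \<in> carrier Q; b \<in> carrier Q\<rbrakk> \<Longrightarrow> a \<sqdot> b \<preceq> b"
  using lat.meet_left[of a b] lat.meet_right[of a b] by simp_all

lemma meet_greatest:
  "\<lbrakk>c \<preceq> a; c \<preceq> b; a \<in> carrier Q; b \<in> carrier Q; c \<in> carrier Q\<rbrakk> \<Longrightarrow> c \<preceq> a \<sqdot> b"
  using lat.meet_le[of c a b] by simp

lemma meet_eqI:
  assumes "a \<in> carrier Q" "b \<in> carrier Q" "s \<in> carrier Q" "s \<preceq> a" "s \<preceq> b"
    "\<And>u. \<lbrakk>u \<in> carrier Q; u \<preceq> a; u \<preceq> b\<rbrakk> \<Longrightarrow> u \<preceq> s"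
  shows "a \<sqdot> b = s"
  using assms by (intro le_antisym meet_greatest meet_closed assms(6) meet_le) auto

lemma meet_Join:
  "\<lbrakk>a \<in> carrier Q; A \<subseteq> carrier Q\<rbrakk> \<Longrightarrow> a \<sqdot> \<Or>A = \<Or>((\<lambda>b. a \<sqdot> b) ` A)"
  using frame.meet_join_distrib[OF lat_frame, of a A] by simp

lemma eq_Join_meets:
  assumes "a \<preceq> \<Or>A" "a \<in> carrier Q" "A \<subseteq> carrier Q"
  shows "a = \<Or>((\<lambda>b. a \<sqdot> b) ` A)"
  using meet_Join[OF assms(2,3)] meet_eqI[of a "\<Or>A" a] assms Join_closed le_refl by simp

text \<open>Let \<open>s\<close> be the join of \<open>A\<close>. By compatibility every member is a restriction of it,
  \<open>a = s \<otimes> lam a\<close>. A general \<open>b \<preceq> s\<close> is, by the frame law, the join of the elements \<open>b \<sqdot> a\<close>; each of these is a restriction of \<open>s\<close>, and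
  the restricting projections can be joined.\<close>

lemma partial_isometry_Join:
  assumes A: "A \<subseteq> partial_isometries Q"
    and lam_comp: "\<And>a b. \<lbrakk>a \<in> A; b \<in> A\<rbrakk> \<Longrightarrow> a \<otimes> lam Q b = b \<otimes> lam Q a"
    and rho_comp: "\<And>a b. \<lbrakk>a \<in> A; b \<in> A\<rbrakk> \<Longrightarrow> rho Q b \<otimes> a = rho Q a \<otimes> b"
  shows "\<Or>A \<in> partial_isometries Q"
proof (rule partial_isometryI)
  have AQ: "A \<subseteq> carrier Q" using A partial_isometry_closed by blast
  then show s: "\<Or>A \<in> carrier Q" by (rule Join_closed)
  have a_lam: "\<Or>A \<otimes> lam Q a = a" if a: "a \<in> A" for a
  proof (rule le_antisym)
    have aQ: "a \<in> carrier Q" using a AQ by blast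
    have "\<Or>A \<otimes> lam Q a = \<Or>((\<lambda>b. b \<otimes> lam Q a) ` A)"
      using AQ aQ by (intro join_mult lam_closed)
    also have "\<dots> \<preceq> a"
    proof (rule Join_least)
      fix x assume "x \<in> (\<lambda>b. b \<otimes> lam Q a) ` A"
      then obtain b where "b \<in> A" "x = a \<otimes> lam Q b" using lam_comp a by force
      then show "x \<preceq> a" using below_one_mult_le(2) lam_below aQ AQ by blast
    qed (use aQ AQ lam_closed in auto)
    finally show "\<Or>A \<otimes> lam Q a \<preceq> a" .
    have "a \<otimes> lam Q a \<preceq> \<Or>A \<otimes> lam Q a"
      using a aQ AQ s by (intro mult_mono_left Join_upper lam_closed)
    then show "a \<preceq> \<Or>A \<otimes> lam Q a" using mult_lam[OF aQ] by simp
  qed (use a AQ s lam_closed in auto)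
  have rho_a: "rho Q a \<otimes> \<Or>A = a" if a: "a \<in> A" for a
  proof (rule le_antisym)
    have aQ: "a \<in> carrier Q" using a AQ by blast
    have "rho Q a \<otimes> \<Or>A = \<Or>((\<lambda>b. rho Q a \<otimes> b) ` A)"
      using AQ aQ by (intro mult_join rho_closed)
    also have "\<dots> \<preceq> a"
    proof (rule Join_least)
      fix x assume "x \<in> (\<lambda>b. rho Q a \<otimes> b) ` A"
      then obtain b where "b \<in> A" "x = rho Q b \<otimes> a" using rho_comp a by force
      then show "x \<preceq> a" using below_one_mult_le(1) rho_below aQ AQ by blast
    qed (use aQ AQ rho_closed in auto)
    finally show "rho Q a \<otimes> \<Or>A \<preceq> a" .
    have "rho Q a \<otimes> a \<preceq> rho Q a \<otimes> \<Or>A"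
      using a aQ AQ s by (intro mult_mono_right Join_upper rho_closed)
    then show "a \<preceq> rho Q a \<otimes> \<Or>A" using rho_mult[OF aQ] by simp
  qed (use a AQ s rho_closed in auto)
  fix b assume b: "b \<in> carrier Q" "b \<preceq> \<Or>A"
  let ?B = "(\<lambda>a. b \<sqdot> a) ` A"
  have BQ: "?B \<subseteq> carrier Q" using b AQ meet_closed by blast
  have bB: "b = \<Or>?B" using b AQ by (intro eq_Join_meets)
  have restr: "c = \<Or>A \<otimes> lam Q c" "c = rho Q c \<otimes> \<Or>A" if "c \<in> ?B" for c
  proof -
    obtain a where a: "a \<in> A" "c = b \<sqdot> a" using \<open>c \<in> ?B\<close> by blast
    then have c: "c \<preceq> a" "c \<in> carrier Q" and aQ: "a \<in> carrier Q" and aP: "a \<in> partial_isometries Q"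
      using b AQ A meet_le meet_closed by auto
    note ca = partial_isometry_le[OF c(1) aP c(2)]
    have "lam Q a \<otimes> lam Q c = lam Q c"
      using below_one_le_iff[of "lam Q c" "lam Q a"] below_one_comm[of "lam Q c" "lam Q a"]
        lam_mono[OF c aQ] lam_below aQ c(2) by simp
    then show "c = \<Or>A \<otimes> lam Q c"
      using a_lam[OF a(1)] ca(1) s aQ c(2) lam_closed m_assoc by metis
    have "rho Q c \<otimes> rho Q a = rho Q c"
      using below_one_le_iff[of "rho Q c" "rho Q a"] rho_mono[OF c aQ] rho_below aQ c(2) by simp
    then show "c = rho Q c \<otimes> \<Or>A"
      using rho_a[OF a(1)] ca(2) s aQ c(2) rho_closed m_assoc by metis
  qed
  have "\<Or>A \<otimes> lam Q b = \<Or>((\<lambda>c. \<Or>A \<otimes> c) ` lam Q ` ?B)"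
    by (subst bB, subst lam_join[OF BQ], rule mult_join) (use s BQ lam_closed in auto)
  also have "(\<lambda>c. \<Or>A \<otimes> c) ` lam Q ` ?B = ?B" using restr(1) by (force simp: image_image)
  finally have 1: "b = \<Or>A \<otimes> lam Q b" using bB by simp
  have "rho Q b \<otimes> \<Or>A = \<Or>((\<lambda>c. c \<otimes> \<Or>A) ` rho Q ` ?B)"
    by (subst bB, subst rho_join[OF BQ], rule join_mult) (use s BQ rho_closed in auto)
  also have "(\<lambda>c. c \<otimes> \<Or>A) ` rho Q ` ?B = ?B" using restr(2) by (force simp: image_image)
  finally show "b = \<Or>A \<otimes> lam Q b \<and> b = rho Q b \<otimes> \<Or>A" using bB 1 by simp
qed

end

context restriction_quantal_frame
begin

text \<open>The top element is a join of partial isometries; taking the meet of \<open>a\<close> with this join,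
  the frame law gives \<open>a\<close> as a join of elements below partial isometries. Hence partial
  isometries generate the quantal frame, and a morphism is determined by its values on them.\<close>

lemma eq_Join_partial_isometries:
  assumes a: "a \<in> carrier Q"
  shows "a = \<Or>{p \<in> partial_isometries Q. p \<preceq> a}"
proof -
  let ?P = "{p \<in> partial_isometries Q. p \<preceq> a}"
  obtain A where A: "A \<subseteq> partial_isometries Q" "\<top>\<^bsub>lat Q\<^esub> = \<Or>A" using top_join by blast
  have AQ: "A \<subseteq> carrier Q" and PQ: "?P \<subseteq> carrier Q" using A partial_isometry_closed by auto
  have "a \<preceq> \<Or>A" using lat.top_higher[of a] a A(2) by simp
  then have "a = \<Or>((\<lambda>b. a \<sqdot> b) ` A)" using a AQ by (intro eq_Join_meets)
  also have "\<dots> \<preceq> \<Or>?P"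
  proof (rule Join_mono)
    show "(\<lambda>b. a \<sqdot> b) ` A \<subseteq> ?P"
    proof
      fix c assume "c \<in> (\<lambda>b. a \<sqdot> b) ` A"
      then obtain b where b: "b \<in> A" "c = a \<sqdot> b" by blast
      then have "c \<preceq> a" "c \<preceq> b" "c \<in> carrier Q" "b \<in> partial_isometries Q"
        using a A AQ meet_closed meet_le by auto
      then show "c \<in> ?P" using partial_isometry_down by blast
    qed
  qed (rule PQ)
  finally show ?thesis using a PQ by (intro le_antisym Join_closed Join_least) auto
qed

end


section \<open>The monoid of partial isometries\<close>

text \<open>The monoid \<open>S\<close> is the monoid of partial isometries of \<open>Q\<close>, up to the bijection \<open>j\<close>. Leaving \<open>j\<close>
  arbitrary covers both passages between the two kinds of structure: the partial isometries of a
  given \<open>Q\<close>, moved into a prescribed type, and the embedding of a given \<open>S\<close> into a quantal frame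
  built from it.\<close>

locale partial_isometry_representation = restriction_quantal_frame Q
  for S :: "('a, 'm) restr_monoid_scheme" and Q :: "('b, 'n) lr_quantale_scheme" (structure)
    and j :: "'a \<Rightarrow> 'b" +
  assumes bij: "bij_betw j (carrier S) (partial_isometries Q)"
    and S_mult_closed: "\<lbrakk>a \<in> carrier S; b \<in> carrier S\<rbrakk> \<Longrightarrow> a \<otimes>\<^bsub>S\<^esub> b \<in> carrier S"
    and j_mult: "\<lbrakk>a \<in> carrier S; b \<in> carrier S\<rbrakk> \<Longrightarrow> j (a \<otimes>\<^bsub>S\<^esub> b) = j a \<otimes> j b"
    and S_one_closed: "\<one>\<^bsub>S\<^esub> \<in> carrier S"
    and j_one: "j \<one>\<^bsub>S\<^esub> = \<one>"
    and S_lam_closed: "a \<in> carrier S \<Longrightarrow> lam S a \<in> carrier S"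
    and j_lam: "a \<in> carrier S \<Longrightarrow> j (lam S a) = lam Q (j a)"
    and S_rho_closed: "a \<in> carrier S \<Longrightarrow> rho S a \<in> carrier S"
    and j_rho: "a \<in> carrier S \<Longrightarrow> j (rho S a) = rho Q (j a)"
    and S_proj_closed: "proj S \<subseteq> carrier S"
    and j_proj: "j ` proj S = below_one Q"
begin

lemma j_partial_isometry: "a \<in> carrier S \<Longrightarrow> j a \<in> partial_isometries Q"
  using bij by (auto simp: bij_betw_def)

lemma j_closed: "a \<in> carrier S \<Longrightarrow> j a \<in> carrier Q"
  using j_partial_isometry partial_isometry_closed by blast

lemma j_image_closed: "A \<subseteq> carrier S \<Longrightarrow> j ` A \<subseteq> carrier Q"
  using j_closed by blast

lemma j_inject: "\<lbrakk>a \<in> carrier S; b \<in> carrier S\<rbrakk> \<Longrightarrow> j a = j b \<longleftrightarrow> a = b"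
  using bij by (auto simp: bij_betw_def dest: inj_onD)

lemma j_surj:
  assumes "p \<in> partial_isometries Q"
  obtains a where "a \<in> carrier S" "j a = p"
proof -
  have "p \<in> j ` carrier S" using assms bij by (simp add: bij_betw_def)
  then show thesis using that by (elim imageE) simp
qed

lemma proj_iff: "a \<in> carrier S \<Longrightarrow> a \<in> proj S \<longleftrightarrow> j a \<in> below_one Q"
  using j_inject S_proj_closed unfolding j_proj[symmetric] by auto

lemma projD: "f \<in> proj S \<Longrightarrow> j f \<in> below_one Q" "f \<in> proj S \<Longrightarrow> f \<in> carrier S"
  using j_proj S_proj_closed by auto

lemma restriction_monoid_S: "restriction_monoid S"
proof unfold_locales
  note closed = S_mult_closed S_one_closed S_lam_closed S_rho_closed projD j_closed
  note j = j_mult j_one j_lam j_rho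
  show "proj S \<noteq> {}" using j_proj one_below_one by auto
  show "f \<otimes>\<^bsub>S\<^esub> f = f" if "f \<in> proj S" for f
    using that closed by (simp add: j below_one_idem flip: j_inject)
  show "f \<otimes>\<^bsub>S\<^esub> g \<in> proj S" if "f \<in> proj S" "g \<in> proj S" for f g
    using that closed by (simp add: proj_iff j below_one_mult)
  show "f \<otimes>\<^bsub>S\<^esub> g = g \<otimes>\<^bsub>S\<^esub> f" if "f \<in> proj S" "g \<in> proj S" for f g
    using that closed below_one_comm by (simp add: j flip: j_inject)
  show "lam S a \<in> proj S" "rho S a \<in> proj S" if "a \<in> carrier S" for a
    using that closed by (simp_all add: proj_iff j lam_below rho_below)
  show "lam S f = f" "rho S f = f" if "f \<in> proj S" for f
    using that closed by (simp_all add: j lam_id rho_id flip: j_inject)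
  show "a \<otimes>\<^bsub>S\<^esub> lam S a = a" "rho S a \<otimes>\<^bsub>S\<^esub> a = a" if "a \<in> carrier S" for a
    using that closed mult_lam[of "j a"] rho_mult[of "j a"] by (simp_all add: j flip: j_inject)
  show "lam S (lam S a \<otimes>\<^bsub>S\<^esub> b) = lam S (a \<otimes>\<^bsub>S\<^esub> b)"
      "rho S (a \<otimes>\<^bsub>S\<^esub> rho S b) = rho S (a \<otimes>\<^bsub>S\<^esub> b)"
    if "a \<in> carrier S" "b \<in> carrier S" for a b
    using that closed lam_mult[of "j a" "j b"] rho_mult_rho[of "j a" "j b"]
    by (simp_all add: j flip: j_inject)
  show "f \<otimes>\<^bsub>S\<^esub> a = a \<otimes>\<^bsub>S\<^esub> lam S (f \<otimes>\<^bsub>S\<^esub> a)" if "a \<in> carrier S" "f \<in> proj S" for a f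
    using that closed partial_isometry_le(1)[of "j f \<otimes> j a" "j a"] below_one_mult_le[of "j f" "j a"]
    by (simp add: j j_partial_isometry flip: j_inject)
  show "a \<otimes>\<^bsub>S\<^esub> f = rho S (a \<otimes>\<^bsub>S\<^esub> f) \<otimes>\<^bsub>S\<^esub> a" if "a \<in> carrier S" "f \<in> proj S" for a f
    using that closed partial_isometry_le(2)[of "j a \<otimes> j f" "j a"] below_one_mult_le[of "j f" "j a"]
    by (simp add: j j_partial_isometry flip: j_inject)
  show "a \<otimes>\<^bsub>S\<^esub> b \<otimes>\<^bsub>S\<^esub> c = a \<otimes>\<^bsub>S\<^esub> (b \<otimes>\<^bsub>S\<^esub> c)"
    if "a \<in> carrier S" "b \<in> carrier S" "c \<in> carrier S" for a b c
    using that closed by (simp add: j m_assoc flip: j_inject)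
  show "\<one>\<^bsub>S\<^esub> \<otimes>\<^bsub>S\<^esub> a = a" "a \<otimes>\<^bsub>S\<^esub> \<one>\<^bsub>S\<^esub> = a" if "a \<in> carrier S" for a
    using that closed by (simp_all add: j flip: j_inject)
qed (use S_mult_closed S_one_closed projD in auto)

text \<open>Elements below a partial isometry are its restrictions, so the two orders agree on \<open>S\<close>.\<close>

lemma nat_le_iff:
  assumes "a \<in> carrier S" "b \<in> carrier S"
  shows "nat_le S (proj S) a b \<longleftrightarrow> j a \<preceq> j b"
proof
  assume "nat_le S (proj S) a b"
  then show "j a \<preceq> j b"
    using assms below_one_mult_le j_closed by (auto simp: nat_le_def j_mult projD)
next
  assume "j a \<preceq> j b"
  then have "j a = j b \<otimes> lam Q (j a)" "j a = rho Q (j a) \<otimes> j b"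
    using assms j_partial_isometry j_closed by (auto intro: partial_isometry_le)
  then have "a = b \<otimes>\<^bsub>S\<^esub> lam S a" "a = rho S a \<otimes>\<^bsub>S\<^esub> b"
    using assms by (simp_all add: j_mult j_lam j_rho S_lam_closed S_rho_closed S_mult_closed flip: j_inject)
  moreover have "lam S a \<in> proj S" "rho S a \<in> proj S"
    using assms by (simp_all add: proj_iff S_lam_closed S_rho_closed j_lam j_rho lam_below rho_below j_closed)
  ultimately show "nat_le S (proj S) a b" unfolding nat_le_def by blast
qed

lemma proj_le_iff: "\<lbrakk>f \<in> proj S; g \<in> proj S\<rbrakk> \<Longrightarrow> nat_le S (proj S) f g \<longleftrightarrow> j f \<preceq> j g"
  by (intro nat_le_iff projD)

text \<open>If \<open>A\<close> has an upper bound \<open>s\<close> in \<open>S\<close>, the join of \<open>j ` A\<close> lies below the partial isometry \<open>j s\<close>. Hence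
  it is a partial isometry itself, and so is in the image of \<open>j\<close>.\<close>

lemma is_lub_nat_order_iff:
  assumes A: "A \<subseteq> carrier S"
  shows "is_lub (nat_order S) s A \<longleftrightarrow> s \<in> carrier S \<and> j s = \<Or>(j ` A)"
proof
  note jA = j_image_closed[OF A]
  assume "is_lub (nat_order S) s A"
  then have s: "s \<in> carrier S" "\<And>a. a \<in> A \<Longrightarrow> j a \<preceq> j s"
      "\<And>u. \<lbrakk>u \<in> carrier S; \<And>a. a \<in> A \<Longrightarrow> j a \<preceq> j u\<rbrakk> \<Longrightarrow> j s \<preceq> j u"
    using A nat_le_iff unfolding is_lub_iff[of A "nat_order S", simplified, OF A]
    by (blast, blast, metis subsetD)
  have "\<Or>(j ` A) \<preceq> j s" using s jA by (intro Join_least j_closed) auto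
  then have "\<Or>(j ` A) \<in> partial_isometries Q"
    using s(1) jA by (intro partial_isometry_down[OF _ j_partial_isometry] Join_closed)
  then obtain u where u: "u \<in> carrier S" "j u = \<Or>(j ` A)" by (rule j_surj)
  then have "j s \<preceq> j u" using jA by (intro s(3)) (auto intro: Join_upper)
  then show "s \<in> carrier S \<and> j s = \<Or>(j ` A)"
    using u s(1) \<open>\<Or>(j ` A) \<preceq> j s\<close> le_antisym[of "j s" "j u"] jA
    by (simp add: j_closed Join_closed)
next
  note jA = j_image_closed[OF A]
  assume s: "s \<in> carrier S \<and> j s = \<Or>(j ` A)"
  show "is_lub (nat_order S) s A"
    unfolding is_lub_iff[of A "nat_order S", simplified, OF A]
  proof (intro conjI ballI impI)
    show "nat_le S (proj S) a s" if "a \<in> A" for a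
      using that s A jA nat_le_iff[of a s] by (auto intro: Join_upper)
    show "nat_le S (proj S) s u" if "u \<in> carrier S" "\<forall>a\<in>A. nat_le S (proj S) a u" for u
      using that s A jA nat_le_iff[of s u] nat_le_iff[of _ u] by (auto intro!: Join_least simp: j_closed subset_iff)
  qed (use s in simp)
qed

lemma is_lub_proj_order:
  assumes A: "A \<subseteq> proj S" and s: "s \<in> proj S" "j s = \<Or>(j ` A)"
  shows "is_lub (proj_order S) s A"
proof -
  have AS: "A \<subseteq> carrier S" using A S_proj_closed by blast
  have "is_lub (nat_order S) s A" using s AS projD by (simp add: is_lub_nat_order_iff)
  then show ?thesis
    using A s(1) S_proj_closed unfolding is_lub_iff[of A "nat_order S", simplified, OF AS]
      is_lub_iff[of A "proj_order S", simplified, OF A] by blast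
qed

lemma is_glb_nat_order:
  assumes "s \<in> carrier S" "t \<in> carrier S" "u \<in> carrier S" "j u = j s \<sqdot> j t"
  shows "is_glb (nat_order S) u {s, t}"
  using assms by (subst is_glb_iff) (auto simp: nat_le_iff j_closed meet_le intro: meet_greatest)

lemma partial_order_nat_order: "partial_order (nat_order S)"
proof (rule partial_orderI)
  fix x y z
  assume "x \<in> carrier (nat_order S)" "y \<in> carrier (nat_order S)" "z \<in> carrier (nat_order S)"
    "x \<sqsubseteq>\<^bsub>nat_order S\<^esub> y" "y \<sqsubseteq>\<^bsub>nat_order S\<^esub> z"
  then show "x \<sqsubseteq>\<^bsub>nat_order S\<^esub> z"
    using le_trans[of "j x" "j y" "j z"] by (simp add: nat_le_iff j_closed)
next
  fix x y
  assume "x \<in> carrier (nat_order S)" "y \<in> carrier (nat_order S)"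
    "x \<sqsubseteq>\<^bsub>nat_order S\<^esub> y" "y \<sqsubseteq>\<^bsub>nat_order S\<^esub> x"
  then show "x = y"
    using le_antisym[of "j x" "j y"] by (simp add: nat_le_iff j_closed j_inject)
qed (auto simp: nat_le_iff j_closed intro: le_refl)

lemma partial_order_proj_order: "partial_order (proj_order S)"
proof (rule partial_orderI)
  fix x y z
  assume "x \<in> carrier (proj_order S)" "y \<in> carrier (proj_order S)" "z \<in> carrier (proj_order S)"
    "x \<sqsubseteq>\<^bsub>proj_order S\<^esub> y" "y \<sqsubseteq>\<^bsub>proj_order S\<^esub> z"
  then show "x \<sqsubseteq>\<^bsub>proj_order S\<^esub> z"
    using le_trans[of "j x" "j y" "j z"] by (simp add: proj_le_iff j_closed projD)
next
  fix x y
  assume "x \<in> carrier (proj_order S)" "y \<in> carrier (proj_order S)"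
    "x \<sqsubseteq>\<^bsub>proj_order S\<^esub> y" "y \<sqsubseteq>\<^bsub>proj_order S\<^esub> x"
  then show "x = y"
    using le_antisym[of "j x" "j y"] by (simp add: proj_le_iff j_closed projD j_inject)
qed (auto simp: proj_le_iff j_closed projD intro: le_refl)

lemma sup_proj_order:
  assumes A: "A \<subseteq> proj S"
  shows "\<Squnion>\<^bsub>proj_order S\<^esub>A \<in> proj S" "j (\<Squnion>\<^bsub>proj_order S\<^esub>A) = \<Or>(j ` A)"
    "is_lub (proj_order S) (\<Squnion>\<^bsub>proj_order S\<^esub>A) A"
proof -
  have "\<Or>(j ` A) \<in> below_one Q" using A projD by (intro Join_below_one) auto
  then obtain s where s: "s \<in> proj S" "j s = \<Or>(j ` A)" using j_proj by (metis (no_types) imageE)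
  note lub = is_lub_proj_order[OF A this]
  note eq = partial_order.sup_eq[OF partial_order_proj_order lub]
  show "\<Squnion>\<^bsub>proj_order S\<^esub>A \<in> proj S" "j (\<Squnion>\<^bsub>proj_order S\<^esub>A) = \<Or>(j ` A)"
    "is_lub (proj_order S) (\<Squnion>\<^bsub>proj_order S\<^esub>A) A"
    unfolding eq using s lub by auto
qed

lemma complete_lattice_proj_order: "complete_lattice (proj_order S)"
  using sup_proj_order(3) by (intro partial_order.complete_lattice_if_lubs partial_order_proj_order) auto

lemma meet_nat_order:
  assumes "s \<in> carrier S" "t \<in> carrier S"
  shows "s \<sqinter>\<^bsub>nat_order S\<^esub> t \<in> carrier S" "j (s \<sqinter>\<^bsub>nat_order S\<^esub> t) = j s \<sqdot> j t"
proof -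
  have "j s \<sqdot> j t \<in> partial_isometries Q"
    using assms by (intro partial_isometry_down[OF meet_le(1) j_partial_isometry] j_closed meet_closed)
  then obtain u where u: "u \<in> carrier S" "j u = j s \<sqdot> j t" by (rule j_surj)
  then have "s \<sqinter>\<^bsub>nat_order S\<^esub> t = u"
    using assms by (intro partial_order.meet_eq partial_order_nat_order is_glb_nat_order)
  then show "s \<sqinter>\<^bsub>nat_order S\<^esub> t \<in> carrier S" "j (s \<sqinter>\<^bsub>nat_order S\<^esub> t) = j s \<sqdot> j t"
    using u by auto
qed

lemma meet_proj_order:
  assumes "f \<in> proj S" "g \<in> proj S"
  shows "f \<sqinter>\<^bsub>proj_order S\<^esub> g = f \<otimes>\<^bsub>S\<^esub> g"
proof (rule partial_order.meet_eq[OF partial_order_proj_order])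
  interpret SM: restriction_monoid S by (rule restriction_monoid_S)
  note fg = SM.proj_mult_closed[OF assms]
  show "is_glb (proj_order S) (f \<otimes>\<^bsub>S\<^esub> g) {f, g}"
    using assms fg below_one_mult_le[of "j f" "j g"] below_one_mult_le[of "j g" "j f"]
    by (subst is_glb_iff) (auto simp: proj_le_iff j_mult projD below_one_closed intro: below_one_le_mult)
qed

lemma top_proj_order: "\<top>\<^bsub>proj_order S\<^esub> = \<one>\<^bsub>S\<^esub>"
proof -
  interpret L: complete_lattice "proj_order S" by (rule complete_lattice_proj_order)
  have one: "\<one>\<^bsub>S\<^esub> \<in> proj S" by (simp add: proj_iff S_one_closed j_one one_below_one)
  have "f \<sqsubseteq>\<^bsub>proj_order S\<^esub> \<one>\<^bsub>S\<^esub>" if "f \<in> carrier (proj_order S)" for f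
    using that one projD(1)[of f] by (simp add: proj_le_iff j_one below_one_def)
  then show ?thesis using L.top_weak_eq[of "\<one>\<^bsub>S\<^esub>"] one by simp
qed

text \<open>Multiplication is the meet of projections, so the frame law is an instance of the
  distributivity of multiplication over joins.\<close>

lemma frame_proj_order: "frame (proj_order S)"
proof -
  interpret L: complete_lattice "proj_order S" by (rule complete_lattice_proj_order)
  interpret SM: restriction_monoid S by (rule restriction_monoid_S)
  show ?thesis
  proof
    fix x A assume "x \<in> carrier (proj_order S)" "A \<subseteq> carrier (proj_order S)"
    then have x: "x \<in> proj S" and A: "A \<subseteq> proj S" by auto
    have meets: "(\<lambda>y. x \<sqinter>\<^bsub>proj_order S\<^esub> y) ` A = (\<lambda>y. x \<otimes>\<^bsub>S\<^esub> y) ` A"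
      using x A by (intro image_cong refl meet_proj_order) auto
    have sub: "(\<lambda>y. x \<otimes>\<^bsub>S\<^esub> y) ` A \<subseteq> proj S"
      using x A SM.proj_mult_closed by auto
    have jA: "j ` A \<subseteq> carrier Q" using A projD by (intro j_image_closed) auto
    have "j (x \<otimes>\<^bsub>S\<^esub> \<Squnion>\<^bsub>proj_order S\<^esub>A) = \<Or>((\<lambda>b. j x \<otimes> b) ` j ` A)"
      using sup_proj_order[OF A] x projD mult_join[OF j_closed jA, of x] by (simp add: j_mult)
    also have "(\<lambda>b. j x \<otimes> b) ` j ` A = j ` (\<lambda>y. x \<otimes>\<^bsub>S\<^esub> y) ` A"
      unfolding image_image using x A projD by (intro image_cong refl j_mult[symmetric]) auto
    also have "\<Or>\<dots> = j (\<Squnion>\<^bsub>proj_order S\<^esub>((\<lambda>y. x \<otimes>\<^bsub>S\<^esub> y) ` A))"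
      using sup_proj_order(2)[OF sub] by simp
    finally show "x \<sqinter>\<^bsub>proj_order S\<^esub> (\<Squnion>\<^bsub>proj_order S\<^esub>A)
        = \<Squnion>\<^bsub>proj_order S\<^esub>((\<lambda>y. x \<sqinter>\<^bsub>proj_order S\<^esub> y) ` A)"
      unfolding meets using x sup_proj_order(1)[OF A] sup_proj_order(1)[OF sub] projD S_mult_closed
      by (simp add: meet_proj_order j_inject)
  qed
qed

theorem complete_restriction_monoid_S: "complete_restriction_monoid S"
proof -
  have lub: "\<exists>s. is_lub (nat_order S) s A"
    if A: "A \<subseteq> carrier S" and comp: "\<And>a b. \<lbrakk>a \<in> A; b \<in> A\<rbrakk> \<Longrightarrow> compatible S a b" for A
  proof -
    have lam: "j a \<otimes> lam Q (j b) = j b \<otimes> lam Q (j a)"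
      and rho: "rho Q (j b) \<otimes> j a = rho Q (j a) \<otimes> j b" if "a \<in> A" "b \<in> A" for a b
    proof -
      have ab: "a \<in> carrier S" "b \<in> carrier S" using that A by auto
      then show "j a \<otimes> lam Q (j b) = j b \<otimes> lam Q (j a)" "rho Q (j b) \<otimes> j a = rho Q (j a) \<otimes> j b"
        using comp[OF that] by (simp_all add: compatible_def S_lam_closed S_rho_closed
            flip: j_lam j_rho j_mult)
    qed
    have "\<Or>(j ` A) \<in> partial_isometries Q"
      using A j_partial_isometry lam rho by (intro partial_isometry_Join) auto
    then obtain s where "s \<in> carrier S" "j s = \<Or>(j ` A)" by (rule j_surj)
    then show ?thesis using is_lub_nat_order_iff[OF A] by blast
  qed
  then show ?thesis
    by (intro complete_restriction_monoid.intro complete_restriction_monoid_axioms.intro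
        restriction_monoid_S frame_proj_order) (use lub in blast)
qed

end


section \<open>Morphisms of quantal frames and of their partial isometries\<close>

lemma preserves_finite_meetsI:
  assumes "complete_lattice L" "complete_lattice M" and f: "f \<in> carrier L \<rightarrow> carrier M"
    and meets: "\<And>x y. \<lbrakk>x \<in> carrier L; y \<in> carrier L\<rbrakk> \<Longrightarrow> f (x \<sqinter>\<^bsub>L\<^esub> y) = f x \<sqinter>\<^bsub>M\<^esub> f y"
    and A: "finite A" "A \<noteq> {}" "A \<subseteq> carrier L"
  shows "f (\<Sqinter>\<^bsub>L\<^esub>A) = \<Sqinter>\<^bsub>M\<^esub>(f ` A)"
proof -
  interpret L: complete_lattice L by fact
  interpret M: complete_lattice M by fact
  show ?thesis
    using A
  proof (induction rule: finite_ne_induct)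
    case (singleton x)
    then have "f x \<in> carrier M" using f by auto
    then show ?case using singleton L.inf_of_singleton[of x] M.inf_of_singleton[of "f x"] by simp
  next
    case (insert a A)
    then have fA: "f a \<in> carrier M" "f ` A \<subseteq> carrier M" using f by auto
    have "\<Sqinter>\<^bsub>L\<^esub>(insert a A) = a \<sqinter>\<^bsub>L\<^esub> \<Sqinter>\<^bsub>L\<^esub>A"
      using insert.prems L.weak_inf_insert[of a A] by (simp add: L.eq_is_equal)
    moreover have "\<Sqinter>\<^bsub>M\<^esub>(insert (f a) (f ` A)) = f a \<sqinter>\<^bsub>M\<^esub> \<Sqinter>\<^bsub>M\<^esub>(f ` A)"
      using fA M.weak_inf_insert[of "f a" "f ` A"] by (simp add: M.eq_is_equal)
    ultimately show ?case using insert meets[of a "\<Sqinter>\<^bsub>L\<^esub>A"] by simp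
  qed
qed

lemma frame_morphismI:
  assumes L: "complete_lattice L" and M: "complete_lattice M"
    and f: "f \<in> carrier L \<rightarrow> carrier M"
    and joins: "\<And>A. A \<subseteq> carrier L \<Longrightarrow> f (\<Squnion>\<^bsub>L\<^esub>A) = \<Squnion>\<^bsub>M\<^esub>(f ` A)"
    and top: "f \<top>\<^bsub>L\<^esub> = \<top>\<^bsub>M\<^esub>"
    and meets: "\<And>x y. \<lbrakk>x \<in> carrier L; y \<in> carrier L\<rbrakk> \<Longrightarrow> f (x \<sqinter>\<^bsub>L\<^esub> y) = f x \<sqinter>\<^bsub>M\<^esub> f y"
  shows "frame_morphism L M f"
proof -
  interpret L: complete_lattice L by fact
  interpret M: complete_lattice M by fact
  have "f (\<Sqinter>\<^bsub>L\<^esub>A) = \<Sqinter>\<^bsub>M\<^esub>(f ` A)" if "A \<subseteq> carrier L" "finite A" for A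
  proof (cases "A = {}")
    case True
    then show ?thesis
      using top L.weak_inf_empty M.weak_inf_empty by (simp add: L.eq_is_equal M.eq_is_equal)
  next
    case False
    show ?thesis by (rule preserves_finite_meetsI[OF L M f meets that(2) False that(1)])
  qed
  then show ?thesis unfolding frame_morphism_def using f joins by blast
qed

lemma (in unital_quantale) Join_mult_Join:
  assumes A: "A \<subseteq> carrier Q" and B: "B \<subseteq> carrier Q"
  shows "\<Or>A \<otimes> \<Or>B = \<Or>(\<Union>a\<in>A. (\<lambda>b. a \<otimes> b) ` B)"
proof -
  have "\<Or>A \<otimes> \<Or>B = \<Or>((\<lambda>a. a \<otimes> \<Or>B) ` A)"
    using A B by (intro join_mult Join_closed)
  also have "(\<lambda>a. a \<otimes> \<Or>B) ` A = (\<lambda>a. \<Or>((\<lambda>b. a \<otimes> b) ` B)) ` A"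
    using A B by (intro image_cong refl mult_join) auto
  also have "\<Or>\<dots> = \<Or>(\<Union>a\<in>A. (\<lambda>b. a \<otimes> b) ` B)"
    using A B by (intro Join_UN[symmetric]) auto
  finally show ?thesis .
qed

lemma (in ehresmann_quantal_frame) Join_meet_Join:
  assumes A: "A \<subseteq> carrier Q" and B: "B \<subseteq> carrier Q"
  shows "\<Or>A \<sqdot> \<Or>B = \<Or>(\<Union>a\<in>A. (\<lambda>b. a \<sqdot> b) ` B)"
proof -
  have comm: "x \<sqdot> y = y \<sqdot> x" for x y by (simp add: meet_def insert_commute)
  have "\<Or>A \<sqdot> \<Or>B = \<Or>((\<lambda>a. \<Or>B \<sqdot> a) ` A)"
    unfolding comm[of "\<Or>A"] using A B by (intro meet_Join Join_closed)
  also have "(\<lambda>a. \<Or>B \<sqdot> a) ` A = (\<lambda>a. \<Or>((\<lambda>b. a \<sqdot> b) ` B)) ` A"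
    unfolding comm[of "\<Or>B"] using A B by (intro image_cong refl meet_Join) auto
  also have "\<Or>\<dots> = \<Or>(\<Union>a\<in>A. (\<lambda>b. a \<sqdot> b) ` B)"
    using A B meet_closed by (intro Join_UN[symmetric]) auto
  finally show ?thesis .
qed

text \<open>The map on \<open>S\<close> that corresponds to \<open>\<theta>\<close> restricted to partial isometries.\<close>

definition transfer ::
  "('a, 'm) restr_monoid_scheme \<Rightarrow> ('a \<Rightarrow> 'b) \<Rightarrow> ('c, 'n) restr_monoid_scheme \<Rightarrow> ('c \<Rightarrow> 'd) \<Rightarrow>
   ('b \<Rightarrow> 'd) \<Rightarrow> 'a \<Rightarrow> 'c" where
  "transfer S j S' j' \<theta> = (\<lambda>x\<in>carrier S. inv_into (carrier S') j' (\<theta> (j x)))"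

locale representation_pair =
  A: partial_isometry_representation S Q j + B: partial_isometry_representation S' Q' j'
  for S :: "('a, 'm) restr_monoid_scheme" and Q :: "('b, 'n) lr_quantale_scheme" and j :: "'a \<Rightarrow> 'b"
    and S' :: "('c, 'k) restr_monoid_scheme" and Q' :: "('d, 'l) lr_quantale_scheme"
    and j' :: "'c \<Rightarrow> 'd"
begin

abbreviation J where "J X \<equiv> \<Squnion>\<^bsub>lat Q\<^esub>X"
abbreviation J' where "J' X \<equiv> \<Squnion>\<^bsub>lat Q'\<^esub>X"

context
  fixes \<theta> assumes \<theta>: "rqf_morphism Q Q' \<theta>"
begin

lemma \<theta>_closed: "a \<in> carrier Q \<Longrightarrow> \<theta> a \<in> carrier Q'"
  and \<theta>_ext: "\<theta> \<in> extensional (carrier Q)"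
  and \<theta>_join: "X \<subseteq> carrier Q \<Longrightarrow> \<theta> (J X) = J' (\<theta> ` X)"
  and \<theta>_mult: "\<lbrakk>a \<in> carrier Q; b \<in> carrier Q\<rbrakk> \<Longrightarrow> \<theta> (a \<otimes>\<^bsub>Q\<^esub> b) = \<theta> a \<otimes>\<^bsub>Q'\<^esub> \<theta> b"
  and \<theta>_one: "\<theta> \<one>\<^bsub>Q\<^esub> = \<one>\<^bsub>Q'\<^esub>"
  and \<theta>_lam: "a \<in> carrier Q \<Longrightarrow> \<theta> (lam Q a) = lam Q' (\<theta> a)"
  and \<theta>_rho: "a \<in> carrier Q \<Longrightarrow> \<theta> (rho Q a) = rho Q' (\<theta> a)"
  and \<theta>_pi: "p \<in> partial_isometries Q \<Longrightarrow> \<theta> p \<in> partial_isometries Q'"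
  using \<theta> unfolding rqf_morphism_def hom_def PiE_def by auto

abbreviation (input) "\<phi> \<equiv> transfer S j S' j' \<theta>"

lemma transfer_ext: "\<phi> \<in> extensional (carrier S)"
  by (simp add: transfer_def)

lemma transfer_closed: "x \<in> carrier S \<Longrightarrow> \<phi> x \<in> carrier S'"
  and j'_transfer: "x \<in> carrier S \<Longrightarrow> j' (\<phi> x) = \<theta> (j x)"
proof -
  assume x: "x \<in> carrier S"
  then have "\<theta> (j x) \<in> j' ` carrier S'"
    using \<theta>_pi[OF A.j_partial_isometry[OF x]] B.bij by (simp add: bij_betw_def)
  then show "\<phi> x \<in> carrier S'" "j' (\<phi> x) = \<theta> (j x)"
    using x by (simp_all add: transfer_def inv_into_into f_inv_into_f)
qed

lemma transfer_mult: "\<lbrakk>x \<in> carrier S; y \<in> carrier S\<rbrakk> \<Longrightarrow> \<phi> (x \<otimes>\<^bsub>S\<^esub> y) = \<phi> x \<otimes>\<^bsub>S'\<^esub> \<phi> y"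
  by (simp add: j'_transfer transfer_closed A.S_mult_closed B.S_mult_closed A.j_mult B.j_mult
      \<theta>_mult A.j_closed flip: B.j_inject)

lemma transfer_one: "\<phi> \<one>\<^bsub>S\<^esub> = \<one>\<^bsub>S'\<^esub>"
  by (simp add: j'_transfer transfer_closed A.S_one_closed B.S_one_closed A.j_one B.j_one
      \<theta>_one flip: B.j_inject)

lemma transfer_lam: "x \<in> carrier S \<Longrightarrow> \<phi> (lam S x) = lam S' (\<phi> x)"
  and transfer_rho: "x \<in> carrier S \<Longrightarrow> \<phi> (rho S x) = rho S' (\<phi> x)"
  by (simp_all add: j'_transfer transfer_closed A.S_lam_closed B.S_lam_closed A.j_lam B.j_lam
      A.S_rho_closed B.S_rho_closed A.j_rho B.j_rho \<theta>_lam \<theta>_rho A.j_closed flip: B.j_inject)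

lemma transfer_proj:
  assumes "f \<in> proj S"
  shows "\<phi> f \<in> proj S'"
proof -
  interpret MA: restriction_monoid S by (rule A.restriction_monoid_S)
  interpret MB: restriction_monoid S' by (rule B.restriction_monoid_S)
  have f: "f \<in> carrier S" using assms by (rule A.projD)
  have "\<phi> f = lam S' (\<phi> f)" using transfer_lam[OF f] MA.lam_id[OF assms] by simp
  then show ?thesis using MB.lam_proj[OF transfer_closed[OF f]] by simp
qed

lemma transfer_frame_morphism: "frame_morphism (proj_order S) (proj_order S') \<phi>"
proof (rule frame_morphismI)
  show "complete_lattice (proj_order S)" "complete_lattice (proj_order S')"
    by (rule A.complete_lattice_proj_order B.complete_lattice_proj_order)+
  show "\<phi> \<in> carrier (proj_order S) \<rightarrow> carrier (proj_order S')"
    using transfer_proj by simp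
  show "\<phi> \<top>\<^bsub>proj_order S\<^esub> = \<top>\<^bsub>proj_order S'\<^esub>"
    by (simp add: A.top_proj_order B.top_proj_order transfer_one)
  show "\<phi> (x \<sqinter>\<^bsub>proj_order S\<^esub> y) = \<phi> x \<sqinter>\<^bsub>proj_order S'\<^esub> \<phi> y"
    if "x \<in> carrier (proj_order S)" "y \<in> carrier (proj_order S)" for x y
    using that by (simp add: A.meet_proj_order B.meet_proj_order transfer_proj transfer_mult A.projD)
  show "\<phi> (\<Squnion>\<^bsub>proj_order S\<^esub>X) = \<Squnion>\<^bsub>proj_order S'\<^esub>(\<phi> ` X)" if "X \<subseteq> carrier (proj_order S)" for X
  proof -
    have X: "X \<subseteq> proj S" "\<phi> ` X \<subseteq> proj S'" and XS: "X \<subseteq> carrier S"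
      using that transfer_proj A.projD by auto
    note supA = A.sup_proj_order[OF X(1)] and supB = B.sup_proj_order[OF X(2)]
    have "j' (\<phi> (\<Squnion>\<^bsub>proj_order S\<^esub>X)) = J' (\<theta> ` j ` X)"
      using supA A.projD \<theta>_join[OF A.j_image_closed[OF XS]] by (simp add: j'_transfer)
    also have "\<theta> ` j ` X = j' ` \<phi> ` X"
      unfolding image_image using XS by (intro image_cong refl j'_transfer[symmetric]) auto
    also have "J' \<dots> = j' (\<Squnion>\<^bsub>proj_order S'\<^esub>(\<phi> ` X))" using supB by simp
    finally show ?thesis
      using supA supB(1,2) B.projD(2)[OF supB(1)] B.projD(2)[OF transfer_proj[OF supA(1)]]
      by (simp flip: B.j_inject)
  qed
qed

lemma transfer_crm_morphism: "crm_morphism S S' \<phi>"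
  unfolding crm_morphism_def hom_def
  using transfer_frame_morphism transfer_ext
  by (simp add: transfer_closed transfer_mult transfer_lam transfer_rho PiE_def)

text \<open>If \<open>\<theta>\<close> preserves the top element, then \<open>j' t\<close> lies below the join of all \<open>\<theta> p\<close> with \<open>p\<close> a partial
  isometry. By the frame law \<open>j' t\<close> is the join of its meets with these \<open>\<theta> p\<close>, which are partial
  isometries.\<close>

lemma transfer_proper:
  assumes "rqf_proper Q Q' \<theta>"
  shows "crm_proper S S' \<phi>"
  unfolding crm_proper_def
proof
  fix t assume t: "t \<in> carrier S'"
  let ?X = "{x \<in> carrier S'. qle Q' (j' x) (j' t) \<and> (\<exists>s \<in> carrier S. qle Q' (j' x) (j' (\<phi> s)))}"
  have jX: "j' ` ?X \<subseteq> carrier Q'" by (intro B.j_image_closed) auto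
  let ?P = "{p \<in> partial_isometries Q. qle Q p \<top>\<^bsub>lat Q\<^esub>}"
  have PQ: "?P \<subseteq> carrier Q" using A.partial_isometry_closed by auto
  have "\<top>\<^bsub>lat Q'\<^esub> = J' (\<theta> ` ?P)"
    using assms A.eq_Join_partial_isometries[OF A.lat.top_closed[simplified]] \<theta>_join[OF PQ]
    by (simp add: rqf_proper_def)
  then have "qle Q' (j' t) (J' (\<theta> ` ?P))"
    using B.lat.top_higher[of "j' t"] t by (simp add: B.j_closed)
  then have "j' t = J' ((\<lambda>b. j' t \<sqinter>\<^bsub>lat Q'\<^esub> b) ` \<theta> ` ?P)"
    using t PQ \<theta>_closed by (intro B.eq_Join_meets B.j_closed) auto
  also have "qle Q' \<dots> (J' (j' ` ?X))"
  proof (rule B.Join_mono[OF _ jX], safe)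
    fix p assume p: "p \<in> partial_isometries Q"
    then obtain s where s: "s \<in> carrier S" "j s = p" by (rule A.j_surj)
    have jt: "j' t \<in> partial_isometries Q'" "j' t \<in> carrier Q'" and \<theta>p: "\<theta> p \<in> carrier Q'"
      using t p by (auto intro: B.j_partial_isometry B.j_closed \<theta>_closed A.partial_isometry_closed)
    then have "j' t \<sqinter>\<^bsub>lat Q'\<^esub> \<theta> p \<in> partial_isometries Q'"
      by (intro B.partial_isometry_down[OF B.meet_le(1) jt(1)] B.meet_closed)
    then obtain x where x: "x \<in> carrier S'" "j' x = j' t \<sqinter>\<^bsub>lat Q'\<^esub> \<theta> p" by (rule B.j_surj)
    then have "qle Q' (j' x) (j' t)" "qle Q' (j' x) (j' (\<phi> s))"
      using s B.meet_le[OF jt(2) \<theta>p] by (simp_all add: j'_transfer)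
    then have "x \<in> ?X" using x(1) s(1) by blast
    then show "j' t \<sqinter>\<^bsub>lat Q'\<^esub> \<theta> p \<in> j' ` ?X" unfolding x(2)[symmetric] by (rule imageI)
  qed
  finally have "qle Q' (j' t) (J' (j' ` ?X))" .
  moreover have "qle Q' (J' (j' ` ?X)) (j' t)"
    using jX t by (intro B.Join_least B.j_closed) auto
  ultimately have "j' t = J' (j' ` ?X)"
    using jX t by (intro B.le_antisym B.j_closed B.Join_closed)
  then have "is_lub (nat_order S') t ?X"
    using t by (subst B.is_lub_nat_order_iff) auto
  then show "\<exists>X\<subseteq>carrier S'. is_lub (nat_order S') t X \<and>
      (\<forall>x\<in>X. \<exists>s\<in>carrier S. x \<sqsubseteq>\<^bsub>nat_order S'\<^esub> \<phi> s)"
    by (intro exI[of _ ?X]) (auto simp: B.nat_le_iff transfer_closed)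
qed

lemma transfer_meet_preserving:
  assumes "rqf_meet_preserving Q Q' \<theta>"
  shows "crm_meet_preserving S S' \<phi>"
  unfolding crm_meet_preserving_def
proof (intro ballI)
  fix s t assume st: "s \<in> carrier S" "t \<in> carrier S"
  have "\<theta> (j s \<sqinter>\<^bsub>lat Q\<^esub> j t) = \<theta> (j s) \<sqinter>\<^bsub>lat Q'\<^esub> \<theta> (j t)"
    using assms[unfolded rqf_meet_preserving_def, rule_format, of "{j s, j t}"] st
    by (simp add: meet_def A.j_closed)
  then show "\<phi> (s \<sqinter>\<^bsub>nat_order S\<^esub> t) = \<phi> s \<sqinter>\<^bsub>nat_order S'\<^esub> \<phi> t"
    using st by (simp add: j'_transfer transfer_closed A.meet_nat_order B.meet_nat_order flip: B.j_inject)
qed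

lemma transfer_crm_morphisms: "\<theta> \<in> rqf_morphisms k Q Q' \<Longrightarrow> \<phi> \<in> crm_morphisms k S S'"
  unfolding rqf_morphisms_def crm_morphisms_def
  using transfer_crm_morphism transfer_proper transfer_meet_preserving by simp

lemma \<theta>_eq_Join_transfer:
  assumes a: "a \<in> carrier Q"
  shows "\<theta> a = J' ((\<lambda>x. j' (\<phi> x)) ` {x \<in> carrier S. qle Q (j x) a})"
proof -
  let ?P = "{p \<in> partial_isometries Q. qle Q p a}"
  have "\<theta> a = J' (\<theta> ` ?P)"
    using A.eq_Join_partial_isometries[OF a] \<theta>_join[of ?P] A.partial_isometry_closed by auto
  also have "?P = j ` {x \<in> carrier S. qle Q (j x) a}"
    using A.j_partial_isometry by (auto elim: A.j_surj)
  also have "\<theta> ` \<dots> = (\<lambda>x. j' (\<phi> x)) ` {x \<in> carrier S. qle Q (j x) a}"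
    unfolding image_image by (intro image_cong refl) (simp add: j'_transfer)
  finally show ?thesis .
qed

end

context
  fixes \<phi> assumes \<phi>: "crm_morphism S S' \<phi>"
begin

lemma \<phi>_closed: "x \<in> carrier S \<Longrightarrow> \<phi> x \<in> carrier S'"
  and \<phi>_ext: "\<phi> \<in> extensional (carrier S)"
  and \<phi>_mult: "\<lbrakk>x \<in> carrier S; y \<in> carrier S\<rbrakk> \<Longrightarrow> \<phi> (x \<otimes>\<^bsub>S\<^esub> y) = \<phi> x \<otimes>\<^bsub>S'\<^esub> \<phi> y"
  and \<phi>_lam: "x \<in> carrier S \<Longrightarrow> \<phi> (lam S x) = lam S' (\<phi> x)"
  and \<phi>_rho: "x \<in> carrier S \<Longrightarrow> \<phi> (rho S x) = rho S' (\<phi> x)"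
  and \<phi>_frame: "frame_morphism (proj_order S) (proj_order S') \<phi>"
  using \<phi> unfolding crm_morphism_def hom_def PiE_def by auto

lemma \<phi>_proj: "f \<in> proj S \<Longrightarrow> \<phi> f \<in> proj S'"
  and \<phi>_join: "X \<subseteq> proj S \<Longrightarrow> \<phi> (\<Squnion>\<^bsub>proj_order S\<^esub>X) = \<Squnion>\<^bsub>proj_order S'\<^esub>(\<phi> ` X)"
  using \<phi>_frame unfolding frame_morphism_def by auto

lemma \<phi>_one: "\<phi> \<one>\<^bsub>S\<^esub> = \<one>\<^bsub>S'\<^esub>"
proof -
  interpret LA: complete_lattice "proj_order S" by (rule A.complete_lattice_proj_order)
  interpret LB: complete_lattice "proj_order S'" by (rule B.complete_lattice_proj_order)
  have "\<phi> (\<Sqinter>\<^bsub>proj_order S\<^esub>{}) = \<Sqinter>\<^bsub>proj_order S'\<^esub>{}"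
    using \<phi>_frame by (simp add: frame_morphism_def)
  then show ?thesis
    using LA.weak_inf_empty LB.weak_inf_empty by (simp add: A.top_proj_order B.top_proj_order)
qed

lemma \<phi>_mono:
  assumes "qle Q (j x) (j y)" "x \<in> carrier S" "y \<in> carrier S"
  shows "qle Q' (j' (\<phi> x)) (j' (\<phi> y))"
proof -
  have "nat_le S (proj S) x y" using assms by (simp add: A.nat_le_iff)
  then obtain f g where "f \<in> proj S" "g \<in> proj S" "x = g \<otimes>\<^bsub>S\<^esub> y" "x = y \<otimes>\<^bsub>S\<^esub> f"
    by (auto simp: nat_le_def)
  then have "\<phi> x = \<phi> g \<otimes>\<^bsub>S'\<^esub> \<phi> y" "\<phi> x = \<phi> y \<otimes>\<^bsub>S'\<^esub> \<phi> f" "\<phi> f \<in> proj S'" "\<phi> g \<in> proj S'"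
    using assms(3) A.projD \<phi>_mult \<phi>_proj by metis+
  then have "nat_le S' (proj S') (\<phi> x) (\<phi> y)" unfolding nat_le_def by blast
  then show ?thesis using assms by (simp add: B.nat_le_iff \<phi>_closed)
qed

definition below where "below a = {x \<in> carrier S. qle Q (j x) a}"

text \<open>Since \<open>a\<close> is the join of the elements \<open>j x \<preceq> a\<close>, this is the only possible join-preserving extension
  of \<open>\<phi>\<close>.\<close>

definition extend :: "'b \<Rightarrow> 'd" where
  "extend = (\<lambda>a\<in>carrier Q. J' ((\<lambda>x. j' (\<phi> x)) ` below a))"

lemma below_subset: "below a \<subseteq> carrier S"
  by (auto simp: below_def)

lemma eq_Join_below:
  assumes a: "a \<in> carrier Q"
  shows "a = J (j ` below a)"
proof -
  have "{p \<in> partial_isometries Q. qle Q p a} = j ` below a"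
    using A.j_partial_isometry by (auto simp: below_def elim: A.j_surj)
  then show ?thesis using A.eq_Join_partial_isometries[OF a] by simp
qed

lemma extend_eq: "a \<in> carrier Q \<Longrightarrow> extend a = J' ((\<lambda>x. j' (\<phi> x)) ` below a)"
  by (simp add: extend_def)

lemma image_closed: "X \<subseteq> carrier S \<Longrightarrow> (\<lambda>x. j' (\<phi> x)) ` X \<subseteq> carrier Q'"
  by (auto intro: B.j_closed \<phi>_closed)

lemma extend_closed: "a \<in> carrier Q \<Longrightarrow> extend a \<in> carrier Q'"
  by (simp add: extend_eq B.Join_closed image_closed below_subset)

lemma le_extend: "\<lbrakk>x \<in> carrier S; qle Q (j x) a; a \<in> carrier Q\<rbrakk> \<Longrightarrow> qle Q' (j' (\<phi> x)) (extend a)"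
  by (auto simp: extend_eq below_def intro!: B.Join_upper B.j_closed \<phi>_closed)

lemma extend_least:
  "\<lbrakk>a \<in> carrier Q; u \<in> carrier Q'; \<And>x. \<lbrakk>x \<in> carrier S; qle Q (j x) a\<rbrakk> \<Longrightarrow> qle Q' (j' (\<phi> x)) u\<rbrakk>
   \<Longrightarrow> qle Q' (extend a) u"
  by (auto simp: extend_eq below_def intro!: B.Join_least B.j_closed \<phi>_closed)

lemma extend_mono:
  assumes "qle Q a b" "a \<in> carrier Q" "b \<in> carrier Q"
  shows "qle Q' (extend a) (extend b)"
  using assms A.le_trans[of "j _" a b]
  by (intro extend_least extend_closed le_extend) (auto intro: A.j_closed)

lemma extend_j: "x \<in> carrier S \<Longrightarrow> extend (j x) = j' (\<phi> x)"
  by (intro B.le_antisym extend_least le_extend extend_closed \<phi>_mono)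
    (auto intro: A.j_closed B.j_closed \<phi>_closed A.le_refl)

text \<open>Suppose \<open>j x \<preceq> \<Squnion>X\<close>. By the frame law \<open>j x\<close> is the join of its meets with the members of \<open>X\<close>; these
  meets are restrictions of \<open>j x\<close>, so \<open>x = x \<otimes> e\<close> where \<open>e\<close> is the join of the set \<open>F\<close> of all
  projections \<open>f\<close> such that \<open>j (x \<otimes> f)\<close> lies below a member of \<open>X\<close>. Only joins of projections are
  involved, and these are preserved by \<open>\<phi>\<close>; so \<open>\<phi> x\<close> is the join of the elements
  \<open>\<phi> (x \<otimes> f)\<close>, each of which lies below the image of a member of \<open>X\<close>.\<close>

lemma extend_join_le:
  assumes X: "X \<subseteq> carrier Q" and x: "x \<in> carrier S" and le: "qle Q (j x) (J X)"
  shows "qle Q' (j' (\<phi> x)) (J' (extend ` X))"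
proof -
  define F where "F = {f \<in> proj S. \<exists>a \<in> X. qle Q (j (x \<otimes>\<^bsub>S\<^esub> f)) a}"
  define e where "e = \<Squnion>\<^bsub>proj_order S\<^esub>F"
  have F: "F \<subseteq> proj S" and FS: "F \<subseteq> carrier S" and \<phi>F: "\<phi> ` F \<subseteq> proj S'" and \<phi>FS: "\<phi> ` F \<subseteq> carrier S'"
    using A.projD \<phi>_proj \<phi>_closed by (auto simp: F_def)
  have e: "e \<in> proj S" "j e = J (j ` F)" and eS: "e \<in> carrier S"
    using A.sup_proj_order[OF F] A.projD by (auto simp: e_def)
  have jx: "j x \<in> carrier Q" "j x \<in> partial_isometries Q"
    using x by (auto intro: A.j_closed A.j_partial_isometry)
  have extX: "extend ` X \<subseteq> carrier Q'" using X extend_closed by auto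
  have "j x = J ((\<lambda>a. j x \<sqinter>\<^bsub>lat Q\<^esub> a) ` X)"
    using jx X le by (intro A.eq_Join_meets)
  also have "qle Q \<dots> (j x \<otimes>\<^bsub>Q\<^esub> j e)"
  proof (rule A.Join_least)
    fix c assume "c \<in> (\<lambda>a. j x \<sqinter>\<^bsub>lat Q\<^esub> a) ` X"
    then obtain a where a: "a \<in> X" "c = j x \<sqinter>\<^bsub>lat Q\<^esub> a" by blast
    then have aQ: "a \<in> carrier Q" using X by blast
    have c: "c \<in> carrier Q" "qle Q c (j x)" "qle Q c a"
      using a aQ jx A.meet_closed A.meet_le by auto
    then have cx: "c = j x \<otimes>\<^bsub>Q\<^esub> lam Q c" using jx A.partial_isometry_le by blast
    obtain f where f: "f \<in> proj S" "j f = lam Q c"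
      using A.lam_below[OF c(1)] unfolding A.j_proj[symmetric] by auto
    have "j (x \<otimes>\<^bsub>S\<^esub> f) = c" using x f cx A.projD by (simp add: A.j_mult)
    then have "f \<in> F" using f a c by (auto simp: F_def)
    then have "qle Q (j f) (j e)"
      using e A.j_image_closed[OF FS] by (auto intro: A.Join_upper)
    then have "qle Q (j x \<otimes>\<^bsub>Q\<^esub> j f) (j x \<otimes>\<^bsub>Q\<^esub> j e)"
      using x jx eS f A.projD by (intro A.mult_mono_right A.j_closed)
    then show "qle Q c (j x \<otimes>\<^bsub>Q\<^esub> j e)" using cx f by simp
  qed (use jx X eS A.meet_closed A.j_closed in auto)
  finally have "j x = j x \<otimes>\<^bsub>Q\<^esub> j e"
    using jx eS e(1) A.projD A.below_one_mult_le[of "j e" "j x"] by (intro A.le_antisym) (auto intro: A.j_closed)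
  then have "x = x \<otimes>\<^bsub>S\<^esub> e"
    using x eS A.S_mult_closed by (simp add: A.j_mult flip: A.j_inject)
  then have "\<phi> x = \<phi> x \<otimes>\<^bsub>S'\<^esub> \<phi> e" using \<phi>_mult[OF x eS] by simp
  then have "j' (\<phi> x) = j' (\<phi> x) \<otimes>\<^bsub>Q'\<^esub> j' (\<phi> e)"
    using x eS \<phi>_closed B.j_mult by metis
  also have "j' (\<phi> e) = J' (j' ` \<phi> ` F)"
    using \<phi>_join[OF F] B.sup_proj_order[OF \<phi>F] by (simp add: e_def)
  also have "j' (\<phi> x) \<otimes>\<^bsub>Q'\<^esub> \<dots> = J' ((\<lambda>b. j' (\<phi> x) \<otimes>\<^bsub>Q'\<^esub> b) ` j' ` \<phi> ` F)"
    using x \<phi>FS by (intro B.mult_join B.j_closed \<phi>_closed B.j_image_closed)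
  also have "qle Q' \<dots> (J' (extend ` X))"
  proof (rule B.Join_least)
    show "(\<lambda>b. j' (\<phi> x) \<otimes>\<^bsub>Q'\<^esub> b) ` j' ` \<phi> ` F \<subseteq> carrier Q'"
      using x \<phi>FS B.j_closed \<phi>_closed by auto
    show "J' (extend ` X) \<in> carrier Q'" using extX by (rule B.Join_closed)
    fix c assume "c \<in> (\<lambda>b. j' (\<phi> x) \<otimes>\<^bsub>Q'\<^esub> b) ` j' ` \<phi> ` F"
    then obtain f where f: "f \<in> F" "c = j' (\<phi> x) \<otimes>\<^bsub>Q'\<^esub> j' (\<phi> f)" by blast
    then obtain a where a: "a \<in> X" "qle Q (j (x \<otimes>\<^bsub>S\<^esub> f)) a" by (auto simp: F_def)
    have fS: "f \<in> carrier S" using f FS by blast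
    have "c = j' (\<phi> (x \<otimes>\<^bsub>S\<^esub> f))"
      using f x fS by (simp add: \<phi>_mult B.j_mult \<phi>_closed)
    then have "qle Q' c (extend a)"
      using a X x fS by (auto intro!: le_extend A.S_mult_closed)
    moreover have "qle Q' (extend a) (J' (extend ` X))"
      using a extX by (intro B.Join_upper) auto
    ultimately show "qle Q' c (J' (extend ` X))"
      by (rule B.le_trans)
        (use a X extX f x fS in \<open>auto intro: extend_closed B.Join_closed B.j_closed \<phi>_closed\<close>)
  qed
  finally show ?thesis .
qed

lemma extend_join:
  assumes X: "X \<subseteq> carrier Q"
  shows "extend (J X) = J' (extend ` X)"
proof (rule B.le_antisym)
  have JX: "J X \<in> carrier Q" using X by (rule A.Join_closed)
  have eX: "extend ` X \<subseteq> carrier Q'" using X extend_closed by auto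
  show "qle Q' (extend (J X)) (J' (extend ` X))"
    using X JX eX by (intro extend_least B.Join_closed extend_join_le)
  show "qle Q' (J' (extend ` X)) (extend (J X))"
    using X JX eX by (intro B.Join_least extend_closed) (auto intro!: extend_mono A.Join_upper)
  show "extend (J X) \<in> carrier Q'" "J' (extend ` X) \<in> carrier Q'"
    using JX eX by (auto intro: extend_closed B.Join_closed)
qed

text \<open>An identity between join-preserving operations need only be checked on the generators
  \<open>j x\<close>. This lemma serves \<open>lam\<close> and \<open>rho\<close>, the next one multiplication and binary meets.\<close>

lemma extend_unary:
  assumes h: "\<And>X. X \<subseteq> carrier Q \<Longrightarrow> h (J X) = J (h ` X)"
    and h': "\<And>X. X \<subseteq> carrier Q' \<Longrightarrow> h' (J' X) = J' (h' ` X)"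
    and closed: "\<And>a. a \<in> carrier Q \<Longrightarrow> h a \<in> carrier Q"
    and eq: "\<And>x. x \<in> carrier S \<Longrightarrow> extend (h (j x)) = h' (j' (\<phi> x))"
    and a: "a \<in> carrier Q"
  shows "extend (h a) = h' (extend a)"
proof -
  have ja: "j ` below a \<subseteq> carrier Q" using below_subset by (rule A.j_image_closed)
  have "extend (h a) = extend (h (J (j ` below a)))" using eq_Join_below[OF a] by simp
  also have "\<dots> = J' (extend ` h ` j ` below a)"
    using ja closed by (simp add: h) (intro extend_join, auto)
  also have "extend ` h ` j ` below a = h' ` (\<lambda>x. j' (\<phi> x)) ` below a"
    unfolding image_image using below_subset by (intro image_cong refl eq) auto
  also have "J' \<dots> = h' (extend a)"
    using a by (simp add: extend_eq h'[OF image_closed[OF below_subset]])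
  finally show ?thesis .
qed

lemma extend_binary:
  assumes m: "\<And>X Y. \<lbrakk>X \<subseteq> carrier Q; Y \<subseteq> carrier Q\<rbrakk> \<Longrightarrow> m (J X) (J Y) = J (\<Union>a\<in>X. m a ` Y)"
    and m': "\<And>X Y. \<lbrakk>X \<subseteq> carrier Q'; Y \<subseteq> carrier Q'\<rbrakk> \<Longrightarrow> m' (J' X) (J' Y) = J' (\<Union>a\<in>X. m' a ` Y)"
    and closed: "\<And>a b. \<lbrakk>a \<in> carrier Q; b \<in> carrier Q\<rbrakk> \<Longrightarrow> m a b \<in> carrier Q"
    and eq: "\<And>x y. \<lbrakk>x \<in> carrier S; y \<in> carrier S\<rbrakk> \<Longrightarrow> extend (m (j x) (j y)) = m' (j' (\<phi> x)) (j' (\<phi> y))"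
    and a: "a \<in> carrier Q" and b: "b \<in> carrier Q"
  shows "extend (m a b) = m' (extend a) (extend b)"
proof -
  have ja: "j ` below a \<subseteq> carrier Q" and jb: "j ` below b \<subseteq> carrier Q"
    using below_subset by (intro A.j_image_closed; blast)+
  have "extend (m a b) = extend (m (J (j ` below a)) (J (j ` below b)))"
    using eq_Join_below[OF a] eq_Join_below[OF b] by simp
  also have "\<dots> = extend (J (\<Union>x\<in>j ` below a. m x ` j ` below b))"
    using ja jb by (simp only: m)
  also have "\<dots> = J' (extend ` (\<Union>x\<in>j ` below a. m x ` j ` below b))"
    using ja jb closed by (intro extend_join) blast
  also have "extend ` (\<Union>x\<in>j ` below a. m x ` j ` below b)
      = (\<Union>u\<in>(\<lambda>x. j' (\<phi> x)) ` below a. m' u ` (\<lambda>x. j' (\<phi> x)) ` below b)"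
  proof -
    have "extend (m (j x) (j y)) = m' (j' (\<phi> x)) (j' (\<phi> y))" if "x \<in> below a" "y \<in> below b" for x y
      using that below_subset by (intro eq) auto
    then show ?thesis by (simp add: image_UN image_image)
  qed
  also have "J' \<dots> = m' (extend a) (extend b)"
    using a b by (simp add: extend_eq m'[OF image_closed[OF below_subset] image_closed[OF below_subset]])
  finally show ?thesis .
qed

lemma extend_rqf_morphism: "rqf_morphism Q Q' extend"
  unfolding rqf_morphism_def
proof (intro conjI allI impI ballI)
  show "extend \<in> carrier Q \<rightarrow>\<^sub>E carrier Q'"
    using extend_closed by (auto simp: extend_def)
  show "extend (J X) = J' (extend ` X)" if "X \<subseteq> carrier Q" for X
    using that by (rule extend_join)
  have "extend (a \<otimes>\<^bsub>Q\<^esub> b) = extend a \<otimes>\<^bsub>Q'\<^esub> extend b" if "a \<in> carrier Q" "b \<in> carrier Q" for a b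
    using A.Join_mult_Join B.Join_mult_Join _ _ that
  proof (rule extend_binary)
    show "extend (j x \<otimes>\<^bsub>Q\<^esub> j y) = j' (\<phi> x) \<otimes>\<^bsub>Q'\<^esub> j' (\<phi> y)" if "x \<in> carrier S" "y \<in> carrier S" for x y
      using that by (simp add: extend_j A.S_mult_closed \<phi>_mult \<phi>_closed flip: A.j_mult B.j_mult)
  qed (simp_all add: A.m_closed)
  then show "extend \<in> hom Q Q'" using extend_closed by (auto simp: hom_def)
  show "extend \<one>\<^bsub>Q\<^esub> = \<one>\<^bsub>Q'\<^esub>"
    using extend_j[OF A.S_one_closed] by (simp add: A.j_one \<phi>_one B.j_one)
  show "extend (lam Q a) = lam Q' (extend a)" if "a \<in> carrier Q" for a
    using A.lam_join B.lam_join A.lam_closed _ that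
  proof (rule extend_unary)
    show "extend (lam Q (j x)) = lam Q' (j' (\<phi> x))" if "x \<in> carrier S" for x
      using that by (simp add: extend_j A.S_lam_closed \<phi>_lam \<phi>_closed flip: A.j_lam B.j_lam)
  qed
  show "extend (rho Q a) = rho Q' (extend a)" if "a \<in> carrier Q" for a
    using A.rho_join B.rho_join A.rho_closed _ that
  proof (rule extend_unary)
    show "extend (rho Q (j x)) = rho Q' (j' (\<phi> x))" if "x \<in> carrier S" for x
      using that by (simp add: extend_j A.S_rho_closed \<phi>_rho \<phi>_closed flip: A.j_rho B.j_rho)
  qed
  show "extend \<in> partial_isometries Q \<rightarrow> partial_isometries Q'"
  proof
    fix p assume "p \<in> partial_isometries Q"
    then obtain x where "x \<in> carrier S" "j x = p" by (rule A.j_surj)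
    then show "extend p \<in> partial_isometries Q'"
      using extend_j[of x] by (simp add: B.j_partial_isometry \<phi>_closed)
  qed
qed

text \<open>Every partial isometry \<open>j' t\<close> is a join of elements below some \<open>extend (j s)\<close>, hence lies below the
  image of the top element; and the top element of \<open>Q'\<close> is the join of the partial isometries.\<close>

lemma extend_proper:
  assumes proper: "crm_proper S S' \<phi>"
  shows "rqf_proper Q Q' extend"
proof -
  have top: "\<top>\<^bsub>lat Q\<^esub> \<in> carrier Q" "\<top>\<^bsub>lat Q'\<^esub> \<in> carrier Q'"
    using A.lat.top_closed B.lat.top_closed by simp_all
  let ?P = "{p \<in> partial_isometries Q'. qle Q' p \<top>\<^bsub>lat Q'\<^esub>}"
  have P: "?P \<subseteq> carrier Q'" using B.partial_isometry_closed by auto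
  have "qle Q' (J' ?P) (extend \<top>\<^bsub>lat Q\<^esub>)"
  proof (rule B.Join_least[OF P extend_closed[OF top(1)]])
    fix p assume "p \<in> ?P"
    then obtain t where t: "t \<in> carrier S'" "j' t = p" by (auto elim: B.j_surj)
    then obtain X where X: "X \<subseteq> carrier S'" "is_lub (nat_order S') t X"
        "\<And>x. x \<in> X \<Longrightarrow> \<exists>s \<in> carrier S. x \<sqsubseteq>\<^bsub>nat_order S'\<^esub> \<phi> s"
      using proper unfolding crm_proper_def by meson
    have "p = J' (j' ` X)" using X t B.is_lub_nat_order_iff by blast
    also have "qle Q' \<dots> (extend \<top>\<^bsub>lat Q\<^esub>)"
    proof (rule B.Join_least)
      fix c assume "c \<in> j' ` X"
      then obtain x where x: "x \<in> X" "c = j' x" by blast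
      then obtain s where s: "s \<in> carrier S" "x \<sqsubseteq>\<^bsub>nat_order S'\<^esub> \<phi> s" using X(3) by blast
      have xS: "x \<in> carrier S'" using x X by blast
      have "qle Q' c (j' (\<phi> s))" using x s xS by (simp add: B.nat_le_iff \<phi>_closed)
      moreover have "qle Q' (j' (\<phi> s)) (extend \<top>\<^bsub>lat Q\<^esub>)"
        using s top A.lat.top_higher[of "j s"] by (intro le_extend) (simp_all add: A.j_closed)
      ultimately show "qle Q' c (extend \<top>\<^bsub>lat Q\<^esub>)"
        by (rule B.le_trans) (use x xS s top in \<open>auto intro: B.j_closed \<phi>_closed extend_closed\<close>)
    qed (use X B.j_image_closed extend_closed top in auto)
    finally show "qle Q' p (extend \<top>\<^bsub>lat Q\<^esub>)" .
  qed
  then have "qle Q' \<top>\<^bsub>lat Q'\<^esub> (extend \<top>\<^bsub>lat Q\<^esub>)"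
    using B.eq_Join_partial_isometries[OF top(2)] by simp
  then show ?thesis
    unfolding rqf_proper_def using top extend_closed B.lat.top_higher[of "extend \<top>\<^bsub>lat Q\<^esub>"]
    by (intro B.le_antisym) simp_all
qed

lemma extend_meet_preserving:
  assumes meet: "crm_meet_preserving S S' \<phi>"
  shows "rqf_meet_preserving Q Q' extend"
proof -
  have binary: "extend (a \<sqinter>\<^bsub>lat Q\<^esub> b) = extend a \<sqinter>\<^bsub>lat Q'\<^esub> extend b"
    if "a \<in> carrier Q" "b \<in> carrier Q" for a b
    using A.Join_meet_Join B.Join_meet_Join A.meet_closed _ that
  proof (rule extend_binary)
    show "extend (j x \<sqinter>\<^bsub>lat Q\<^esub> j y) = j' (\<phi> x) \<sqinter>\<^bsub>lat Q'\<^esub> j' (\<phi> y)"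
      if "x \<in> carrier S" "y \<in> carrier S" for x y
    proof -
      have "\<phi> (x \<sqinter>\<^bsub>nat_order S\<^esub> y) = \<phi> x \<sqinter>\<^bsub>nat_order S'\<^esub> \<phi> y"
        using meet that by (simp add: crm_meet_preserving_def)
      then show ?thesis
        using that extend_j[OF A.meet_nat_order(1)[OF that]]
        by (simp add: A.meet_nat_order B.meet_nat_order \<phi>_closed)
    qed
  qed
  show ?thesis
    unfolding rqf_meet_preserving_def
  proof (intro allI impI)
    fix X assume "X \<subseteq> carrier Q \<and> finite X \<and> X \<noteq> {}"
    then show "extend (\<Sqinter>\<^bsub>lat Q\<^esub>X) = \<Sqinter>\<^bsub>lat Q'\<^esub>(extend ` X)"
      using binary extend_closed
      by (intro preserves_finite_meetsI[OF A.complete B.complete]) auto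
  qed
qed

lemma extend_rqf_morphisms: "\<phi> \<in> crm_morphisms k S S' \<Longrightarrow> extend \<in> rqf_morphisms k Q Q'"
  unfolding rqf_morphisms_def crm_morphisms_def
  using extend_rqf_morphism extend_proper extend_meet_preserving by simp

lemma transfer_extend: "transfer S j S' j' extend = \<phi>"
proof (rule extensionalityI[of _ "carrier S"])
  show "transfer S j S' j' extend x = \<phi> x" if x: "x \<in> carrier S" for x
    using x j'_transfer[OF extend_rqf_morphism x] transfer_closed[OF extend_rqf_morphism x]
    by (simp add: extend_j B.j_inject \<phi>_closed)
qed (use \<phi>_ext in \<open>simp_all add: transfer_def\<close>)

end

theorem bij_betw_transfer:
  "bij_betw (transfer S j S' j') (rqf_morphisms k Q Q') (crm_morphisms k S S')"
proof (rule bij_betw_imageI)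
  have rqf: "rqf_morphism Q Q' \<theta>" if "\<theta> \<in> rqf_morphisms k Q Q'" for \<theta>
    using that by (simp add: rqf_morphisms_def)
  have crm: "crm_morphism S S' \<phi>" if "\<phi> \<in> crm_morphisms k S S'" for \<phi>
    using that by (simp add: crm_morphisms_def)
  show "inj_on (transfer S j S' j') (rqf_morphisms k Q Q')"
  proof (rule inj_onI)
    fix \<theta>1 \<theta>2
    assume "\<theta>1 \<in> rqf_morphisms k Q Q'" "\<theta>2 \<in> rqf_morphisms k Q Q'"
      and eq: "transfer S j S' j' \<theta>1 = transfer S j S' j' \<theta>2"
    then have m: "rqf_morphism Q Q' \<theta>1" "rqf_morphism Q Q' \<theta>2" by (auto intro: rqf)
    show "\<theta>1 = \<theta>2"
      using \<theta>_ext[OF m(1)] \<theta>_ext[OF m(2)]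
    proof (rule extensionalityI)
      show "\<theta>1 a = \<theta>2 a" if "a \<in> carrier Q" for a
        using \<theta>_eq_Join_transfer[OF m(1) that] \<theta>_eq_Join_transfer[OF m(2) that] eq by simp
    qed
  qed
  show "transfer S j S' j' ` rqf_morphisms k Q Q' = crm_morphisms k S S'"
  proof (intro equalityI subsetI)
    show "\<phi> \<in> crm_morphisms k S S'" if "\<phi> \<in> transfer S j S' j' ` rqf_morphisms k Q Q'" for \<phi>
      using that rqf transfer_crm_morphisms by blast
    show "\<phi> \<in> transfer S j S' j' ` rqf_morphisms k Q Q'" if "\<phi> \<in> crm_morphisms k S S'" for \<phi>
      using that crm[OF that] extend_rqf_morphisms[OF crm[OF that] that]
        transfer_extend[OF crm[OF that]] by (metis imageI)
  qed
qed

end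


section \<open>Order and joins in a complete restriction monoid\<close>

context restriction_semigroup
begin

abbreviation nat_le_syntax (infix \<open>\<unlhd>\<close> 50) where "a \<unlhd> b \<equiv> nat_le S (proj S) a b"

lemma proj_closed: "f \<in> proj S \<Longrightarrow> f \<in> carrier S"
  using proj_subset by blast

lemma lam_closed: "a \<in> carrier S \<Longrightarrow> lam S a \<in> carrier S"
  and rho_closed: "a \<in> carrier S \<Longrightarrow> rho S a \<in> carrier S"
  using lam_proj rho_proj proj_closed by blast+

lemma lam_mult_proj: "\<lbrakk>a \<in> carrier S; f \<in> proj S\<rbrakk> \<Longrightarrow> lam S (a \<otimes> f) = lam S a \<otimes> f"
  using lam_lam_mult[of a f] lam_id[of "lam S a \<otimes> f"] by (simp add: proj_closed lam_proj proj_mult_closed)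

lemma rho_proj_mult: "\<lbrakk>a \<in> carrier S; f \<in> proj S\<rbrakk> \<Longrightarrow> rho S (f \<otimes> a) = f \<otimes> rho S a"
  using rho_mult_rho[of f a] rho_id[of "f \<otimes> rho S a"] by (simp add: proj_closed rho_proj proj_mult_closed)

lemma mult_proj_le: "\<lbrakk>a \<in> carrier S; f \<in> proj S\<rbrakk> \<Longrightarrow> a \<otimes> f \<unlhd> a"
  unfolding nat_le_def using mult_proj rho_proj mult_closed proj_closed by metis

lemma proj_mult_le: "\<lbrakk>a \<in> carrier S; f \<in> proj S\<rbrakk> \<Longrightarrow> f \<otimes> a \<unlhd> a"
  unfolding nat_le_def using proj_mult lam_proj mult_closed proj_closed by metis

lemma nat_leE:
  assumes "a \<unlhd> b"
  obtains f g where "f \<in> proj S" "g \<in> proj S" "a = b \<otimes> f" "a = g \<otimes> b"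
  using assms unfolding nat_le_def by blast

lemma nat_le_lam:
  assumes "a \<unlhd> b" "b \<in> carrier S"
  shows "b \<otimes> lam S a = a"
proof -
  obtain f where f: "f \<in> proj S" "a = b \<otimes> f" using assms(1) by (rule nat_leE)
  have "b \<otimes> lam S a = (b \<otimes> lam S b) \<otimes> f"
    unfolding f(2) using assms(2) f(1) by (simp add: lam_mult_proj mult_assoc lam_closed proj_closed)
  then show ?thesis using f(2) mult_lam[OF assms(2)] by simp
qed

lemma nat_le_rho:
  assumes "a \<unlhd> b" "b \<in> carrier S"
  shows "rho S a \<otimes> b = a"
proof -
  obtain g where g: "g \<in> proj S" "a = g \<otimes> b" using assms(1) by (rule nat_leE)
  have "rho S a \<otimes> b = g \<otimes> (rho S b \<otimes> b)"
    unfolding g(2) using assms(2) g(1) by (simp add: rho_proj_mult mult_assoc rho_closed proj_closed)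
  then show ?thesis using g(2) rho_mult[OF assms(2)] by simp
qed

lemma nat_le_closed: "\<lbrakk>a \<unlhd> b; b \<in> carrier S\<rbrakk> \<Longrightarrow> a \<in> carrier S"
  using mult_closed proj_closed by (auto elim: nat_leE)

lemma nat_le_refl: "a \<in> carrier S \<Longrightarrow> a \<unlhd> a"
  using mult_proj_le[OF _ lam_proj, of a a] mult_lam by simp

lemma nat_le_trans:
  assumes "a \<unlhd> b" "b \<unlhd> c" "c \<in> carrier S"
  shows "a \<unlhd> c"
proof -
  obtain f where f: "f \<in> proj S" "a = b \<otimes> f" using assms(1) by (rule nat_leE)
  obtain g where g: "g \<in> proj S" "b = c \<otimes> g" using assms(2) by (rule nat_leE)
  have "a = c \<otimes> (g \<otimes> f)" using f g assms(3) by (simp add: mult_assoc proj_closed)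
  then show ?thesis using mult_proj_le[OF assms(3) proj_mult_closed[OF g(1) f(1)]] by simp
qed

lemma lam_mono:
  assumes "a \<unlhd> b" "b \<in> carrier S"
  shows "lam S a \<unlhd> lam S b"
proof -
  obtain f where f: "f \<in> proj S" "a = b \<otimes> f" using assms(1) by (rule nat_leE)
  then show ?thesis using mult_proj_le[OF lam_closed[OF assms(2)] f(1)] assms(2) by (simp add: lam_mult_proj)
qed

lemma rho_mono:
  assumes "a \<unlhd> b" "b \<in> carrier S"
  shows "rho S a \<unlhd> rho S b"
proof -
  obtain f where f: "f \<in> proj S" "a = f \<otimes> b" using assms(1) by (rule nat_leE)
  then show ?thesis using proj_mult_le[OF rho_closed[OF assms(2)] f(1)] assms(2) by (simp add: rho_proj_mult)
qed

lemma proj_le_mult: "\<lbrakk>f \<unlhd> g; f \<in> proj S; g \<in> proj S\<rbrakk> \<Longrightarrow> g \<otimes> f = f"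
  using nat_le_lam[of f g] lam_id proj_closed by simp

lemma nat_le_antisym:
  assumes "a \<unlhd> b" "b \<unlhd> a" "a \<in> carrier S" "b \<in> carrier S"
  shows "a = b"
proof -
  have "lam S b \<otimes> lam S a = lam S a" "lam S a \<otimes> lam S b = lam S b"
    using assms by (auto intro!: proj_le_mult lam_mono lam_proj)
  then have "lam S a = lam S b" using proj_comm[of "lam S a" "lam S b"] lam_proj assms(3,4) by simp
  then have "b \<otimes> lam S a = b \<otimes> lam S b" by (rule arg_cong)
  then show ?thesis unfolding nat_le_lam[OF assms(1,4)] mult_lam[OF assms(4)] .
qed

lemma mult_mono_left:
  assumes "a \<unlhd> b" "b \<in> carrier S" "c \<in> carrier S"
  shows "c \<otimes> a \<unlhd> c \<otimes> b"
proof -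
  obtain f where f: "f \<in> proj S" "a = b \<otimes> f" using assms(1) by (rule nat_leE)
  then show ?thesis
    using mult_proj_le[OF mult_closed[OF assms(3,2)] f(1)] assms by (simp add: mult_assoc proj_closed)
qed

lemma mult_mono_right:
  assumes "a \<unlhd> b" "b \<in> carrier S" "c \<in> carrier S"
  shows "a \<otimes> c \<unlhd> b \<otimes> c"
proof -
  obtain f where f: "f \<in> proj S" "a = f \<otimes> b" using assms(1) by (rule nat_leE)
  then show ?thesis
    using proj_mult_le[OF mult_closed[OF assms(2,3)] f(1)] assms by (simp add: mult_assoc proj_closed)
qed

lemma proj_down: "\<lbrakk>a \<unlhd> f; f \<in> proj S\<rbrakk> \<Longrightarrow> a \<in> proj S"
  using proj_mult_closed by (auto elim: nat_leE)

text \<open>If \<open>a = c \<otimes> lam a\<close> and \<open>b = c \<otimes> lam b\<close>, then \<open>a \<otimes> lam b\<close> and \<open>b \<otimes> lam a\<close> are both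
  \<open>c \<otimes> lam a \<otimes> lam b\<close>.\<close>

lemma compatible_if_bounded:
  assumes "a \<unlhd> c" "b \<unlhd> c" "c \<in> carrier S"
  shows "compatible S a b"
proof -
  have ab: "a \<in> carrier S" "b \<in> carrier S" using assms nat_le_closed by auto
  have "a \<otimes> lam S b = c \<otimes> (lam S a \<otimes> lam S b)"
    using nat_le_lam[OF assms(1,3)] ab assms(3) by (simp add: lam_closed flip: mult_assoc)
  also have "\<dots> = c \<otimes> (lam S b \<otimes> lam S a)" using ab by (simp add: proj_comm lam_proj)
  also have "\<dots> = b \<otimes> lam S a"
    using nat_le_lam[OF assms(2,3)] ab assms(3) by (simp add: lam_closed flip: mult_assoc)
  finally have 1: "a \<otimes> lam S b = b \<otimes> lam S a" .
  have "rho S b \<otimes> a = (rho S b \<otimes> rho S a) \<otimes> c"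
    using nat_le_rho[OF assms(1,3)] ab assms(3) by (simp add: rho_closed mult_assoc)
  also have "\<dots> = (rho S a \<otimes> rho S b) \<otimes> c" using ab by (simp add: proj_comm rho_proj)
  also have "\<dots> = rho S a \<otimes> b"
    using nat_le_rho[OF assms(2,3)] ab assms(3) by (simp add: rho_closed mult_assoc)
  finally show ?thesis using 1 by (simp add: compatible_def)
qed

abbreviation lub where "lub s X \<equiv> is_lub (nat_order S) s X"

lemma lub_iff:
  "X \<subseteq> carrier S \<Longrightarrow> lub s X \<longleftrightarrow>
    s \<in> carrier S \<and> (\<forall>x \<in> X. x \<unlhd> s) \<and> (\<forall>u \<in> carrier S. (\<forall>x \<in> X. x \<unlhd> u) \<longrightarrow> s \<unlhd> u)"
  using is_lub_iff[of X "nat_order S" s] by simp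

lemma lub_closed: "lub s X \<Longrightarrow> s \<in> carrier S"
  using least_closed[of "nat_order S"] by fastforce

lemma is_lub_unique:
  assumes "lub s X" "lub t X"
  shows "s = t"
  using assms nat_le_antisym lub_closed unfolding least_def by (metis monoid_order_simps(2))

lemma lub_upper: "\<lbrakk>lub s X; X \<subseteq> carrier S; x \<in> X\<rbrakk> \<Longrightarrow> x \<unlhd> s"
  by (simp add: lub_iff)

lemma lub_least: "\<lbrakk>lub s X; X \<subseteq> carrier S; u \<in> carrier S; \<And>x. x \<in> X \<Longrightarrow> x \<unlhd> u\<rbrakk> \<Longrightarrow> s \<unlhd> u"
  by (simp add: lub_iff)

lemma lub_proj_order:
  assumes F: "F \<subseteq> proj S" and s: "lub e F" "e \<in> proj S"
  shows "is_lub (proj_order S) e F"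
  using s F proj_closed lub_iff[of F e] is_lub_iff[of F "proj_order S" e] by auto

end

context restriction_monoid
begin

lemma one_proj: "\<one> \<in> proj S"
  using mult_lam[OF one_closed] lam_proj[OF one_closed] lam_closed[OF one_closed] by simp

lemma proj_le_one: "f \<in> proj S \<Longrightarrow> f \<unlhd> \<one>"
  using proj_mult_le[OF one_closed, of f] proj_closed by simp

lemma proj_iff_le_one: "f \<in> proj S \<longleftrightarrow> f \<unlhd> \<one>"
  using proj_le_one proj_down[OF _ one_proj] by blast

lemma lub_proj:
  assumes "lub e F" "F \<subseteq> proj S"
  shows "e \<in> proj S"
proof -
  have "F \<subseteq> carrier S" using assms(2) proj_closed by blast
  then have "e \<unlhd> \<one>" using lub_least[OF assms(1) _ one_closed] proj_le_one assms(2) by blast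
  then show ?thesis by (simp add: proj_iff_le_one)
qed

end

context complete_restriction_monoid
begin

lemma bounded_lub:
  assumes "\<And>x. x \<in> X \<Longrightarrow> x \<unlhd> c" "c \<in> carrier S"
  obtains s where "lub s X"
proof -
  have "X \<subseteq> carrier S" using assms nat_le_closed by blast
  then show thesis
    using that compatible_join[of X] compatible_if_bounded assms by metis
qed

text \<open>The frame law of the projections, restated for least upper bounds in the whole monoid; a set
  of projections has the same least upper bound in both orders, as it is bounded by the unit.\<close>

lemma proj_mult_lub:
  assumes F: "F \<subseteq> proj S" and f: "f \<in> proj S" and e: "lub e F"
  shows "lub (f \<otimes> e) ((\<lambda>g. f \<otimes> g) ` F)"
proof -
  interpret L: frame "proj_order S" by (rule proj_frame)
  have meet: "x \<sqinter>\<^bsub>proj_order S\<^esub> y = x \<otimes> y" if "x \<in> proj S" "y \<in> proj S" for x y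
  proof (rule L.meet_eq)
    have "z \<unlhd> x \<otimes> y" if "z \<in> proj S" "z \<unlhd> x" "z \<unlhd> y" for z
    proof -
      have "(x \<otimes> y) \<otimes> z = z"
        using that \<open>x \<in> proj S\<close> \<open>y \<in> proj S\<close> by (simp add: mult_assoc proj_closed proj_le_mult)
      then show ?thesis
        using that mult_proj_le[of "x \<otimes> y" z] \<open>x \<in> proj S\<close> \<open>y \<in> proj S\<close> by (simp add: mult_closed proj_closed)
    qed
    then show "is_glb (proj_order S) (x \<otimes> y) {x, y}"
      using that by (subst is_glb_iff) (auto simp: proj_mult_closed proj_mult_le mult_proj_le proj_closed)
  qed
  have eP: "e \<in> proj S" using e F by (rule lub_proj)
  have fF: "(\<lambda>g. f \<otimes> g) ` F \<subseteq> proj S" using F f proj_mult_closed by auto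
  have "\<And>x. x \<in> (\<lambda>g. f \<otimes> g) ` F \<Longrightarrow> x \<unlhd> \<one>" using fF proj_le_one by blast
  then obtain u where u: "lub u ((\<lambda>g. f \<otimes> g) ` F)" using bounded_lub one_closed by blast
  have "u = \<Squnion>\<^bsub>proj_order S\<^esub>((\<lambda>g. f \<otimes> g) ` F)"
    using L.sup_eq[OF lub_proj_order[OF fF u lub_proj[OF u fF]]] by simp
  also have "(\<lambda>g. f \<otimes> g) ` F = (\<lambda>y. f \<sqinter>\<^bsub>proj_order S\<^esub> y) ` F"
    using f F meet by (intro image_cong refl) auto
  also have "\<Squnion>\<^bsub>proj_order S\<^esub>\<dots> = f \<sqinter>\<^bsub>proj_order S\<^esub> \<Squnion>\<^bsub>proj_order S\<^esub>F"
    using L.meet_join_distrib[of f F] f F by simp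
  also have "\<Squnion>\<^bsub>proj_order S\<^esub>F = e" using L.sup_eq[OF lub_proj_order[OF F e eP]] .
  finally show ?thesis using u f eP meet by simp
qed

text \<open>Together with \<open>lub_if_lam\<close> below: for a set \<open>X\<close> bounded by \<open>s\<close>, being the join of \<open>X\<close> can be tested on
  the projections \<open>lam\<close> (or \<open>rho\<close>). For this direction let \<open>e\<close> be the join of \<open>lam ` X\<close>. Then \<open>s \<otimes> e\<close> is still
  an upper bound of \<open>X\<close>, so \<open>s = s \<otimes> e\<close> and \<open>lam s \<le> e\<close>.\<close>

lemma lub_lam:
  assumes X: "X \<subseteq> carrier S" and s: "lub s X"
  shows "lub (lam S s) (lam S ` X)"
proof -
  have sS: "s \<in> carrier S" using s by (rule lub_closed)
  have lX: "lam S ` X \<subseteq> proj S" and lXS: "lam S ` X \<subseteq> carrier S"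
    using X lam_proj lam_closed by auto
  have le: "x \<unlhd> lam S s" if "x \<in> lam S ` X" for x
    using that lub_upper[OF s X] sS lam_mono by blast
  obtain e where e: "lub e (lam S ` X)" using bounded_lub[OF le] sS lam_closed by blast
  have eP: "e \<in> proj S" using e lX by (rule lub_proj)
  have "x \<unlhd> s \<otimes> e" if x: "x \<in> X" for x
  proof -
    have xS: "x \<in> carrier S" using x X by blast
    have "e \<otimes> lam S x = lam S x"
      using lub_upper[OF e lXS, of "lam S x"] x eP xS by (intro proj_le_mult lam_proj) auto
    then have "(s \<otimes> e) \<otimes> lam S x = x"
      using nat_le_lam[OF lub_upper[OF s X x] sS] sS eP xS by (simp add: mult_assoc proj_closed lam_closed)
    then show ?thesis
      using mult_proj_le[of "s \<otimes> e" "lam S x"] sS eP xS by (simp add: mult_closed proj_closed lam_proj)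
  qed
  then have "s \<unlhd> s \<otimes> e" using lub_least[OF s X] sS eP by (simp add: mult_closed proj_closed)
  then have "s = s \<otimes> e"
    using sS eP by (intro nat_le_antisym mult_proj_le) (simp_all add: mult_closed proj_closed)
  then have "lam S s = lam S s \<otimes> e" using sS eP lam_mult_proj by metis
  then have "lam S s \<unlhd> e" using proj_mult_le[of e "lam S s"] sS eP by (simp add: proj_closed lam_proj)
  moreover have "e \<unlhd> lam S s" using lub_least[OF e lXS] le sS lam_closed by blast
  ultimately have "e = lam S s" using sS eP by (intro nat_le_antisym) (simp_all add: proj_closed lam_closed)
  then show ?thesis using e by simp
qed

lemma lub_rho:
  assumes X: "X \<subseteq> carrier S" and s: "lub s X"
  shows "lub (rho S s) (rho S ` X)"
proof -
  have sS: "s \<in> carrier S" using s by (rule lub_closed)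
  have lX: "rho S ` X \<subseteq> proj S" and lXS: "rho S ` X \<subseteq> carrier S"
    using X rho_proj rho_closed by auto
  have le: "x \<unlhd> rho S s" if "x \<in> rho S ` X" for x
    using that lub_upper[OF s X] sS rho_mono by blast
  obtain e where e: "lub e (rho S ` X)" using bounded_lub[OF le] sS rho_closed by blast
  have eP: "e \<in> proj S" using e lX by (rule lub_proj)
  have "x \<unlhd> e \<otimes> s" if x: "x \<in> X" for x
  proof -
    have xS: "x \<in> carrier S" using x X by blast
    have "e \<otimes> rho S x = rho S x"
      using lub_upper[OF e lXS, of "rho S x"] x eP xS by (intro proj_le_mult rho_proj) auto
    then have "rho S x \<otimes> e = rho S x" using proj_comm[OF eP rho_proj[OF xS]] by simp
    then have "rho S x \<otimes> (e \<otimes> s) = x"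
      using nat_le_rho[OF lub_upper[OF s X x] sS] sS eP xS by (simp add: proj_closed rho_closed flip: mult_assoc)
    then show ?thesis
      using proj_mult_le[of "e \<otimes> s" "rho S x"] sS eP xS by (simp add: mult_closed proj_closed rho_proj)
  qed
  then have "s \<unlhd> e \<otimes> s" using lub_least[OF s X] sS eP by (simp add: mult_closed proj_closed)
  then have "s = e \<otimes> s"
    using sS eP by (intro nat_le_antisym proj_mult_le) (simp_all add: mult_closed proj_closed)
  then have "rho S s = e \<otimes> rho S s" using sS eP rho_proj_mult by metis
  then have "rho S s \<unlhd> e" using mult_proj_le[of e "rho S s"] sS eP by (simp add: proj_closed rho_proj)
  moreover have "e \<unlhd> rho S s" using lub_least[OF e lXS] le sS rho_closed by blast
  ultimately have "e = rho S s" using sS eP by (intro nat_le_antisym) (simp_all add: proj_closed rho_closed)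
  then show ?thesis using e by simp
qed

text \<open>The bounded set \<open>X\<close> is compatible, so it has a join \<open>c \<le> s\<close>; from \<open>lam c = lam s\<close> follows
  \<open>c = s \<otimes> lam c = s\<close>.\<close>

lemma lub_if_lam:
  assumes s: "s \<in> carrier S" and le: "\<And>x. x \<in> X \<Longrightarrow> x \<unlhd> s" and lam: "lub (lam S s) (lam S ` X)"
  shows "lub s X"
proof -
  have X: "X \<subseteq> carrier S" using le s nat_le_closed by blast
  obtain c where c: "lub c X" using bounded_lub[OF le s] .
  have cS: "c \<in> carrier S" using c by (rule lub_closed)
  have "c \<unlhd> s" using lub_least[OF c X s le] .
  moreover have "lam S c = lam S s"
    using is_lub_unique[OF lub_lam[OF X c] lam] .
  ultimately have "c = s" using nat_le_lam[of c s] s mult_lam by simp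
  then show ?thesis using c by simp
qed

lemma lub_if_rho:
  assumes s: "s \<in> carrier S" and le: "\<And>x. x \<in> X \<Longrightarrow> x \<unlhd> s" and rho: "lub (rho S s) (rho S ` X)"
  shows "lub s X"
proof -
  have X: "X \<subseteq> carrier S" using le s nat_le_closed by blast
  obtain c where c: "lub c X" using bounded_lub[OF le s] .
  have cS: "c \<in> carrier S" using c by (rule lub_closed)
  have "c \<unlhd> s" using lub_least[OF c X s le] .
  moreover have "rho S c = rho S s"
    using is_lub_unique[OF lub_rho[OF X c] rho] .
  ultimately have "c = s" using nat_le_rho[of c s] s rho_mult by simp
  then show ?thesis using c by simp
qed

text \<open>For \<open>x \<in> X\<close> we have \<open>t \<otimes> x = (t \<otimes> s) \<otimes> lam x\<close>, hence \<open>lam (t \<otimes> x) = lam (t \<otimes> s) \<otimes> lam x\<close>. Testing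
  on projections reduces the claim to the frame law.\<close>

lemma lub_mult_left:
  assumes X: "X \<subseteq> carrier S" and s: "lub s X" and t: "t \<in> carrier S"
  shows "lub (t \<otimes> s) ((\<lambda>x. t \<otimes> x) ` X)"
proof (rule lub_if_lam)
  have sS: "s \<in> carrier S" using s by (rule lub_closed)
  then show "t \<otimes> s \<in> carrier S" using t by (intro mult_closed)
  show "y \<unlhd> t \<otimes> s" if "y \<in> (\<lambda>x. t \<otimes> x) ` X" for y
    using that lub_upper[OF s X] sS t mult_mono_left by blast
  have lX: "lam S ` X \<subseteq> proj S" using X lam_proj by auto
  have "lam S (t \<otimes> x) = lam S (t \<otimes> s) \<otimes> lam S x" if x: "x \<in> X" for x
  proof -
    have xS: "x \<in> carrier S" using x X by blast
    have "t \<otimes> x = (t \<otimes> s) \<otimes> lam S x"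
      using nat_le_lam[OF lub_upper[OF s X x] sS] t sS xS by (simp add: mult_assoc lam_closed)
    then show ?thesis using lam_mult_proj[of "t \<otimes> s" "lam S x"] t sS xS by (simp add: mult_closed lam_proj)
  qed
  then have "lam S ` (\<lambda>x. t \<otimes> x) ` X = (\<lambda>f. lam S (t \<otimes> s) \<otimes> f) ` lam S ` X"
    by (simp add: image_image)
  moreover have "lam S (t \<otimes> s) \<otimes> lam S s = lam S (t \<otimes> s)"
    using lam_mult_proj[of "t \<otimes> s" "lam S s"] t sS by (simp add: mult_closed lam_proj mult_assoc lam_closed mult_lam)
  ultimately show "lub (lam S (t \<otimes> s)) (lam S ` (\<lambda>x. t \<otimes> x) ` X)"
    using proj_mult_lub[OF lX lam_proj[OF mult_closed[OF t sS]] lub_lam[OF X s]] by simp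
qed

lemma lub_mult_right:
  assumes X: "X \<subseteq> carrier S" and s: "lub s X" and t: "t \<in> carrier S"
  shows "lub (s \<otimes> t) ((\<lambda>x. x \<otimes> t) ` X)"
proof (rule lub_if_rho)
  have sS: "s \<in> carrier S" using s by (rule lub_closed)
  then show "s \<otimes> t \<in> carrier S" using t by (intro mult_closed)
  show "y \<unlhd> s \<otimes> t" if "y \<in> (\<lambda>x. x \<otimes> t) ` X" for y
    using that lub_upper[OF s X] sS t mult_mono_right by blast
  have lX: "rho S ` X \<subseteq> proj S" using X rho_proj by auto
  have "rho S (x \<otimes> t) = rho S (s \<otimes> t) \<otimes> rho S x" if x: "x \<in> X" for x
  proof -
    have xS: "x \<in> carrier S" using x X by blast
    have "x \<otimes> t = rho S x \<otimes> (s \<otimes> t)"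
      using nat_le_rho[OF lub_upper[OF s X x] sS] t sS xS by (simp add: rho_closed flip: mult_assoc)
    then show ?thesis
      using rho_proj_mult[of "s \<otimes> t" "rho S x"] proj_comm[of "rho S x" "rho S (s \<otimes> t)"] t sS xS
      by (simp add: mult_closed rho_proj)
  qed
  then have "rho S ` (\<lambda>x. x \<otimes> t) ` X = (\<lambda>f. rho S (s \<otimes> t) \<otimes> f) ` rho S ` X"
    by (simp add: image_image)
  moreover have "rho S (s \<otimes> t) \<otimes> rho S s = rho S (s \<otimes> t)"
    using rho_proj_mult[of "s \<otimes> t" "rho S s"] proj_comm[of "rho S s" "rho S (s \<otimes> t)"] t sS
    by (simp add: mult_closed rho_proj rho_closed rho_mult flip: mult_assoc)
  ultimately show "lub (rho S (s \<otimes> t)) (rho S ` (\<lambda>x. x \<otimes> t) ` X)"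
    using proj_mult_lub[OF lX rho_proj[OF mult_closed[OF sS t]] lub_rho[OF X s]] by simp
qed

end


section \<open>The quantal frame of closed order ideals\<close>

text \<open>Order ideals closed under all joins that exist. The empty join is included, so a closed ideal
  contains the zero element.\<close>

definition closed_ideal :: "('a, 'm) restr_monoid_scheme \<Rightarrow> 'a set \<Rightarrow> bool" where
  "closed_ideal S A \<longleftrightarrow> A \<subseteq> carrier S \<and>
     (\<forall>a \<in> A. \<forall>b \<in> carrier S. nat_le S (proj S) b a \<longrightarrow> b \<in> A) \<and>
     (\<forall>X s. X \<subseteq> A \<longrightarrow> is_lub (nat_order S) s X \<longrightarrow> s \<in> A)"

definition ideal_closure :: "('a, 'm) restr_monoid_scheme \<Rightarrow> 'a set \<Rightarrow> 'a set" where
  "ideal_closure S X = \<Inter>{A. closed_ideal S A \<and> X \<subseteq> A}"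

definition principal_ideal :: "('a, 'm) restr_monoid_scheme \<Rightarrow> 'a \<Rightarrow> 'a set" where
  "principal_ideal S s = {x \<in> carrier S. nat_le S (proj S) x s}"

text \<open>Every operation is the closure of the elementwise operation. For \<open>lam\<close> and \<open>rho\<close> the closure joins
  projections that come from incompatible elements.\<close>

definition ideal_completion :: "('a, 'm) restr_monoid_scheme \<Rightarrow> 'a set lr_quantale" where
  "ideal_completion S =
     \<lparr>carrier = {A. closed_ideal S A},
      monoid.mult = (\<lambda>A B. ideal_closure S (A <#>\<^bsub>S\<^esub> B)),
      one = proj S,
      lam = (\<lambda>A. ideal_closure S (lam S ` A)),
      rho = (\<lambda>A. ideal_closure S (rho S ` A)),
      qle = (\<subseteq>)\<rparr>"

context complete_restriction_monoid
begin

abbreviation ideal where "ideal A \<equiv> closed_ideal S A"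
abbreviation cl where "cl X \<equiv> ideal_closure S X"
abbreviation pr where "pr s \<equiv> principal_ideal S s"

lemma ideal_subset: "ideal A \<Longrightarrow> A \<subseteq> carrier S"
  and ideal_down: "\<lbrakk>ideal A; a \<in> A; b \<unlhd> a; b \<in> carrier S\<rbrakk> \<Longrightarrow> b \<in> A"
  and ideal_lub: "\<lbrakk>ideal A; X \<subseteq> A; lub s X\<rbrakk> \<Longrightarrow> s \<in> A"
  by (auto simp: closed_ideal_def)

lemma idealI:
  assumes "A \<subseteq> carrier S" "\<And>a b. \<lbrakk>a \<in> A; b \<unlhd> a; b \<in> carrier S; a \<in> carrier S\<rbrakk> \<Longrightarrow> b \<in> A"
    "\<And>X s. \<lbrakk>X \<subseteq> A; X \<subseteq> carrier S; lub s X; s \<in> carrier S\<rbrakk> \<Longrightarrow> s \<in> A"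
  shows "ideal A"
  unfolding closed_ideal_def
proof (intro conjI ballI allI impI)
  show "s \<in> A" if "X \<subseteq> A" "lub s X" for X s
    using that assms(1) lub_closed by (intro assms(3)[of X]) auto
qed (use assms in auto)

lemma ideal_carrier: "ideal (carrier S)"
  by (rule idealI) simp_all

lemma ideal_proj: "ideal (proj S)"
proof (rule idealI)
  show "b \<in> proj S" if "a \<in> proj S" "b \<unlhd> a" for a b
    using that(2,1) by (rule proj_down)
  show "s \<in> proj S" if "X \<subseteq> proj S" "lub s X" for X s
    using that(2,1) by (rule lub_proj)
qed (rule proj_subset)

lemma ideal_principal:
  assumes s: "s \<in> carrier S"
  shows "ideal (pr s)"
proof (rule idealI)
  show "b \<in> pr s" if "a \<in> pr s" "b \<unlhd> a" "b \<in> carrier S" for a b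
    using that nat_le_trans[of b a s] s by (simp add: principal_ideal_def)
  show "t \<in> pr s" if "X \<subseteq> pr s" "X \<subseteq> carrier S" "lub t X" "t \<in> carrier S" for X t
    using that lub_least[of t X s] s by (auto simp: principal_ideal_def)
qed (auto simp: principal_ideal_def)

lemma ideal_INT:
  assumes "\<And>i. i \<in> I \<Longrightarrow> ideal (f i)" "I \<noteq> {}"
  shows "ideal (\<Inter>i\<in>I. f i)"
proof (rule idealI)
  show "(\<Inter>i\<in>I. f i) \<subseteq> carrier S" using assms ideal_subset by fast
  show "b \<in> (\<Inter>i\<in>I. f i)" if "a \<in> (\<Inter>i\<in>I. f i)" "b \<unlhd> a" "b \<in> carrier S" for a b
    using that assms(1) ideal_down[of "f _" a b] by simp
  show "s \<in> (\<Inter>i\<in>I. f i)" if "X \<subseteq> (\<Inter>i\<in>I. f i)" "lub s X" for X s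
  proof
    fix i assume i: "i \<in> I"
    then have "X \<subseteq> f i" using that(1) by fast
    then show "s \<in> f i" using ideal_lub[OF assms(1)[OF i]] that(2) by simp
  qed
qed

lemma ideal_Int: "\<lbrakk>ideal A; ideal B\<rbrakk> \<Longrightarrow> ideal (A \<inter> B)"
  using ideal_INT[of "{A, B}" "\<lambda>A. A"] by auto

lemma ideal_cl: "X \<subseteq> carrier S \<Longrightarrow> ideal (cl X)"
  using ideal_INT[of "{A. ideal A \<and> X \<subseteq> A}" "\<lambda>A. A"] ideal_carrier
  by (auto simp: ideal_closure_def)

lemma cl_superset: "X \<subseteq> cl X"
  by (auto simp: ideal_closure_def)

lemma cl_least: "\<lbrakk>ideal A; X \<subseteq> A\<rbrakk> \<Longrightarrow> cl X \<subseteq> A"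
  by (auto simp: ideal_closure_def)

lemma cl_mono: "X \<subseteq> Y \<Longrightarrow> cl X \<subseteq> cl Y"
  by (auto simp: ideal_closure_def)

lemma cl_ideal: "ideal A \<Longrightarrow> cl A = A"
  using cl_least cl_superset by blast

lemma cl_subset: "X \<subseteq> carrier S \<Longrightarrow> cl X \<subseteq> carrier S"
  using ideal_cl ideal_subset by blast

lemma cl_eqI: "\<lbrakk>X \<subseteq> cl Y; Y \<subseteq> cl X; X \<subseteq> carrier S; Y \<subseteq> carrier S\<rbrakk> \<Longrightarrow> cl X = cl Y"
  by (intro equalityI cl_least ideal_cl)

lemma cl_UN_cl:
  assumes "\<And>i. i \<in> I \<Longrightarrow> f i \<subseteq> carrier S"
  shows "cl (\<Union>i\<in>I. cl (f i)) = cl (\<Union>i\<in>I. f i)"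
proof (rule cl_eqI)
  show "(\<Union>i\<in>I. cl (f i)) \<subseteq> cl (\<Union>i\<in>I. f i)" by (intro UN_least cl_mono) auto
  show "(\<Union>i\<in>I. f i) \<subseteq> cl (\<Union>i\<in>I. cl (f i))"
    using cl_superset[of "f _"] cl_superset[of "\<Union>i\<in>I. cl (f i)"] by blast
  show "(\<Union>i\<in>I. cl (f i)) \<subseteq> carrier S" using assms by (intro UN_least cl_subset)
qed (use assms in auto)

text \<open>The reason why closures commute with the operations: a monotone map that preserves joins pulls
  closed ideals back to closed ideals, so it maps the closure of \<open>X\<close> into the closure of its image.\<close>

lemma ideal_vimage:
  assumes A: "ideal A"
    and closed: "\<And>x. x \<in> carrier S \<Longrightarrow> g x \<in> carrier S"
    and mono: "\<And>x y. \<lbrakk>x \<unlhd> y; y \<in> carrier S\<rbrakk> \<Longrightarrow> g x \<unlhd> g y"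
    and lubs: "\<And>X s. \<lbrakk>X \<subseteq> carrier S; lub s X\<rbrakk> \<Longrightarrow> lub (g s) (g ` X)"
  shows "ideal {x \<in> carrier S. g x \<in> A}"
proof (rule idealI)
  fix a b assume "a \<in> {x \<in> carrier S. g x \<in> A}" "b \<unlhd> a" "b \<in> carrier S"
  then show "b \<in> {x \<in> carrier S. g x \<in> A}"
    using mono[of b a] closed ideal_down[OF A, of "g a" "g b"] by simp
next
  fix X s assume X: "X \<subseteq> {x \<in> carrier S. g x \<in> A}" "X \<subseteq> carrier S" "lub s X" "s \<in> carrier S"
  then have "g ` X \<subseteq> A" by auto
  then show "s \<in> {x \<in> carrier S. g x \<in> A}"
    using ideal_lub[OF A _ lubs[OF X(2,3)]] X(4) by simp
qed auto

lemma image_cl: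
  assumes X: "X \<subseteq> carrier S"
    and closed: "\<And>x. x \<in> carrier S \<Longrightarrow> g x \<in> carrier S"
    and mono: "\<And>x y. \<lbrakk>x \<unlhd> y; y \<in> carrier S\<rbrakk> \<Longrightarrow> g x \<unlhd> g y"
    and lubs: "\<And>X s. \<lbrakk>X \<subseteq> carrier S; lub s X\<rbrakk> \<Longrightarrow> lub (g s) (g ` X)"
  shows "g ` cl X \<subseteq> cl (g ` X)"
proof -
  have "g ` X \<subseteq> carrier S" using X closed by auto
  then have "ideal {x \<in> carrier S. g x \<in> cl (g ` X)}"
    using closed mono lubs by (intro ideal_vimage ideal_cl)
  moreover have "X \<subseteq> {x \<in> carrier S. g x \<in> cl (g ` X)}" using X cl_superset[of "g ` X"] by auto
  ultimately have "cl X \<subseteq> {x \<in> carrier S. g x \<in> cl (g ` X)}" by (rule cl_least)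
  then show ?thesis by auto
qed

lemma cl_image_cl:
  assumes X: "X \<subseteq> carrier S"
    and closed: "\<And>x. x \<in> carrier S \<Longrightarrow> g x \<in> carrier S"
    and mono: "\<And>x y. \<lbrakk>x \<unlhd> y; y \<in> carrier S\<rbrakk> \<Longrightarrow> g x \<unlhd> g y"
    and lubs: "\<And>X s. \<lbrakk>X \<subseteq> carrier S; lub s X\<rbrakk> \<Longrightarrow> lub (g s) (g ` X)"
  shows "cl (g ` cl X) = cl (g ` X)"
proof (rule cl_eqI)
  show "g ` cl X \<subseteq> cl (g ` X)" using assms by (rule image_cl)
  show "g ` X \<subseteq> cl (g ` cl X)" using cl_superset[of X] cl_superset[of "g ` cl X"] by blast
  show "g ` cl X \<subseteq> carrier S" "g ` X \<subseteq> carrier S" using X cl_subset[OF X] closed by auto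
qed

lemma cl_lam_cl: "X \<subseteq> carrier S \<Longrightarrow> cl (lam S ` cl X) = cl (lam S ` X)"
  by (intro cl_image_cl lam_closed lam_mono lub_lam)

lemma cl_rho_cl: "X \<subseteq> carrier S \<Longrightarrow> cl (rho S ` cl X) = cl (rho S ` X)"
  by (intro cl_image_cl rho_closed rho_mono lub_rho)

lemma set_mult_image: "X <#> Y = (\<Union>x\<in>X. (\<lambda>y. x \<otimes> y) ` Y)" "X <#> Y = (\<Union>y\<in>Y. (\<lambda>x. x \<otimes> y) ` X)"
  by (auto simp: set_mult_def)

lemma set_mult_subset: "\<lbrakk>X \<subseteq> carrier S; Y \<subseteq> carrier S\<rbrakk> \<Longrightarrow> X <#> Y \<subseteq> carrier S"
  by (auto simp: set_mult_def intro: mult_closed)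

lemma set_mult_memI: "\<lbrakk>x \<in> X; y \<in> Y\<rbrakk> \<Longrightarrow> x \<otimes> y \<in> X <#> Y"
  by (auto simp: set_mult_def)

lemma cl_set_mult_cl_right:
  assumes X: "X \<subseteq> carrier S" and Y: "Y \<subseteq> carrier S"
  shows "cl (X <#> cl Y) = cl (X <#> Y)"
proof (rule cl_eqI)
  show "X <#> cl Y \<subseteq> cl (X <#> Y)"
    unfolding set_mult_image(1)
  proof (rule UN_least)
    fix x assume x: "x \<in> X"
    then have "(\<lambda>y. x \<otimes> y) ` cl Y \<subseteq> cl ((\<lambda>y. x \<otimes> y) ` Y)"
      using X by (intro image_cl Y mult_closed mult_mono_left lub_mult_left) auto
    also have "\<dots> \<subseteq> cl (\<Union>x\<in>X. (\<lambda>y. x \<otimes> y) ` Y)" using x by (intro cl_mono) auto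
    finally show "(\<lambda>y. x \<otimes> y) ` cl Y \<subseteq> cl (\<Union>x\<in>X. (\<lambda>y. x \<otimes> y) ` Y)" .
  qed
  have "X <#> Y \<subseteq> X <#> cl Y" using cl_superset[of Y] by (auto simp: set_mult_def)
  then show "X <#> Y \<subseteq> cl (X <#> cl Y)" using cl_superset by blast
qed (intro set_mult_subset cl_subset X Y)+

lemma cl_set_mult_cl_left:
  assumes X: "X \<subseteq> carrier S" and Y: "Y \<subseteq> carrier S"
  shows "cl (cl X <#> Y) = cl (X <#> Y)"
proof (rule cl_eqI)
  show "cl X <#> Y \<subseteq> cl (X <#> Y)"
    unfolding set_mult_image(2)
  proof (rule UN_least)
    fix y assume y: "y \<in> Y"
    then have "(\<lambda>x. x \<otimes> y) ` cl X \<subseteq> cl ((\<lambda>x. x \<otimes> y) ` X)"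
      using Y by (intro image_cl X mult_closed mult_mono_right lub_mult_right) auto
    also have "\<dots> \<subseteq> cl (\<Union>y\<in>Y. (\<lambda>x. x \<otimes> y) ` X)" using y by (intro cl_mono) auto
    finally show "(\<lambda>x. x \<otimes> y) ` cl X \<subseteq> cl (\<Union>y\<in>Y. (\<lambda>x. x \<otimes> y) ` X)" .
  qed
  have "X <#> Y \<subseteq> cl X <#> Y" using cl_superset[of X] by (auto simp: set_mult_def)
  then show "X <#> Y \<subseteq> cl (cl X <#> Y)" using cl_superset by blast
qed (intro set_mult_subset cl_subset X Y)+

text \<open>The elements \<open>x\<close> all of whose restrictions in \<open>A\<close> lie in the closure of \<open>A \<inter> X\<close> form a closed
  ideal: if \<open>a \<in> A\<close> lies below a join \<open>s\<close> of elements \<open>y\<close>, then \<open>a = s \<otimes> lam a\<close> is the join of the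
  elements \<open>y \<otimes> lam a\<close>. This closed ideal contains \<open>X\<close> because \<open>X\<close> is an order ideal.\<close>

lemma Int_cl_subset:
  assumes A: "ideal A" and X: "X \<subseteq> carrier S" and down: "\<And>x y. \<lbrakk>x \<in> X; y \<unlhd> x; y \<in> carrier S\<rbrakk> \<Longrightarrow> y \<in> X"
  shows "A \<inter> cl X \<subseteq> cl (A \<inter> X)"
proof -
  have AS: "A \<subseteq> carrier S" using A by (rule ideal_subset)
  let ?H = "{x \<in> carrier S. \<forall>a \<in> A. a \<unlhd> x \<longrightarrow> a \<in> cl (A \<inter> X)}"
  have C: "ideal (cl (A \<inter> X))" using AS by (intro ideal_cl) auto
  have "ideal ?H"
  proof (rule idealI)
    fix a b assume "a \<in> ?H" "b \<unlhd> a" "b \<in> carrier S"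
    then show "b \<in> ?H" using nat_le_trans[of _ b a] by auto
  next
    fix Y s assume Y: "Y \<subseteq> ?H" "Y \<subseteq> carrier S" and s: "lub s Y" "s \<in> carrier S"
    have "a \<in> cl (A \<inter> X)" if a: "a \<in> A" "a \<unlhd> s" for a
    proof -
      have aS: "a \<in> carrier S" using a AS by blast
      have "lub (s \<otimes> lam S a) ((\<lambda>y. y \<otimes> lam S a) ` Y)"
        using Y(2) s(1) lam_closed[OF aS] by (rule lub_mult_right)
      then have lub_a: "lub a ((\<lambda>y. y \<otimes> lam S a) ` Y)" using nat_le_lam[OF a(2) s(2)] by simp
      have "y \<otimes> lam S a \<in> cl (A \<inter> X)" if y: "y \<in> Y" for y
      proof -
        have yS: "y \<in> carrier S" using y Y by blast
        then have "y \<otimes> lam S a \<in> carrier S" using aS by (intro mult_closed lam_closed)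
        moreover have "y \<otimes> lam S a \<unlhd> a"
          using lub_upper[OF lub_a] y Y(2) aS by (auto intro!: mult_closed lam_closed)
        ultimately have "y \<otimes> lam S a \<in> A" using ideal_down[OF A a(1)] by blast
        moreover have "y \<otimes> lam S a \<unlhd> y" using yS aS by (intro mult_proj_le lam_proj)
        ultimately show ?thesis using y Y(1) by blast
      qed
      then show ?thesis using ideal_lub[OF C _ lub_a] by blast
    qed
    then show "s \<in> ?H" using s by blast
  qed auto
  moreover have "X \<subseteq> ?H"
    using X AS down cl_superset[of "A \<inter> X"] by blast
  ultimately have "cl X \<subseteq> ?H" by (rule cl_least)
  then show ?thesis using AS nat_le_refl by blast
qed

abbreviation Q where "Q \<equiv> ideal_completion S"

lemma Q_simps [simp]:
  "carrier Q = {A. ideal A}" "A \<otimes>\<^bsub>Q\<^esub> B = cl (A <#> B)" "\<one>\<^bsub>Q\<^esub> = proj S"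
  "lam Q A = cl (lam S ` A)" "rho Q A = cl (rho S ` A)" "qle Q = (\<subseteq>)"
  by (simp_all add: ideal_completion_def)

lemma ideal_mult: "\<lbrakk>ideal A; ideal B\<rbrakk> \<Longrightarrow> ideal (cl (A <#> B))"
  by (intro ideal_cl set_mult_subset ideal_subset)

lemma ideal_lam: "ideal A \<Longrightarrow> ideal (cl (lam S ` A))"
  and ideal_rho: "ideal A \<Longrightarrow> ideal (cl (rho S ` A))"
  using ideal_subset lam_closed rho_closed by (auto intro!: ideal_cl)

lemma ideal_Union_subset: "\<A> \<subseteq> {A. ideal A} \<Longrightarrow> \<Union>\<A> \<subseteq> carrier S"
  using ideal_subset by blast

lemma partial_order_Q: "partial_order (lat Q)"
  by (rule partial_orderI) auto

lemma is_lub_Q: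
  assumes "\<A> \<subseteq> {A. ideal A}"
  shows "is_lub (lat Q) (cl (\<Union>\<A>)) \<A>"
proof -
  have "A \<subseteq> cl (\<Union>\<A>)" if "A \<in> \<A>" for A
    using that cl_superset[of "\<Union>\<A>"] by blast
  moreover have "cl (\<Union>\<A>) \<subseteq> B" if "ideal B" "\<And>A. A \<in> \<A> \<Longrightarrow> A \<subseteq> B" for B
    using that(2) by (intro cl_least that(1)) blast
  ultimately show ?thesis
    using assms ideal_cl[OF ideal_Union_subset[OF assms]] by (simp add: is_lub_iff)
qed

lemma sup_Q: "\<A> \<subseteq> {A. ideal A} \<Longrightarrow> \<Squnion>\<^bsub>lat Q\<^esub>\<A> = cl (\<Union>\<A>)"
  by (intro partial_order.sup_eq partial_order_Q is_lub_Q)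

lemma complete_lattice_Q: "complete_lattice (lat Q)"
  using is_lub_Q by (intro partial_order.complete_lattice_if_lubs partial_order_Q) auto

lemma proj_set_mult_ideal: "ideal A \<Longrightarrow> cl (proj S <#> A) = A"
proof -
  assume A: "ideal A"
  have "proj S <#> A \<subseteq> A"
    using ideal_subset[OF A] proj_closed by (auto simp: set_mult_def intro!: ideal_down[OF A _ proj_mult_le] mult_closed)
  moreover have "A \<subseteq> proj S <#> A"
    using set_mult_memI[OF one_proj] ideal_subset[OF A] by force
  ultimately show ?thesis using cl_ideal[OF A] by simp
qed

lemma ideal_set_mult_proj: "ideal A \<Longrightarrow> cl (A <#> proj S) = A"
proof -
  assume A: "ideal A"
  have "A <#> proj S \<subseteq> A"
    using ideal_subset[OF A] proj_closed by (auto simp: set_mult_def intro!: ideal_down[OF A _ mult_proj_le] mult_closed)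
  moreover have "A \<subseteq> A <#> proj S"
    using set_mult_memI[OF _ one_proj] ideal_subset[OF A] by force
  ultimately show ?thesis using cl_ideal[OF A] by simp
qed

lemma cl_set_mult_assoc:
  assumes "A \<subseteq> carrier S" "B \<subseteq> carrier S" "C \<subseteq> carrier S"
  shows "cl (cl (A <#> B) <#> C) = cl (A <#> cl (B <#> C))"
proof -
  have "(\<Union>a\<in>A. \<Union>b\<in>B. \<Union>c\<in>C. {a \<otimes> b \<otimes> c}) = (\<Union>a\<in>A. \<Union>b\<in>B. \<Union>c\<in>C. {a \<otimes> (b \<otimes> c)})"
    using assms by (intro SUP_cong refl arg_cong[of _ _ "\<lambda>x. {x}"] mult_assoc) auto
  then have "(A <#> B) <#> C = A <#> (B <#> C)" by (simp add: set_mult_def)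
  then show ?thesis
    using assms by (simp add: cl_set_mult_cl_left cl_set_mult_cl_right set_mult_subset)
qed

lemma unital_quantale_Q: "unital_quantale Q"
proof (intro unital_quantale.intro unital_quantale_axioms.intro complete_lattice_Q)
  show "Group.monoid Q"
    by (rule monoidI)
      (auto simp: ideal_mult ideal_proj proj_set_mult_ideal ideal_set_mult_proj cl_set_mult_assoc ideal_subset)
  fix A \<B> assume "A \<in> carrier Q" "\<B> \<subseteq> carrier Q"
  then have A: "A \<subseteq> carrier S" "ideal A" and \<B>: "\<B> \<subseteq> {A. ideal A}" and U: "\<Union>\<B> \<subseteq> carrier S"
    using ideal_subset ideal_Union_subset by auto
  have sub: "A <#> B \<subseteq> carrier S" "B <#> A \<subseteq> carrier S" if "B \<in> \<B>" for B
    using that A U by (intro set_mult_subset; blast)+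
  have "cl (A <#> cl (\<Union>\<B>)) = cl (A <#> \<Union>\<B>)" using A(1) U by (rule cl_set_mult_cl_right)
  also have "A <#> \<Union>\<B> = (\<Union>B\<in>\<B>. A <#> B)" by (auto simp: set_mult_def)
  also have "cl \<dots> = cl (\<Union>((\<lambda>B. A \<otimes>\<^bsub>Q\<^esub> B) ` \<B>))" using sub by (simp add: cl_UN_cl)
  finally show "A \<otimes>\<^bsub>Q\<^esub> \<Squnion>\<^bsub>lat Q\<^esub>\<B> = \<Squnion>\<^bsub>lat Q\<^esub>((\<lambda>B. A \<otimes>\<^bsub>Q\<^esub> B) ` \<B>)"
    using A \<B> by (subst (1 2) sup_Q) (auto intro: ideal_mult)
  have "cl (cl (\<Union>\<B>) <#> A) = cl (\<Union>\<B> <#> A)" using U A(1) by (rule cl_set_mult_cl_left)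
  also have "\<Union>\<B> <#> A = (\<Union>B\<in>\<B>. B <#> A)" by (auto simp: set_mult_def)
  also have "cl \<dots> = cl (\<Union>((\<lambda>B. B \<otimes>\<^bsub>Q\<^esub> A) ` \<B>))" using sub by (simp add: cl_UN_cl)
  finally show "\<Squnion>\<^bsub>lat Q\<^esub>\<B> \<otimes>\<^bsub>Q\<^esub> A = \<Squnion>\<^bsub>lat Q\<^esub>((\<lambda>B. B \<otimes>\<^bsub>Q\<^esub> A) ` \<B>)"
    using A \<B> by (subst (1 2) sup_Q) (auto intro: ideal_mult)
qed

lemma ehresmann_quantale_Q: "ehresmann_quantale Q"
proof (intro ehresmann_quantale.intro ehresmann_quantale_axioms.intro unital_quantale_Q)
  fix A assume "A \<in> carrier Q"
  then have A: "ideal A" "A \<subseteq> carrier S" using ideal_subset by auto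
  have lA: "lam S ` A \<subseteq> proj S" "rho S ` A \<subseteq> proj S" using A lam_proj rho_proj by auto
  then have lAS: "lam S ` A \<subseteq> carrier S" "rho S ` A \<subseteq> carrier S" using proj_closed by auto
  show "lam Q A \<in> below_one Q" "rho Q A \<in> below_one Q"
    using A lA by (simp_all add: below_one_def ideal_lam ideal_rho cl_least ideal_proj)
  have "rho S ` A <#> A \<subseteq> A"
    using A(2) lA lAS by (auto simp: set_mult_def intro!: ideal_down[OF A(1) _ proj_mult_le] mult_closed)
  moreover have "A \<subseteq> rho S ` A <#> A"
    using A(2) set_mult_memI[of "rho S _" "rho S ` A" _ A] rho_mult by force
  ultimately have "A = cl (rho S ` A <#> A)" using cl_ideal[OF A(1)] by simp
  then show "A = rho Q A \<otimes>\<^bsub>Q\<^esub> A" using A lAS by (simp add: cl_set_mult_cl_left)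
  have "A <#> lam S ` A \<subseteq> A"
    using A(2) lA lAS by (auto simp: set_mult_def intro!: ideal_down[OF A(1) _ mult_proj_le] mult_closed)
  moreover have "A \<subseteq> A <#> lam S ` A"
    using A(2) set_mult_memI[of _ A "lam S _" "lam S ` A"] mult_lam by force
  ultimately have "A = cl (A <#> lam S ` A)" using cl_ideal[OF A(1)] by simp
  then show "A = A \<otimes>\<^bsub>Q\<^esub> lam Q A" using A lAS by (simp add: cl_set_mult_cl_right)
next
  fix \<A> assume "\<A> \<subseteq> carrier Q"
  then have \<A>: "\<A> \<subseteq> {A. ideal A}" and U: "\<Union>\<A> \<subseteq> carrier S" using ideal_Union_subset by auto
  have lA: "lam S ` A \<subseteq> carrier S" "rho S ` A \<subseteq> carrier S" if "A \<in> \<A>" for A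
    using that U lam_closed rho_closed by auto
  have "cl (lam S ` cl (\<Union>\<A>)) = cl (\<Union>A\<in>\<A>. cl (lam S ` A))"
    using U lA by (simp add: cl_lam_cl cl_UN_cl image_Union)
  then show "lam Q (\<Squnion>\<^bsub>lat Q\<^esub>\<A>) = \<Squnion>\<^bsub>lat Q\<^esub>(lam Q ` \<A>)"
    using \<A> by (subst (1 2) sup_Q) (auto intro: ideal_lam)
  have "cl (rho S ` cl (\<Union>\<A>)) = cl (\<Union>A\<in>\<A>. cl (rho S ` A))"
    using U lA by (simp add: cl_rho_cl cl_UN_cl image_Union)
  then show "rho Q (\<Squnion>\<^bsub>lat Q\<^esub>\<A>) = \<Squnion>\<^bsub>lat Q\<^esub>(rho Q ` \<A>)"
    using \<A> by (subst (1 2) sup_Q) (auto intro: ideal_rho)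
next
  fix A assume "A \<in> below_one Q"
  then have A: "ideal A" "A \<subseteq> proj S" by (simp_all add: below_one_def)
  have "lam S ` A = A" "rho S ` A = A" using A(2) lam_id rho_id by force+
  then show "lam Q A = A" "rho Q A = A" using cl_ideal[OF A(1)] by simp_all
next
  fix A B assume "A \<in> carrier Q" "B \<in> carrier Q"
  then have AB: "A \<subseteq> carrier S" "B \<subseteq> carrier S" using ideal_subset by auto
  then have l: "lam S ` A \<subseteq> carrier S" "rho S ` B \<subseteq> carrier S" using lam_closed rho_closed by auto
  have "(\<Union>a\<in>A. \<Union>b\<in>B. {lam S (a \<otimes> b)}) = (\<Union>a\<in>A. \<Union>b\<in>B. {lam S (lam S a \<otimes> b)})"
    using AB by (intro SUP_cong refl arg_cong[of _ _ "\<lambda>x. {x}"] lam_lam_mult[symmetric]) auto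
  then have "lam S ` (A <#> B) = lam S ` (lam S ` A <#> B)" by (simp add: set_mult_def image_UN)
  then show "lam Q (A \<otimes>\<^bsub>Q\<^esub> B) = lam Q (lam Q A \<otimes>\<^bsub>Q\<^esub> B)"
    using AB l by (simp add: cl_lam_cl cl_set_mult_cl_left set_mult_subset)
  have "(\<Union>a\<in>A. \<Union>b\<in>B. {rho S (a \<otimes> b)}) = (\<Union>a\<in>A. \<Union>b\<in>B. {rho S (a \<otimes> rho S b)})"
    using AB by (intro SUP_cong refl arg_cong[of _ _ "\<lambda>x. {x}"] rho_mult_rho[symmetric]) auto
  then have "rho S ` (A <#> B) = rho S ` (A <#> rho S ` B)" by (simp add: set_mult_def image_UN)
  then show "rho Q (A \<otimes>\<^bsub>Q\<^esub> B) = rho Q (A \<otimes>\<^bsub>Q\<^esub> rho Q B)"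
    using AB l by (simp add: cl_rho_cl cl_set_mult_cl_right set_mult_subset)
qed

lemma ehresmann_quantal_frame_Q: "ehresmann_quantal_frame Q"
proof (intro ehresmann_quantal_frame.intro ehresmann_quantal_frame_axioms.intro ehresmann_quantale_Q
    frame.intro frame_axioms.intro complete_lattice_Q)
  have meet: "A \<sqinter>\<^bsub>lat Q\<^esub> B = A \<inter> B" if "ideal A" "ideal B" for A B
    using that by (intro partial_order.meet_eq partial_order_Q, subst is_glb_iff) (auto simp: ideal_Int)
  fix A \<B> assume "A \<in> carrier (lat Q)" "\<B> \<subseteq> carrier (lat Q)"
  then have A: "ideal A" and \<B>: "\<B> \<subseteq> {A. ideal A}" and U: "\<Union>\<B> \<subseteq> carrier S"
    using ideal_Union_subset by auto
  have AB: "(\<lambda>B. A \<sqinter>\<^bsub>lat Q\<^esub> B) ` \<B> = (\<lambda>B. A \<inter> B) ` \<B>"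
    using A \<B> meet by (intro image_cong refl) auto
  have "A \<inter> cl (\<Union>\<B>) = cl (A \<inter> \<Union>\<B>)"
  proof
    show "A \<inter> cl (\<Union>\<B>) \<subseteq> cl (A \<inter> \<Union>\<B>)"
      using A U by (rule Int_cl_subset) (use \<B> ideal_down in blast)
    show "cl (A \<inter> \<Union>\<B>) \<subseteq> A \<inter> cl (\<Union>\<B>)"
      using A U cl_superset[of "\<Union>\<B>"] by (intro cl_least ideal_Int ideal_cl) blast+
  qed
  also have "A \<inter> \<Union>\<B> = \<Union>((\<lambda>B. A \<inter> B) ` \<B>)" by auto
  finally show "A \<sqinter>\<^bsub>lat Q\<^esub> (\<Squnion>\<^bsub>lat Q\<^esub>\<B>) = \<Squnion>\<^bsub>lat Q\<^esub>((\<lambda>B. A \<sqinter>\<^bsub>lat Q\<^esub> B) ` \<B>)"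
    unfolding AB using A \<B> U by (subst (1 2) sup_Q) (auto simp: meet ideal_cl ideal_Int)
qed

lemma mem_pr: "s \<in> carrier S \<Longrightarrow> s \<in> pr s"
  by (simp add: principal_ideal_def nat_le_refl)

lemma pr_subset_iff: "\<lbrakk>ideal A; s \<in> carrier S\<rbrakk> \<Longrightarrow> pr s \<subseteq> A \<longleftrightarrow> s \<in> A"
  using mem_pr ideal_down by (auto simp: principal_ideal_def)

lemma pr_inject:
  assumes "pr s = pr t" "s \<in> carrier S" "t \<in> carrier S"
  shows "s = t"
proof -
  have "s \<in> pr t" "t \<in> pr s" using assms mem_pr by auto
  then show ?thesis using assms(2,3) by (auto simp: principal_ideal_def intro: nat_le_antisym)
qed

lemma pr_mult:
  assumes st: "s \<in> carrier S" "t \<in> carrier S"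
  shows "cl (pr s <#> pr t) = pr (s \<otimes> t)"
proof
  have "pr s <#> pr t \<subseteq> pr (s \<otimes> t)"
  proof
    fix z assume "z \<in> pr s <#> pr t"
    then obtain x y where "x \<in> carrier S" "y \<in> carrier S" "x \<unlhd> s" "y \<unlhd> t" "z = x \<otimes> y"
      by (auto simp: set_mult_def principal_ideal_def)
    then show "z \<in> pr (s \<otimes> t)"
      using st nat_le_trans[OF mult_mono_right[of x s y] mult_mono_left[of y t s]]
      by (simp add: principal_ideal_def mult_closed)
  qed
  then show "cl (pr s <#> pr t) \<subseteq> pr (s \<otimes> t)" using st by (intro cl_least ideal_principal mult_closed)
  have "s \<otimes> t \<in> cl (pr s <#> pr t)"
    using set_mult_memI[OF mem_pr[OF st(1)] mem_pr[OF st(2)]] cl_superset by blast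
  then show "pr (s \<otimes> t) \<subseteq> cl (pr s <#> pr t)"
    using st by (simp add: pr_subset_iff ideal_mult ideal_principal mult_closed)
qed

lemma pr_lam:
  assumes s: "s \<in> carrier S"
  shows "cl (lam S ` pr s) = pr (lam S s)"
proof
  show "cl (lam S ` pr s) \<subseteq> pr (lam S s)"
    using s by (intro cl_least ideal_principal lam_closed) (auto simp: principal_ideal_def lam_closed lam_mono)
  show "pr (lam S s) \<subseteq> cl (lam S ` pr s)"
    using s mem_pr[OF s] cl_superset[of "lam S ` pr s"]
    by (auto simp: pr_subset_iff ideal_lam ideal_principal lam_closed)
qed

lemma pr_rho:
  assumes s: "s \<in> carrier S"
  shows "cl (rho S ` pr s) = pr (rho S s)"
proof
  show "cl (rho S ` pr s) \<subseteq> pr (rho S s)"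
    using s by (intro cl_least ideal_principal rho_closed) (auto simp: principal_ideal_def rho_closed rho_mono)
  show "pr (rho S s) \<subseteq> cl (rho S ` pr s)"
    using s mem_pr[OF s] cl_superset[of "rho S ` pr s"]
    by (auto simp: pr_subset_iff ideal_rho ideal_principal rho_closed)
qed

lemma pr_proj_below_one: "f \<in> proj S \<Longrightarrow> pr f \<in> below_one Q"
proof -
  assume f: "f \<in> proj S"
  then have "pr f \<subseteq> proj S" using proj_down by (auto simp: principal_ideal_def)
  then show ?thesis using f by (simp add: below_one_def ideal_principal proj_closed)
qed

text \<open>The join of a compatible closed ideal exists, belongs to the ideal, and so is its greatest
  element.\<close>

lemma compatible_ideal_principal:
  assumes A: "ideal A" and comp: "\<And>a b. \<lbrakk>a \<in> A; b \<in> A\<rbrakk> \<Longrightarrow> compatible S a b"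
  obtains s where "s \<in> A" "A = pr s"
proof -
  have AS: "A \<subseteq> carrier S" using A by (rule ideal_subset)
  obtain s where s: "lub s A" using compatible_join[OF AS comp] by blast
  then have sA: "s \<in> A" using ideal_lub[OF A subset_refl] by blast
  have "A \<subseteq> pr s" using lub_upper[OF s AS] AS by (auto simp: principal_ideal_def)
  moreover have "pr s \<subseteq> A" using sA AS pr_subset_iff[OF A, of s] by blast
  ultimately show thesis using that sA by blast
qed

text \<open>Let \<open>A\<close> be a partial isometry and \<open>a, b \<in> A\<close>. The principal ideal of \<open>a\<close> is contained in \<open>A\<close>, hence is
  the product of \<open>A\<close> with the principal ideal of \<open>lam a\<close>. It therefore contains \<open>b \<otimes> lam a\<close>, and
  \<open>b \<otimes> lam a \<le> a\<close> forces \<open>b \<otimes> lam a = a \<otimes> lam b\<close>. So \<open>A\<close> is compatible, and its join, which belongs to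
  \<open>A\<close>, generates it. Conversely, a closed ideal inside a principal ideal is bounded, hence
  compatible, hence principal, and principal ideals are ordered like the monoid.\<close>

lemma partial_isometries_Q: "partial_isometries Q = pr ` carrier S"
proof (intro equalityI subsetI)
  interpret QF: ehresmann_quantal_frame Q by (rule ehresmann_quantal_frame_Q)
  fix A assume PI: "A \<in> partial_isometries Q"
  then have A: "ideal A" and AS: "A \<subseteq> carrier S"
    using QF.partial_isometry_closed[OF PI] ideal_subset by auto
  have "compatible S a b" if ab: "a \<in> A" "b \<in> A" for a b
  proof -
    have S: "a \<in> carrier S" "b \<in> carrier S" using ab AS by auto
    have "pr a \<subseteq> A" using A S ab by (simp add: pr_subset_iff)
    then have "pr a = A \<otimes>\<^bsub>Q\<^esub> lam Q (pr a)" "pr a = rho Q (pr a) \<otimes>\<^bsub>Q\<^esub> A"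
      using S by (intro QF.partial_isometry_le[OF _ PI]; simp add: ideal_principal)+
    then have eq: "pr a = cl (A <#> pr (lam S a))" "pr a = cl (pr (rho S a) <#> A)"
      unfolding Q_simps pr_lam[OF S(1)] pr_rho[OF S(1)] .
    have "b \<otimes> lam S a \<in> pr a"
      unfolding eq(1) using set_mult_memI[OF ab(2) mem_pr[OF lam_closed[OF S(1)]]] cl_superset by blast
    then have 1: "a \<otimes> lam S (b \<otimes> lam S a) = b \<otimes> lam S a"
      using S by (intro nat_le_lam) (simp add: principal_ideal_def)
    have "b \<otimes> lam S a = a \<otimes> (lam S b \<otimes> lam S a)"
      using 1 S by (simp add: lam_mult_proj lam_proj)
    also have "\<dots> = a \<otimes> lam S a \<otimes> lam S b"
      using S proj_comm[of "lam S b" "lam S a"] by (simp add: lam_proj lam_closed mult_assoc)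
    finally have lam: "a \<otimes> lam S b = b \<otimes> lam S a" using S mult_lam by simp
    have "rho S a \<otimes> b \<in> pr a"
      unfolding eq(2) using set_mult_memI[OF mem_pr[OF rho_closed[OF S(1)]] ab(2)] cl_superset by blast
    then have 2: "rho S (rho S a \<otimes> b) \<otimes> a = rho S a \<otimes> b"
      using S by (intro nat_le_rho) (simp add: principal_ideal_def)
    have "rho S a \<otimes> b = rho S a \<otimes> rho S b \<otimes> a"
      using 2 S by (simp add: rho_proj_mult rho_proj)
    also have "\<dots> = rho S b \<otimes> (rho S a \<otimes> a)"
      using S proj_comm[of "rho S b" "rho S a"] by (simp add: rho_proj rho_closed flip: mult_assoc)
    finally have "rho S b \<otimes> a = rho S a \<otimes> b" using S rho_mult by simp
    then show ?thesis using lam by (simp add: compatible_def)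
  qed
  then obtain s where "s \<in> A" "A = pr s" using compatible_ideal_principal[OF A] by blast
  then show "A \<in> pr ` carrier S" using AS by blast
next
  fix A assume "A \<in> pr ` carrier S"
  then obtain s where s: "s \<in> carrier S" "A = pr s" by blast
  have "nat_le Q (below_one Q) B A" if B: "ideal B" "B \<subseteq> pr s" for B
  proof -
    have "compatible S a b" if "a \<in> B" "b \<in> B" for a b
      using that B(2) s(1) compatible_if_bounded[of a s b] by (auto simp: principal_ideal_def)
    then obtain b where b: "b \<in> B" "B = pr b" using compatible_ideal_principal[OF B(1)] by blast
    then have "b \<unlhd> s" using B(2) by (auto simp: principal_ideal_def)
    then obtain f g where fg: "f \<in> proj S" "g \<in> proj S" "b = s \<otimes> f" "b = g \<otimes> s" by (rule nat_leE)
    then have "B = pr g \<otimes>\<^bsub>Q\<^esub> A" "B = A \<otimes>\<^bsub>Q\<^esub> pr f"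
      using b(2) s by (simp_all add: pr_mult proj_closed)
    then show ?thesis unfolding nat_le_def using fg pr_proj_below_one by blast
  qed
  then show "A \<in> partial_isometries Q"
    using s by (auto simp: partial_isometries_def ideal_principal)
qed

lemma restriction_quantal_frame_Q: "restriction_quantal_frame Q"
proof (intro restriction_quantal_frame.intro restriction_quantal_frame_axioms.intro
    ehresmann_quantal_frame_Q)
  interpret QF: ehresmann_quantal_frame Q by (rule ehresmann_quantal_frame_Q)
  have P: "pr ` carrier S \<subseteq> {A. ideal A}" using ideal_principal by auto
  have "carrier S \<subseteq> \<Union>(pr ` carrier S)" using mem_pr by auto
  then have "carrier S \<subseteq> cl (\<Union>(pr ` carrier S))" using cl_superset by blast
  moreover have "cl (\<Union>(pr ` carrier S)) \<subseteq> carrier S"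
    using cl_subset[OF ideal_Union_subset[OF P]] .
  ultimately have "\<Squnion>\<^bsub>lat Q\<^esub>(pr ` carrier S) = carrier S" using sup_Q[OF P] by simp
  moreover have "\<top>\<^bsub>lat Q\<^esub> = carrier S"
    using QF.lat.top_weak_eq[of "carrier S"] ideal_carrier ideal_subset by simp
  ultimately show "\<exists>A\<subseteq>partial_isometries Q. \<top>\<^bsub>lat Q\<^esub> = \<Squnion>\<^bsub>lat Q\<^esub>A"
    unfolding partial_isometries_Q by blast
  show "A \<otimes>\<^bsub>Q\<^esub> B \<in> partial_isometries Q" if "A \<in> partial_isometries Q" "B \<in> partial_isometries Q" for A B
    using that unfolding partial_isometries_Q by (auto simp: pr_mult mult_closed)
qed

theorem principal_ideal_representation: "partial_isometry_representation S Q (principal_ideal S)"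
proof (intro partial_isometry_representation.intro partial_isometry_representation_axioms.intro
    restriction_quantal_frame_Q)
  show "bij_betw pr (carrier S) (partial_isometries Q)"
    unfolding partial_isometries_Q by (rule bij_betw_imageI) (simp_all add: inj_on_def pr_inject)
  show "pr \<one> = \<one>\<^bsub>Q\<^esub>"
    using proj_closed by (auto simp: principal_ideal_def simp flip: proj_iff_le_one)
  show "pr ` proj S = below_one Q"
  proof (intro equalityI subsetI)
    fix A assume "A \<in> below_one Q"
    then have A: "ideal A" "A \<subseteq> proj S" by (simp_all add: below_one_def)
    have "compatible S a b" if "a \<in> A" "b \<in> A" for a b
      using that A(2) by (intro compatible_if_bounded[of a \<one> b] proj_le_one one_closed) blast+
    then obtain s where "s \<in> A" "A = pr s" by (rule compatible_ideal_principal[OF A(1)])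
    then show "A \<in> pr ` proj S" using A(2) by auto
  qed (use pr_proj_below_one in auto)
qed (auto simp: pr_mult pr_lam pr_rho mult_closed lam_closed rho_closed proj_closed)

end


section \<open>Changing the underlying sets\<close>

text \<open>The closed ideals of a monoid on a type \<open>'u\<close> are sets over \<open>'u\<close>. To obtain a quantale on \<open>'u\<close> itself,
  the structure is moved along an injection \<open>h\<close>.\<close>

locale quantale_copy = restriction_quantal_frame Q
  for Q :: "('a, 'm) lr_quantale_scheme" (structure) and R :: "('b, 'n) lr_quantale_scheme"
    and h :: "'a \<Rightarrow> 'b" +
  assumes inj: "inj_on h (carrier Q)"
    and R_carrier: "carrier R = h ` carrier Q"
    and R_mult: "\<lbrakk>a \<in> carrier Q; b \<in> carrier Q\<rbrakk> \<Longrightarrow> h a \<otimes>\<^bsub>R\<^esub> h b = h (a \<otimes> b)"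
    and R_one: "\<one>\<^bsub>R\<^esub> = h \<one>"
    and R_lam: "a \<in> carrier Q \<Longrightarrow> lam R (h a) = h (lam Q a)"
    and R_rho: "a \<in> carrier Q \<Longrightarrow> rho R (h a) = h (rho Q a)"
    and R_le: "\<lbrakk>a \<in> carrier Q; b \<in> carrier Q\<rbrakk> \<Longrightarrow> qle R (h a) (h b) \<longleftrightarrow> a \<preceq> b"
begin

lemma h_inject: "\<lbrakk>a \<in> carrier Q; b \<in> carrier Q\<rbrakk> \<Longrightarrow> h a = h b \<longleftrightarrow> a = b"
  using inj by (auto dest: inj_onD)

lemma R_E:
  assumes "x \<in> carrier R"
  obtains a where "a \<in> carrier Q" "x = h a"
  using assms unfolding R_carrier by blast

lemma R_subsetE:
  assumes "X \<subseteq> carrier R"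
  obtains A where "A \<subseteq> carrier Q" "X = h ` A"
  using assms unfolding R_carrier subset_image_iff by blast

lemma h_closed: "a \<in> carrier Q \<Longrightarrow> h a \<in> carrier R"
  by (simp add: R_carrier)

lemma partial_order_R: "partial_order (lat R)"
proof (rule partial_orderI; unfold lat_simps)
  show "qle R x x" if "x \<in> carrier R" for x
    using that by (elim R_E) (simp add: R_le le_refl)
  show "x = y" if "x \<in> carrier R" "y \<in> carrier R" "qle R x y" "qle R y x" for x y
    using that by (elim R_E) (simp add: R_le h_inject, rule le_antisym)
  show "qle R x z" if "x \<in> carrier R" "y \<in> carrier R" "z \<in> carrier R" "qle R x y" "qle R y z" for x y z
    using that by (elim R_E) (simp add: R_le, rule le_trans)
qed simp

lemma is_lub_R:
  assumes A: "A \<subseteq> carrier Q"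
  shows "is_lub (lat R) (h (\<Or>A)) (h ` A)"
proof -
  have "h ` A \<subseteq> carrier R" using A by (auto simp: R_carrier)
  moreover have "qle R (h a) (h (\<Or>A))" if "a \<in> A" for a
    using that A R_le[of a "\<Or>A"] Join_upper Join_closed by auto
  moreover have "qle R (h (\<Or>A)) u" if u: "u \<in> carrier R" "\<forall>a \<in> A. qle R (h a) u" for u
  proof -
    obtain v where v: "v \<in> carrier Q" "u = h v" using u(1) by (rule R_E)
    have "a \<preceq> v" if "a \<in> A" for a
      using that u(2) v A R_le[of a v] by auto
    then show ?thesis using v A by (simp add: R_le Join_closed Join_least)
  qed
  ultimately show ?thesis using A by (simp add: is_lub_iff h_closed Join_closed)
qed

lemma sup_R: "A \<subseteq> carrier Q \<Longrightarrow> \<Squnion>\<^bsub>lat R\<^esub>(h ` A) = h (\<Or>A)"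
  by (intro partial_order.sup_eq partial_order_R is_lub_R)

lemma complete_lattice_R: "complete_lattice (lat R)"
proof (intro partial_order.complete_lattice_if_lubs partial_order_R)
  fix X assume "X \<subseteq> carrier (lat R)"
  then obtain A where "A \<subseteq> carrier Q" "X = h ` A" by (auto elim: R_subsetE)
  then show "\<exists>s. is_lub (lat R) s X" using is_lub_R by blast
qed

lemma meet_R:
  assumes "a \<in> carrier Q" "b \<in> carrier Q"
  shows "h a \<sqinter>\<^bsub>lat R\<^esub> h b = h (a \<sqdot> b)"
proof (intro partial_order.meet_eq partial_order_R)
  have "qle R u (h (a \<sqdot> b))" if "u \<in> carrier R" "qle R u (h a)" "qle R u (h b)" for u
    using that assms by (elim R_E) (simp add: R_le meet_closed meet_greatest)
  then show "is_glb (lat R) (h (a \<sqdot> b)) {h a, h b}"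
    using assms by (simp add: is_glb_iff h_closed meet_closed R_le meet_le)
qed

lemma below_one_R: "below_one R = h ` below_one Q"
  by (auto simp: below_one_def R_carrier R_one R_le)

lemma unital_quantale_R: "unital_quantale R"
proof (intro unital_quantale.intro unital_quantale_axioms.intro complete_lattice_R monoidI)
  show "x \<otimes>\<^bsub>R\<^esub> y \<in> carrier R" if "x \<in> carrier R" "y \<in> carrier R" for x y
    using that by (elim R_E) (simp add: R_mult h_closed)
  show "x \<otimes>\<^bsub>R\<^esub> y \<otimes>\<^bsub>R\<^esub> z = x \<otimes>\<^bsub>R\<^esub> (y \<otimes>\<^bsub>R\<^esub> z)"
    if "x \<in> carrier R" "y \<in> carrier R" "z \<in> carrier R" for x y z
    using that by (elim R_E) (simp add: R_mult m_assoc)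
  show "\<one>\<^bsub>R\<^esub> \<otimes>\<^bsub>R\<^esub> x = x" "x \<otimes>\<^bsub>R\<^esub> \<one>\<^bsub>R\<^esub> = x" if "x \<in> carrier R" for x
    using that by (elim R_E; simp add: R_mult R_one)+
  fix x X assume "x \<in> carrier R" "X \<subseteq> carrier R"
  then obtain a A where a: "a \<in> carrier Q" "x = h a" and A: "A \<subseteq> carrier Q" "X = h ` A"
    by (metis R_E R_subsetE)
  have "(\<lambda>y. x \<otimes>\<^bsub>R\<^esub> y) ` X = h ` (\<lambda>b. a \<otimes> b) ` A"
    unfolding a(2) A(2) image_image using a(1) A(1) by (intro image_cong refl R_mult) auto
  moreover have "\<Squnion>\<^bsub>lat R\<^esub>(h ` (\<lambda>b. a \<otimes> b) ` A) = h (\<Or>((\<lambda>b. a \<otimes> b) ` A))"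
    using a A by (intro sup_R) auto
  ultimately show "x \<otimes>\<^bsub>R\<^esub> \<Squnion>\<^bsub>lat R\<^esub>X = \<Squnion>\<^bsub>lat R\<^esub>((\<lambda>y. x \<otimes>\<^bsub>R\<^esub> y) ` X)"
    using a A by (simp add: sup_R R_mult Join_closed mult_join)
  have "(\<lambda>y. y \<otimes>\<^bsub>R\<^esub> x) ` X = h ` (\<lambda>b. b \<otimes> a) ` A"
    unfolding a(2) A(2) image_image using a(1) A(1) by (intro image_cong refl R_mult) auto
  moreover have "\<Squnion>\<^bsub>lat R\<^esub>(h ` (\<lambda>b. b \<otimes> a) ` A) = h (\<Or>((\<lambda>b. b \<otimes> a) ` A))"
    using a A by (intro sup_R) auto
  ultimately show "\<Squnion>\<^bsub>lat R\<^esub>X \<otimes>\<^bsub>R\<^esub> x = \<Squnion>\<^bsub>lat R\<^esub>((\<lambda>y. y \<otimes>\<^bsub>R\<^esub> x) ` X)"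
    using a A by (simp add: sup_R R_mult Join_closed join_mult)
qed (simp add: R_one h_closed)

lemma ehresmann_quantale_R: "ehresmann_quantale R"
proof (intro ehresmann_quantale.intro ehresmann_quantale_axioms.intro unital_quantale_R)
  fix x assume "x \<in> carrier R"
  then obtain a where a: "a \<in> carrier Q" "x = h a" by (rule R_E)
  show "lam R x \<in> below_one R" "rho R x \<in> below_one R"
    using a by (simp_all add: R_lam R_rho below_one_R lam_below rho_below)
  show "x = rho R x \<otimes>\<^bsub>R\<^esub> x" "x = x \<otimes>\<^bsub>R\<^esub> lam R x"
    using a rho_mult[of a] mult_lam[of a] by (simp_all add: R_lam R_rho R_mult lam_closed rho_closed)
  fix y assume "y \<in> carrier R"
  then obtain b where b: "b \<in> carrier Q" "y = h b" by (rule R_E)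
  show "lam R (x \<otimes>\<^bsub>R\<^esub> y) = lam R (lam R x \<otimes>\<^bsub>R\<^esub> y)" "rho R (x \<otimes>\<^bsub>R\<^esub> y) = rho R (x \<otimes>\<^bsub>R\<^esub> rho R y)"
    using a b lam_mult[of a b] rho_mult_rho[of a b]
    by (simp_all add: R_lam R_rho R_mult lam_closed rho_closed)
next
  fix x assume "x \<in> below_one R"
  then obtain f where f: "f \<in> below_one Q" "x = h f" unfolding below_one_R by blast
  then show "lam R x = x" "rho R x = x"
    by (simp_all add: R_lam R_rho below_one_closed lam_id rho_id)
next
  fix X assume "X \<subseteq> carrier R"
  then obtain A where A: "A \<subseteq> carrier Q" "X = h ` A" by (rule R_subsetE)
  have sub: "lam Q ` A \<subseteq> carrier Q" "rho Q ` A \<subseteq> carrier Q"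
    using A lam_closed rho_closed by auto
  have "lam R ` X = h ` lam Q ` A" "rho R ` X = h ` rho Q ` A"
    unfolding A(2) image_image using A(1) by (intro image_cong refl R_lam R_rho; auto)+
  then show "lam R (\<Squnion>\<^bsub>lat R\<^esub>X) = \<Squnion>\<^bsub>lat R\<^esub>(lam R ` X)" "rho R (\<Squnion>\<^bsub>lat R\<^esub>X) = \<Squnion>\<^bsub>lat R\<^esub>(rho R ` X)"
    using A by (simp_all add: sup_R[OF sub(1)] sup_R[OF sub(2)] sup_R[OF A(1)] R_lam R_rho
        Join_closed lam_join rho_join)
qed

lemma ehresmann_quantal_frame_R: "ehresmann_quantal_frame R"
proof (intro ehresmann_quantal_frame.intro ehresmann_quantal_frame_axioms.intro ehresmann_quantale_R
    frame.intro frame_axioms.intro complete_lattice_R)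
  fix x X assume "x \<in> carrier (lat R)" "X \<subseteq> carrier (lat R)"
  then obtain a A where a: "a \<in> carrier Q" "x = h a" and A: "A \<subseteq> carrier Q" "X = h ` A"
    by (metis R_E R_subsetE lat_simps(1))
  have "(\<lambda>y. x \<sqinter>\<^bsub>lat R\<^esub> y) ` X = h ` (\<lambda>b. a \<sqdot> b) ` A"
    unfolding a(2) A(2) image_image using a(1) A(1) by (intro image_cong refl meet_R) auto
  moreover have "\<Squnion>\<^bsub>lat R\<^esub>(h ` (\<lambda>b. a \<sqdot> b) ` A) = h (\<Or>((\<lambda>b. a \<sqdot> b) ` A))"
    using a A meet_closed by (intro sup_R) auto
  ultimately show "x \<sqinter>\<^bsub>lat R\<^esub> (\<Squnion>\<^bsub>lat R\<^esub>X) = \<Squnion>\<^bsub>lat R\<^esub>((\<lambda>y. x \<sqinter>\<^bsub>lat R\<^esub> y) ` X)"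
    using a A by (simp add: sup_R meet_R Join_closed meet_Join)
qed

lemma nat_le_R:
  assumes "a \<in> carrier Q" "b \<in> carrier Q"
  shows "nat_le R (below_one R) (h a) (h b) \<longleftrightarrow> nat_le Q (below_one Q) a b"
  unfolding nat_le_def below_one_R
  using assms below_one_closed by (simp add: R_mult h_inject cong: bex_cong)

lemma partial_isometries_R: "partial_isometries R = h ` partial_isometries Q"
  by (auto simp: partial_isometries_def R_carrier R_le nat_le_R)

lemma restriction_quantal_frame_R: "restriction_quantal_frame R"
proof (intro restriction_quantal_frame.intro restriction_quantal_frame_axioms.intro
    ehresmann_quantal_frame_R)
  obtain A where A: "A \<subseteq> partial_isometries Q" "\<top>\<^bsub>lat Q\<^esub> = \<Or>A" using top_join by blast
  have AQ: "A \<subseteq> carrier Q" using A partial_isometry_closed by blast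
  interpret L: complete_lattice "lat R" by (rule complete_lattice_R)
  have "x \<sqsubseteq>\<^bsub>lat R\<^esub> h \<top>\<^bsub>lat Q\<^esub>" if "x \<in> carrier (lat R)" for x
    using that lat.top_higher lat.top_closed by (auto simp: R_carrier R_le)
  moreover have "h \<top>\<^bsub>lat Q\<^esub> \<in> carrier (lat R)"
    using lat.top_closed by (simp add: h_closed)
  ultimately have "\<top>\<^bsub>lat R\<^esub> = h \<top>\<^bsub>lat Q\<^esub>" using L.top_weak_eq[of "h \<top>\<^bsub>lat Q\<^esub>"] by simp
  then have "\<top>\<^bsub>lat R\<^esub> = \<Squnion>\<^bsub>lat R\<^esub>(h ` A)" using A(2) sup_R[OF AQ] by simp
  then show "\<exists>X\<subseteq>partial_isometries R. \<top>\<^bsub>lat R\<^esub> = \<Squnion>\<^bsub>lat R\<^esub>X"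
    unfolding partial_isometries_R using A(1) by blast
  show "x \<otimes>\<^bsub>R\<^esub> y \<in> partial_isometries R" if "x \<in> partial_isometries R" "y \<in> partial_isometries R" for x y
    using that partial_isometries_mult partial_isometry_closed
    unfolding partial_isometries_R by (auto simp: R_mult)
qed

lemma representation_R:
  assumes "partial_isometry_representation S Q j"
  shows "partial_isometry_representation S R (h \<circ> j)"
proof -
  interpret A: partial_isometry_representation S Q j by fact
  show ?thesis
  proof (intro partial_isometry_representation.intro partial_isometry_representation_axioms.intro
      restriction_quantal_frame_R)
    have "inj_on h (partial_isometries Q)"
      using inj partial_isometry_closed by (auto intro: inj_on_subset)
    then have "bij_betw h (partial_isometries Q) (partial_isometries R)"
      by (simp add: partial_isometries_R bij_betw_def)
    then show "bij_betw (h \<circ> j) (carrier S) (partial_isometries R)"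
      using A.bij by (rule bij_betw_trans[rotated])
    show "(h \<circ> j) ` proj S = below_one R"
      by (simp add: below_one_R A.j_proj flip: image_image)
  qed (auto simp: A.S_mult_closed A.j_mult A.S_one_closed A.j_one A.S_lam_closed A.j_lam
      A.S_rho_closed A.j_rho A.projD A.j_closed R_mult R_one R_lam R_rho)
qed

end

lemma quantale_copy_exists:
  fixes Q :: "('a, 'm) lr_quantale_scheme" and h :: "'a \<Rightarrow> 'b"
  assumes Q: "restriction_quantal_frame Q" and h: "inj_on h (carrier Q)"
  obtains R :: "'b lr_quantale" where "carrier R = h ` carrier Q" "quantale_copy Q R h"
proof -
  define g where "g = inv_into (carrier Q) h"
  have g: "g (h a) = a" if "a \<in> carrier Q" for a
    using that h by (simp add: g_def)
  define R where "R = \<lparr>carrier = h ` carrier Q, monoid.mult = (\<lambda>x y. h (g x \<otimes>\<^bsub>Q\<^esub> g y)),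
    one = h \<one>\<^bsub>Q\<^esub>, lam = (\<lambda>x. h (lam Q (g x))), rho = (\<lambda>x. h (rho Q (g x))),
    qle = (\<lambda>x y. qle Q (g x) (g y))\<rparr>"
  have "quantale_copy Q R h"
    using Q h by (intro quantale_copy.intro quantale_copy_axioms.intro) (simp_all add: R_def g)
  then show thesis using that[of R] by (simp add: R_def)
qed

lemma representation_exists:
  fixes Q :: "('b, 'n) lr_quantale_scheme" and c :: "'b \<Rightarrow> 'a"
  assumes Q: "restriction_quantal_frame Q" and c: "inj_on c (partial_isometries Q)"
  obtains S :: "'a restr_monoid" and j
  where "carrier S = c ` partial_isometries Q" "partial_isometry_representation S Q j"
proof -
  interpret restriction_quantal_frame Q by (rule Q)
  define j where "j = inv_into (partial_isometries Q) c"
  have j: "j (c p) = p" if "p \<in> partial_isometries Q" for p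
    using that c by (simp add: j_def)
  define S where "S = \<lparr>carrier = c ` partial_isometries Q,
    monoid.mult = (\<lambda>x y. c (j x \<otimes>\<^bsub>Q\<^esub> j y)), one = c \<one>\<^bsub>Q\<^esub>,
    lam = (\<lambda>x. c (lam Q (j x))), rho = (\<lambda>x. c (rho Q (j x))), proj = c ` below_one Q\<rparr>"
  have mem: "\<one>\<^bsub>Q\<^esub> \<in> partial_isometries Q"
    "\<And>p. p \<in> partial_isometries Q \<Longrightarrow> lam Q p \<in> partial_isometries Q"
    "\<And>p. p \<in> partial_isometries Q \<Longrightarrow> rho Q p \<in> partial_isometries Q"
    by (simp_all add: below_one_partial_isometry one_below_one lam_below rho_below partial_isometry_closed)
  have "partial_isometry_representation S Q j"
  proof (intro partial_isometry_representation.intro partial_isometry_representation_axioms.intro Q)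
    show "bij_betw j (carrier S) (partial_isometries Q)"
      using bij_betw_inv_into[OF inj_on_imp_bij_betw[OF c]] by (simp add: S_def j_def)
    have "j ` c ` below_one Q = (\<lambda>f. f) ` below_one Q"
      unfolding image_image by (intro image_cong refl j below_one_partial_isometry)
    then show "j ` proj S = below_one Q" by (simp add: S_def)
  qed (auto simp: S_def j mem partial_isometries_mult below_one_partial_isometry)
  then show thesis using that[of S j] by (simp add: S_def)
qed


section \<open>Equivalence of the categories\<close>

lemma transfer_compose:
  assumes "representation_pair S Q j S' Q' j'" "representation_pair S' Q' j' S'' Q'' j''"
    and \<theta>: "rqf_morphism Q Q' \<theta>" "rqf_morphism Q' Q'' \<theta>'" "rqf_morphism Q Q'' (compose (carrier Q) \<theta>' \<theta>)"
  shows "transfer S j S'' j'' (compose (carrier Q) \<theta>' \<theta>)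
    = compose (carrier S) (transfer S' j' S'' j'' \<theta>') (transfer S j S' j' \<theta>)"
proof (rule extensionalityI[of _ "carrier S"])
  interpret P: representation_pair S Q j S' Q' j' by fact
  interpret P': representation_pair S' Q' j' S'' Q'' j'' by fact
  interpret P'': representation_pair S Q j S'' Q'' j'' ..
  show "transfer S j S'' j'' (compose (carrier Q) \<theta>' \<theta>) x
      = compose (carrier S) (transfer S' j' S'' j'' \<theta>') (transfer S j S' j' \<theta>) x"
    if x: "x \<in> carrier S" for x
  proof -
    note closed = P.transfer_closed[OF \<theta>(1) x] P.A.j_closed[OF x]
    note c = P'.transfer_closed[OF \<theta>(2) closed(1)] P''.transfer_closed[OF \<theta>(3) x]
    have "j'' (transfer S j S'' j'' (compose (carrier Q) \<theta>' \<theta>) x)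
        = j'' (transfer S' j' S'' j'' \<theta>' (transfer S j S' j' \<theta> x))"
      using x closed P.j'_transfer[OF \<theta>(1) x] P'.j'_transfer[OF \<theta>(2) closed(1)] P''.j'_transfer[OF \<theta>(3) x]
      by (simp add: compose_def)
    then show ?thesis using c x P'.B.j_inject by (simp add: compose_def)
  qed
qed (simp_all add: transfer_def compose_def)

lemma transfer_ident:
  assumes "partial_isometry_representation S Q j"
  shows "transfer S j S j (\<lambda>x\<in>carrier Q. x) = (\<lambda>x\<in>carrier S. x)"
proof -
  interpret A: partial_isometry_representation S Q j by fact
  show ?thesis using A.bij A.j_closed by (auto simp: transfer_def bij_betw_def fun_eq_iff)
qed

lemma compose_in_rqf_morphisms:
  assumes f: "f \<in> rqf_morphisms k Q R" and g: "g \<in> rqf_morphisms k R T"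
    and Q: "restriction_quantal_frame Q"
  shows "compose (carrier Q) g f \<in> rqf_morphisms k Q T"
proof -
  interpret Q: restriction_quantal_frame Q by fact
  have f': "rqf_morphism Q R f" and g': "rqf_morphism R T g"
    using f g by (auto simp: rqf_morphisms_def)
  have fC: "f a \<in> carrier R" if "a \<in> carrier Q" for a using f' that by (auto simp: rqf_morphism_def)
  have gC: "g a \<in> carrier T" if "a \<in> carrier R" for a using g' that by (auto simp: rqf_morphism_def)
  have img: "compose (carrier Q) g f ` A = g ` f ` A" if "A \<subseteq> carrier Q" for A
    unfolding image_image using that by (intro image_cong refl) (auto simp: compose_def)
  have fA: "f ` A \<subseteq> carrier R" if "A \<subseteq> carrier Q" for A using that fC by auto
  have "rqf_morphism Q T (compose (carrier Q) g f)"
    unfolding rqf_morphism_def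
  proof (intro conjI allI impI ballI)
    show "compose (carrier Q) g f \<in> carrier Q \<rightarrow>\<^sub>E carrier T"
      using fC gC by (auto simp: compose_def)
    show "compose (carrier Q) g f (\<Squnion>\<^bsub>lat Q\<^esub>A) = \<Squnion>\<^bsub>lat T\<^esub>(compose (carrier Q) g f ` A)"
      if A: "A \<subseteq> carrier Q" for A
      unfolding img[OF A] using f' g' A fA[OF A] Q.Join_closed[OF A]
      by (simp add: rqf_morphism_def compose_def)
    show "compose (carrier Q) g f \<in> hom Q T"
      using f' g' fC gC by (simp add: rqf_morphism_def hom_def compose_def)
    show "compose (carrier Q) g f \<one>\<^bsub>Q\<^esub> = \<one>\<^bsub>T\<^esub>"
      using f' g' by (simp add: rqf_morphism_def compose_def)
    show "compose (carrier Q) g f (lam Q a) = lam T (compose (carrier Q) g f a)"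
      "compose (carrier Q) g f (rho Q a) = rho T (compose (carrier Q) g f a)" if "a \<in> carrier Q" for a
      using f' g' that fC by (simp_all add: rqf_morphism_def compose_def Q.lam_closed Q.rho_closed)
    show "compose (carrier Q) g f \<in> partial_isometries Q \<rightarrow> partial_isometries T"
      using f' g' Q.partial_isometry_closed by (auto simp: rqf_morphism_def compose_def Pi_iff)
  qed
  moreover have "rqf_proper Q T (compose (carrier Q) g f)" if "rqf_proper Q R f" "rqf_proper R T g"
    using that Q.lat.top_closed by (simp add: rqf_proper_def compose_def)
  moreover have "rqf_meet_preserving Q T (compose (carrier Q) g f)"
    if "rqf_meet_preserving Q R f" "rqf_meet_preserving R T g"
    unfolding rqf_meet_preserving_def
  proof (intro allI impI)
    fix A assume A: "A \<subseteq> carrier Q \<and> finite A \<and> A \<noteq> {}"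
    have "\<Sqinter>\<^bsub>lat Q\<^esub>A \<in> carrier Q" using A Q.lat.inf_closed[of A] by simp
    then show "compose (carrier Q) g f (\<Sqinter>\<^bsub>lat Q\<^esub>A) = \<Sqinter>\<^bsub>lat T\<^esub>(compose (carrier Q) g f ` A)"
      using that A fA[of A] img[of A] by (simp add: rqf_meet_preserving_def compose_def)
  qed
  ultimately show ?thesis using f g by (auto simp: rqf_morphisms_def)
qed

lemma ident_in_rqf_morphisms:
  assumes "restriction_quantal_frame Q"
  shows "(\<lambda>x\<in>carrier Q. x) \<in> rqf_morphisms k Q Q"
proof -
  interpret Q: restriction_quantal_frame Q by fact
  define \<iota> where "\<iota> = (\<lambda>x\<in>carrier Q. x)"
  have \<iota>: "\<iota> \<in> carrier Q \<rightarrow>\<^sub>E carrier Q" "\<And>a. a \<in> carrier Q \<Longrightarrow> \<iota> a = a"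
    by (auto simp: \<iota>_def)
  have img: "\<iota> ` A = A" if "A \<subseteq> carrier Q" for A
  proof -
    have "\<iota> ` A = (\<lambda>x. x) ` A" using that \<iota>(2) by (intro image_cong refl) auto
    then show ?thesis by simp
  qed
  have inf: "\<Sqinter>\<^bsub>lat Q\<^esub>A \<in> carrier Q" if "A \<subseteq> carrier Q" for A
    using that Q.lat.inf_closed[of A] by simp
  have top: "\<top>\<^bsub>lat Q\<^esub> \<in> carrier Q"
    using Q.lat.top_closed by simp
  have "\<iota> \<in> partial_isometries Q \<rightarrow> partial_isometries Q"
    using \<iota>(2) Q.partial_isometry_closed by simp
  then have "rqf_morphism Q Q \<iota>"
    unfolding rqf_morphism_def hom_def using \<iota>(1)
    by (simp add: \<iota>(2) img Q.Join_closed Q.lam_closed Q.rho_closed)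
  moreover have "rqf_proper Q Q \<iota>" "rqf_meet_preserving Q Q \<iota>"
    by (simp_all add: rqf_proper_def rqf_meet_preserving_def \<iota>(2) img inf top)
  ultimately show ?thesis unfolding \<iota>_def by (simp add: rqf_morphisms_def)
qed

lemma concrete_category:
  fixes car :: "'o \<Rightarrow> 'a set"
  assumes hom: "\<And>a b f. \<lbrakk>a \<in> X; b \<in> X; f \<in> H a b\<rbrakk> \<Longrightarrow> f \<in> car a \<rightarrow>\<^sub>E car b"
    and ident: "\<And>a. a \<in> X \<Longrightarrow> (\<lambda>x\<in>car a. x) \<in> H a a"
    and comp: "\<And>a b c f g. \<lbrakk>a \<in> X; b \<in> X; c \<in> X; f \<in> H a b; g \<in> H b c\<rbrakk> \<Longrightarrow> compose (car a) g f \<in> H a c"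
  shows "is_category \<lparr>Obj = X, Hom = H, Ident = (\<lambda>a. \<lambda>x\<in>car a. x),
    Comp = (\<lambda>a b c g f. compose (car a) g f)\<rparr>"
  unfolding is_category_def category.simps
proof (intro conjI ballI)
  fix a b f assume "a \<in> X" "b \<in> X" "f \<in> H a b"
  then have "f \<in> car a \<rightarrow> car b" "f \<in> extensional (car a)" using hom by (auto simp: PiE_def)
  then show "compose (car a) f (\<lambda>x\<in>car a. x) = f" "compose (car a) (\<lambda>x\<in>car b. x) f = f"
    by (rule compose_Id, rule Id_compose)
next
  fix a b c d f g h assume "a \<in> X" "b \<in> X" "f \<in> H a b"
  then have "f \<in> car a \<rightarrow> car b" using hom by (auto simp: PiE_def)
  then show "compose (car a) (compose (car b) h g) f = compose (car a) h (compose (car a) g f)"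
    by (rule compose_assoc[symmetric])
qed (use ident comp in auto)

lemma is_category_rqf: "is_category (rqf_category k R)"
  unfolding rqf_category_def
proof (rule concrete_category)
  show "f \<in> carrier Q \<rightarrow>\<^sub>E carrier T" if "f \<in> rqf_morphisms k Q T" for Q T :: "'a lr_quantale" and f
    using that by (simp add: rqf_morphisms_def rqf_morphism_def)
qed (auto intro: ident_in_rqf_morphisms compose_in_rqf_morphisms)

text \<open>Under the bijection \<open>transfer\<close> composition in the category of monoids becomes composition of
  morphisms of quantal frames, where closure of all four types under composition is evident:
  properness, for instance, is preservation of one element.\<close>

lemma compose_in_crm_morphisms:
  assumes S: "complete_restriction_monoid S" "complete_restriction_monoid T" "complete_restriction_monoid U"
    and f: "f \<in> crm_morphisms k S T" and g: "g \<in> crm_morphisms k T U"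
  shows "compose (carrier S) g f \<in> crm_morphisms k S U"
proof -
  note rep = S[THEN complete_restriction_monoid.principal_ideal_representation]
  note pair = representation_pair.intro[OF rep(1,2)] representation_pair.intro[OF rep(2,3)]
    representation_pair.intro[OF rep(1,3)]
  note bij = pair[THEN representation_pair.bij_betw_transfer, of k]
  obtain \<theta> where \<theta>: "\<theta> \<in> rqf_morphisms k (ideal_completion S) (ideal_completion T)"
      "f = transfer S (principal_ideal S) T (principal_ideal T) \<theta>"
    using bij(1) f by (auto simp: bij_betw_def)
  obtain \<theta>' where \<theta>': "\<theta>' \<in> rqf_morphisms k (ideal_completion T) (ideal_completion U)"
      "g = transfer T (principal_ideal T) U (principal_ideal U) \<theta>'"
    using bij(2) g by (auto simp: bij_betw_def)
  have comp: "compose (carrier (ideal_completion S)) \<theta>' \<theta>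
      \<in> rqf_morphisms k (ideal_completion S) (ideal_completion U)"
    using \<theta>(1) \<theta>'(1) S(1)[THEN complete_restriction_monoid.restriction_quantal_frame_Q]
    by (rule compose_in_rqf_morphisms)
  have "compose (carrier S) g f = transfer S (principal_ideal S) U (principal_ideal U)
      (compose (carrier (ideal_completion S)) \<theta>' \<theta>)"
    unfolding \<theta>(2) \<theta>'(2) using \<theta>(1) \<theta>'(1) comp
    by (intro transfer_compose[OF pair(1,2), symmetric]) (simp_all add: rqf_morphisms_def)
  then show ?thesis using bij_betwE[OF bij(3)] comp by simp
qed

lemma ident_in_crm_morphisms:
  assumes S: "complete_restriction_monoid S"
  shows "(\<lambda>x\<in>carrier S. x) \<in> crm_morphisms k S S"
proof -
  note rep = complete_restriction_monoid.principal_ideal_representation[OF S]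
  note Q = complete_restriction_monoid.restriction_quantal_frame_Q[OF S]
  show ?thesis
    using bij_betwE[OF representation_pair.bij_betw_transfer[OF representation_pair.intro[OF rep rep]], of k]
      ident_in_rqf_morphisms[OF Q, of k] transfer_ident[OF rep] by metis
qed

lemma is_category_crm: "is_category (crm_category k P)"
  unfolding crm_category_def
proof (rule concrete_category)
  show "f \<in> carrier S \<rightarrow>\<^sub>E carrier T" if "f \<in> crm_morphisms k S T" for S T :: "'a restr_monoid" and f
    using that by (simp add: crm_morphisms_def crm_morphism_def)
qed (auto intro: ident_in_crm_morphisms compose_in_crm_morphisms)

text \<open>The functor sends \<open>Q\<close> to a chosen representation of its partial isometries, and is fully faithful
  by \<open>bij_betw_transfer\<close>. By assumption every \<open>S\<close> represents the partial isometries of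
  some \<open>Q\<close>; it is then isomorphic to the chosen representation of the same \<open>Q\<close>, since the transfers of
  the identity of \<open>Q\<close> in the two directions are mutually inverse.\<close>

lemma equivalent_crm_rqf:
  fixes P :: "'a restr_monoid \<Rightarrow> bool" and R :: "'b lr_quantale \<Rightarrow> bool"
  assumes monoid: "\<And>Q. \<lbrakk>restriction_quantal_frame Q; R Q\<rbrakk> \<Longrightarrow> \<exists>S j. P S \<and> partial_isometry_representation S Q j"
    and quantale: "\<And>S. \<lbrakk>complete_restriction_monoid S; P S\<rbrakk> \<Longrightarrow> \<exists>Q j. R Q \<and> partial_isometry_representation S Q j"
  shows "equivalent_categories (crm_category k P) (rqf_category k R)"
proof -
  have "\<forall>Q. \<exists>p. restriction_quantal_frame Q \<and> R Q \<longrightarrow>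
      P (fst p) \<and> partial_isometry_representation (fst p) Q (snd p)"
    using monoid by fastforce
  then obtain p where p: "\<And>Q. restriction_quantal_frame Q \<and> R Q \<Longrightarrow>
      P (fst (p Q)) \<and> partial_isometry_representation (fst (p Q)) Q (snd (p Q))"
    by metis
  define M where "M Q = fst (p Q)" for Q
  define j where "j Q = snd (p Q)" for Q
  have M: "P (M Q)" "partial_isometry_representation (M Q) Q (j Q)"
    if "restriction_quantal_frame Q" "R Q" for Q
    using p that by (simp_all add: M_def j_def)
  note pair = representation_pair.intro[OF M(2) M(2)]
  define G where "G = \<lparr>on_obj = M, on_arr = (\<lambda>Q Q' \<theta>. transfer (M Q) (j Q) (M Q') (j Q') \<theta>)\<rparr>"
  show ?thesis
  proof (rule equivalent_categories_if_fully_faithful[OF is_category_crm is_category_rqf])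
    show "is_functor (rqf_category k R) (crm_category k P) G"
      unfolding is_functor_def
    proof (intro conjI ballI)
      show "on_obj G \<in> Obj (rqf_category k R) \<rightarrow> Obj (crm_category k P)"
        using M partial_isometry_representation.complete_restriction_monoid_S[OF M(2)]
        by (simp add: G_def rqf_category_def crm_category_def)
    next
      fix a b f
      assume "a \<in> Obj (rqf_category k R)" "b \<in> Obj (rqf_category k R)" "f \<in> Hom (rqf_category k R) a b"
      then show "on_arr G a b f \<in> Hom (crm_category k P) (on_obj G a) (on_obj G b)"
        using bij_betwE[OF representation_pair.bij_betw_transfer[OF pair]]
        by (simp add: G_def rqf_category_def crm_category_def)
    next
      fix a assume "a \<in> Obj (rqf_category k R)"
      then show "on_arr G a a (Ident (rqf_category k R) a) = Ident (crm_category k P) (on_obj G a)"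
        by (simp add: G_def rqf_category_def crm_category_def transfer_ident[OF M(2)])
    next
      fix a b c f g
      assume "a \<in> Obj (rqf_category k R)" "b \<in> Obj (rqf_category k R)" "c \<in> Obj (rqf_category k R)"
        "f \<in> Hom (rqf_category k R) a b" "g \<in> Hom (rqf_category k R) b c"
      then have o: "restriction_quantal_frame a" "R a" "restriction_quantal_frame b" "R b"
          "restriction_quantal_frame c" "R c"
        and f: "f \<in> rqf_morphisms k a b" and g: "g \<in> rqf_morphisms k b c"
        by (simp_all add: rqf_category_def)
      have "rqf_morphism a b f" "rqf_morphism b c g" "rqf_morphism a c (compose (carrier a) g f)"
        using f g compose_in_rqf_morphisms[OF f g o(1)] by (simp_all add: rqf_morphisms_def)
      then show "on_arr G a c (Comp (rqf_category k R) a b c g f) =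
          Comp (crm_category k P) (on_obj G a) (on_obj G b) (on_obj G c) (on_arr G b c g) (on_arr G a b f)"
        using transfer_compose[OF pair[OF o(1,2) o(3,4)] pair[OF o(3,4) o(5,6)]]
        by (simp add: G_def rqf_category_def crm_category_def)
    qed
  next
    fix a b assume "a \<in> Obj (rqf_category k R)" "b \<in> Obj (rqf_category k R)"
    then show "bij_betw (on_arr G a b) (Hom (rqf_category k R) a b)
        (Hom (crm_category k P) (on_obj G a) (on_obj G b))"
      using representation_pair.bij_betw_transfer[OF pair[of a b], of k]
      by (simp add: G_def rqf_category_def crm_category_def)
  next
    fix S assume "S \<in> Obj (crm_category k P)"
    then have "\<exists>Q j. R Q \<and> partial_isometry_representation S Q j"
      using quantale by (simp add: crm_category_def)
    then obtain Q i where "R Q" and rep: "partial_isometry_representation S Q i" by blast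
    have Q: "restriction_quantal_frame Q" using rep by (rule partial_isometry_representation.axioms)
    note rep' = M(2)[OF Q \<open>R Q\<close>]
    note pairs = representation_pair.intro[OF rep rep'] representation_pair.intro[OF rep' rep]
    note ident = ident_in_rqf_morphisms[OF Q, of k]
    let ?id = "\<lambda>x\<in>carrier Q. x"
    let ?f = "transfer S i (M Q) (j Q) ?id" and ?g = "transfer (M Q) (j Q) S i ?id"
    have id_id: "compose (carrier Q) ?id ?id = ?id" by (auto simp: compose_def)
    have id: "rqf_morphism Q Q ?id" using ident by (simp add: rqf_morphisms_def)
    have "?f \<in> crm_morphisms k S (M Q)" "?g \<in> crm_morphisms k (M Q) S"
      using pairs[THEN representation_pair.bij_betw_transfer, THEN bij_betwE] ident by blast+
    moreover have "compose (carrier S) ?g ?f = (\<lambda>x\<in>carrier S. x)"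
      using transfer_compose[OF pairs(1,2) id id] id id_id transfer_ident[OF rep] by simp
    moreover have "compose (carrier (M Q)) ?f ?g = (\<lambda>x\<in>carrier (M Q). x)"
      using transfer_compose[OF pairs(2,1) id id] id id_id transfer_ident[OF rep'] by simp
    ultimately have "?f \<in> isos (crm_category k P) S (on_obj G Q)"
      unfolding isos_def by (auto simp: crm_category_def G_def)
    then show "\<exists>Q \<in> Obj (rqf_category k R). isos (crm_category k P) S (on_obj G Q) \<noteq> {}"
      using Q \<open>R Q\<close> by (auto simp: rqf_category_def)
  qed
qed

theorem theorem1p1:
  fixes k :: nat and U :: "'u set set"
  assumes "k \<in> {1, 2, 3, 4}"
  shows "(size_universe U \<longrightarrow>
            equivalent_categories
              (crm_category k (\<lambda>S :: 'u restr_monoid. carrier S \<in> U))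
              (rqf_category k (\<lambda>Q :: 'u lr_quantale. carrier Q \<in> U)))
       \<and> equivalent_categories
            (crm_category k (\<lambda>S :: 'a restr_monoid. True))
            (rqf_category k (\<lambda>Q :: 'a set lr_quantale. partial_isometries Q \<lesssim> (UNIV :: 'a set)))"
proof (intro conjI impI)
  assume U: "size_universe U"
  have U_sub: "B \<in> U" if "A \<in> U" "B \<lesssim> A" for A B
    using U that by (auto simp: size_universe_def)
  have U_Pow: "\<exists>B \<in> U. Pow A \<approx> B" if "A \<in> U" for A
    using U that by (auto simp: size_universe_def)
  show "equivalent_categories (crm_category k (\<lambda>S :: 'u restr_monoid. carrier S \<in> U))
      (rqf_category k (\<lambda>Q :: 'u lr_quantale. carrier Q \<in> U))"
  proof (rule equivalent_crm_rqf)
    fix Q :: "'u lr_quantale" assume Q: "restriction_quantal_frame Q" "carrier Q \<in> U"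
    obtain S :: "'u restr_monoid" and j
      where S: "carrier S = (\<lambda>x. x) ` partial_isometries Q" "partial_isometry_representation S Q j"
      by (rule representation_exists[OF Q(1), of "\<lambda>x. x"]) simp_all
    have "carrier S \<subseteq> carrier Q" using S(1) by (auto simp: partial_isometries_def)
    then have "carrier S \<in> U" using U_sub Q(2) subset_imp_lepoll by blast
    then show "\<exists>(S :: 'u restr_monoid) j. carrier S \<in> U \<and> partial_isometry_representation S Q j" using S(2) by blast
  next
    fix S :: "'u restr_monoid" assume S: "complete_restriction_monoid S" "carrier S \<in> U"
    interpret S: complete_restriction_monoid S by (rule S(1))
    \<comment> \<open>closed ideals are subsets of the carrier, so a small copy of the power set holds them all\<close>
    obtain B where B: "B \<in> U" "Pow (carrier S) \<approx> B" using U_Pow S(2) by blast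
    then obtain h where h: "bij_betw h (Pow (carrier S)) B" by (auto simp: eqpoll_def)
    have sub: "carrier (ideal_completion S) \<subseteq> Pow (carrier S)" using S.ideal_subset by auto
    then have "inj_on h (carrier (ideal_completion S))"
      using h by (auto simp: bij_betw_def intro: inj_on_subset)
    then obtain Q :: "'u lr_quantale"
      where Q: "carrier Q = h ` carrier (ideal_completion S)" "quantale_copy (ideal_completion S) Q h"
      using quantale_copy_exists[OF S.restriction_quantal_frame_Q] by blast
    have "carrier Q \<subseteq> B" unfolding Q(1) using sub h by (auto simp: bij_betw_def)
    then have "carrier Q \<in> U" using U_sub B(1) subset_imp_lepoll by blast
    moreover have "partial_isometry_representation S Q (h \<circ> principal_ideal S)"
      using quantale_copy.representation_R[OF Q(2) S.principal_ideal_representation] .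
    ultimately show "\<exists>(Q :: 'u lr_quantale) j. carrier Q \<in> U \<and> partial_isometry_representation S Q j" by blast
  qed
next
  show "equivalent_categories (crm_category k (\<lambda>S :: 'a restr_monoid. True))
      (rqf_category k (\<lambda>Q :: 'a set lr_quantale. partial_isometries Q \<lesssim> (UNIV :: 'a set)))"
  proof (rule equivalent_crm_rqf)
    fix Q :: "'a set lr_quantale"
    assume Q: "restriction_quantal_frame Q" "partial_isometries Q \<lesssim> (UNIV :: 'a set)"
    then obtain c :: "'a set \<Rightarrow> 'a" where "inj_on c (partial_isometries Q)" by (auto simp: lepoll_def)
    then obtain S :: "'a restr_monoid" and j
      where "carrier S = c ` partial_isometries Q" "partial_isometry_representation S Q j"
      by (rule representation_exists[OF Q(1)])
    then show "\<exists>(S :: 'a restr_monoid) j. True \<and> partial_isometry_representation S Q j" by blast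
  next
    fix S :: "'a restr_monoid" assume "complete_restriction_monoid S"
    then interpret S: complete_restriction_monoid S .
    have "partial_isometries (ideal_completion S) \<lesssim> carrier S"
      unfolding S.partial_isometries_Q by (rule image_lepoll)
    then have "partial_isometries (ideal_completion S) \<lesssim> (UNIV :: 'a set)"
      using subset_imp_lepoll[OF subset_UNIV] by (rule lepoll_trans)
    then show "\<exists>(Q :: 'a set lr_quantale) j. partial_isometries Q \<lesssim> (UNIV :: 'a set) \<and> partial_isometry_representation S Q j"
      using S.principal_ideal_representation by blast
  qed
qed

end
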